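(* Let $(G/K,g_0,J)$ be almost Hermitian, and let $\nabla^c$ be the canonical connection on $\mathcal T(G/K)$. Let $D^{\nabla^c}$ be the Dirac operator constructed from $\nabla^c$ for $g_0$ using $J$ (which is possible since $\nabla^c$ is $G$-invariant, compatible with $g_0$ and commutes with $J$), for any character $\chi$ of $K$. Then $D^{\nabla^c}$ is formally self-adjoint.
   Context: Setting. $G$ is a connected compact semisimple Lie group with Lie algebra $\mathfrak g$; $\mathrm{Kil}$ is the negative of the Killing form; $K$ is a closed subgroup (not necessarily connected) with Lie algebra $\mathfrak k$; $\mathfrak m=\mathfrak k^\perp$ for $\mathrm{Kil}$. "$(G/K,g_0,J)$ is almost Hermitian" means: $g_0$ is an $\mathrm{Ad}(K)$-invariant inner product on $\mathfrak m$, and $J$ is a complex structure on $\mathfrak m$ ($J^2=-I$) orthogonal for $g_0$ and commuting with the $\mathrm{Ad}$-action of $K$. Vector fields. $A=C^\infty(G/K,\mathbb R)\subseteq C^\infty(G,\mathbb R)$, $A_{\mathbb C}=C^\infty(G/K,\mathbb C)$. $\mathcal T(G/K)=\{V\in C^\infty(G,\mathfrak m):V(xs)=\mathrm{Ad}_s^{-1}(V(x)),\ x\in G,s\in K\}$, an $A$-module, with $g_0$ acting pointwise so that $g_0(V,W)\in A$. The canonical connection is $(\nabla^c_VW)(x)=\frac{d}{dt}|_{t=0}W(x\exp(tV(x)))$. A standard module frame is a finite family $\{W_j\}$ in $\mathcal T(G/K)$ with $V=\sum_jW_j\,g_0(W_j,V)$ for all $V\in\mathcal T(G/K)$. Spinors.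 $\mathfrak m_J$ is $\mathfrak m$ as complex vector space with $iX=JX$ and inner product $\langle X,Y\rangle_J=g_0(X,Y)+ig_0(JX,Y)$ (linear in the second variable). $\mathcal S=\bigwedge^*\mathfrak m_J$ (complex exterior algebra) with $\langle X_1\wedge\dots\wedge X_p,Y_1\wedge\dots\wedge Y_q\rangle=\delta_{pq}\det[\langle X_k,Y_l\rangle_J]$. For $X\in\mathfrak m$, $\kappa(X)=i(a(X)+a^\dagger(X))$ on $\mathcal S$, where $a^\dagger(X)(\psi)=X\wedge\psi$ and $a(X)(X_1\wedge\dots\wedge X_p)=\sum_j(-1)^{j-1}\langle X,X_j\rangle_JX_1\wedge\dots\widehat{X_j}\dots\wedge X_p$ (this satisfies the Clifford relation $\kappa(X)\kappa(Y)+\kappa(Y)\kappa(X)=-2g_0(X,Y)$). $\widetilde{\mathrm{Ad}}$ is the action of $K$ on $\mathcal S$ by exterior-algebra automorphisms extending $\mathrm{Ad}|_K$ on $\mathfrak m_J$. For a character (one-dimensional unitary representation) $\chi$ of $K$, $\mathcal S(G/K,\chi)=\{\psi\in C^\infty(G,\mathcal S):\psi(xs)=\bar\chi(s)\widetilde{\mathrm{Ad}}_s^{-1}(\psi(x)),\ x\in G,s\in K\}$, with $\langle\psi,\varphi\rangle_{A_{\mathbb C}}(x)=\langle\psi(x),\varphi(x)\rangle$. $V\in\mathcal T(G/K)$ acts by $(\kappa(V)\psi)(x)=\kappa(V(x))\psi(x)$. Dirac operator. For the canonical connection the spinor connection is $(\nabla^c_V\psi)(x)=\frac{d}{dt}|_{t=0}\psi(x\exp(tV(x)))$,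 and $D^{\nabla^c}\psi=\sum_j\kappa(W_j)(\nabla^c_{W_j}\psi)$ for any standard module frame $\{W_j\}$ (independent of the frame). $D^{\nabla^c}$ is formally self-adjoint if $\langle D^{\nabla^c}\psi,\varphi\rangle=\langle\psi,D^{\nabla^c}\varphi\rangle$ for all $\psi,\varphi\in\mathcal S(G/K,\chi)$, where $\langle\psi,\varphi\rangle=\int_{G/K}\langle\psi,\varphi\rangle_{A_{\mathbb C}}$ with respect to the $G$-invariant measure. *)

theory Defs
  imports
    "HOL-Analysis.Analysis"
    "HOL-Algebra.Coset"
    "Jordan_Normal_Form.Determinant"
begin

hide_const (open) Determinants.det

section \<open>Smooth maps and manifolds\<close>

text \<open>The two notions below are meant for open sets S of a finite-dimensional domain.\<close>

primrec Ck_on :: "nat \<Rightarrow> 'a::real_normed_vector set \<Rightarrow> ('a \<Rightarrow> 'b::real_normed_vector) \<Rightarrow> bool" where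
  "Ck_on 0 S f \<longleftrightarrow> continuous_on S f"
| "Ck_on (Suc k) S f \<longleftrightarrow>
     (\<forall>x\<in>S. f differentiable (at x)) \<and> (\<forall>v. Ck_on k S (\<lambda>x. frechet_derivative f (at x) v))"

definition smooth_on :: "'a::real_normed_vector set \<Rightarrow> ('a \<Rightarrow> 'b::real_normed_vector) \<Rightarrow> bool" where
  "smooth_on S f \<longleftrightarrow> (\<forall>k. Ck_on k S f)"

text \<open>A chart is a pair of its domain and its coordinate map; the values of the coordinate map
  outside the domain are irrelevant.\<close>

type_synonym ('a, 'e) chart = "'a set \<times> ('a \<Rightarrow> 'e)"

definition chart_inv :: "('a, 'e) chart \<Rightarrow> 'e \<Rightarrow> 'a" where
  "chart_inv c = inv_into (fst c) (snd c)"

definition is_chart :: "('a::topological_space, 'e::euclidean_space) chart \<Rightarrow> bool" where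
  "is_chart c \<longleftrightarrow> open (fst c) \<and> open (snd c ` fst c) \<and>
     homeomorphism (fst c) (snd c ` fst c) (snd c) (chart_inv c)"

definition smooth_atlas :: "('a::topological_space, 'e::euclidean_space) chart set \<Rightarrow> bool" where
  "smooth_atlas A \<longleftrightarrow> (\<forall>c\<in>A. is_chart c) \<and> (\<Union>c\<in>A. fst c) = UNIV \<and>
     (\<forall>c\<in>A. \<forall>d\<in>A. smooth_on (snd c ` (fst c \<inter> fst d)) (snd d \<circ> chart_inv c))"

definition prod_atlas :: "('a, 'e) chart set \<Rightarrow> ('b, 'f) chart set \<Rightarrow> ('a \<times> 'b, 'e \<times> 'f) chart set" where
  "prod_atlas A B = {(fst c \<times> fst d, map_prod (snd c) (snd d)) |c d. c \<in> A \<and> d \<in> B}"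

definition vector_atlas :: "('e, 'e) chart set" where
  "vector_atlas = {(UNIV, \<lambda>x. x)}"

definition smooth_map :: "('a::topological_space, 'e::euclidean_space) chart set \<Rightarrow>
    ('b::topological_space, 'f::euclidean_space) chart set \<Rightarrow> ('a \<Rightarrow> 'b) \<Rightarrow> bool" where
  "smooth_map A B f \<longleftrightarrow> continuous_on UNIV f \<and>
     (\<forall>c\<in>A. \<forall>d\<in>B. smooth_on (snd c ` (fst c \<inter> f -` fst d)) (snd d \<circ> f \<circ> chart_inv c))"


section \<open>Lie groups\<close>

text \<open>The chart \<open>chart1\<close> around the identity is used to identify the tangent space at the identity,
  that is the Lie algebra, with the model space 'e: a tangent vector is represented by its
  coordinates in this chart. The chart is an arbitrary one, and the norm and inner product of 'e
  play no role beyond the topology and the vector space structure.\<close>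

record ('g, 'e) lie_struct = "'g monoid" +
  atlas :: "('g, 'e) chart set"
  chart1 :: "('g, 'e) chart"

definition lie_group :: "('g::{t2_space, second_countable_topology}, 'e::euclidean_space) lie_struct \<Rightarrow> bool" where
  "lie_group G \<longleftrightarrow> group G \<and> carrier G = UNIV \<and> smooth_atlas (atlas G) \<and>
     smooth_map (prod_atlas (atlas G) (atlas G)) (atlas G) (\<lambda>(x, y). x \<otimes>\<^bsub>G\<^esub> y) \<and>
     smooth_map (atlas G) (atlas G) (\<lambda>x. inv\<^bsub>G\<^esub> x) \<and>
     chart1 G \<in> atlas G \<and> \<one>\<^bsub>G\<^esub> \<in> fst (chart1 G)"

definition smooth_fun :: "('g::{t2_space, second_countable_topology}, 'e::euclidean_space) lie_struct \<Rightarrow>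
    ('g \<Rightarrow> 'b::euclidean_space) \<Rightarrow> bool" where
  "smooth_fun G f \<longleftrightarrow> smooth_map (atlas G) vector_atlas f"

text \<open>The differential at the identity of a vector-valued map.\<close>

definition diff1 :: "('g::{t2_space, second_countable_topology}, 'e::euclidean_space) lie_struct \<Rightarrow>
    ('g \<Rightarrow> 'b::real_normed_vector) \<Rightarrow> 'e \<Rightarrow> 'b" where
  "diff1 G f X =
     frechet_derivative (f \<circ> chart_inv (chart1 G)) (at (snd (chart1 G) \<one>\<^bsub>G\<^esub>)) X"

definition Ad :: "('g::{t2_space, second_countable_topology}, 'e::euclidean_space) lie_struct \<Rightarrow>
    'g \<Rightarrow> 'e \<Rightarrow> 'e" where
  "Ad G x = diff1 G (\<lambda>y. snd (chart1 G) (x \<otimes>\<^bsub>G\<^esub> y \<otimes>\<^bsub>G\<^esub> inv\<^bsub>G\<^esub> x))"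

text \<open>The Lie bracket, as the differential of the adjoint representation.\<close>

definition ad :: "('g::{t2_space, second_countable_topology}, 'e::euclidean_space) lie_struct \<Rightarrow>
    'e \<Rightarrow> 'e \<Rightarrow> 'e" where
  "ad G X Y = diff1 G (\<lambda>x. Ad G x Y) X"

definition one_parameter_subgroup ::
    "('g::{t2_space, second_countable_topology}, 'e::euclidean_space) lie_struct \<Rightarrow> 'e \<Rightarrow> (real \<Rightarrow> 'g) \<Rightarrow> bool" where
  "one_parameter_subgroup G X \<gamma> \<longleftrightarrow> smooth_map vector_atlas (atlas G) \<gamma> \<and>
     (\<forall>s t. \<gamma> (s + t) = \<gamma> s \<otimes>\<^bsub>G\<^esub> \<gamma> t) \<and>
     ((snd (chart1 G) \<circ> \<gamma>) has_vector_derivative X) (at 0)"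

definition lie_exp :: "('g::{t2_space, second_countable_topology}, 'e::euclidean_space) lie_struct \<Rightarrow>
    'e \<Rightarrow> 'g" where
  "lie_exp G X = (THE \<gamma>. one_parameter_subgroup G X \<gamma>) 1"

definition lie_ideal :: "('g::{t2_space, second_countable_topology}, 'e::euclidean_space) lie_struct \<Rightarrow>
    'e set \<Rightarrow> bool" where
  "lie_ideal G I \<longleftrightarrow> subspace I \<and> (\<forall>X\<in>I. \<forall>Y. ad G X Y \<in> I)"

definition semisimple :: "('g::{t2_space, second_countable_topology}, 'e::euclidean_space) lie_struct \<Rightarrow> bool" where
  "semisimple G \<longleftrightarrow>
     (\<forall>I. lie_ideal G I \<and> (\<forall>X\<in>I. \<forall>Y\<in>I. ad G X Y = 0) \<longrightarrow> I = {0})"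

definition Kil :: "('g::{t2_space, second_countable_topology}, 'e::euclidean_space) lie_struct \<Rightarrow>
    'e \<Rightarrow> 'e \<Rightarrow> real" where
  "Kil G X Y = - (\<Sum>b\<in>Basis. ad G X (ad G Y b) \<bullet> b)"


section \<open>The homogeneous space\<close>

text \<open>The Lie algebra of a closed subgroup, and its orthogonal complement.\<close>

definition lie_subalg :: "('g::{t2_space, second_countable_topology}, 'e::euclidean_space) lie_struct \<Rightarrow>
    'g set \<Rightarrow> 'e set" where
  "lie_subalg G K = {X. \<forall>t. lie_exp G (t *\<^sub>R X) \<in> K}"

definition m_space :: "('g::{t2_space, second_countable_topology}, 'e::euclidean_space) lie_struct \<Rightarrow>
    'g set \<Rightarrow> 'e set" where
  "m_space G K = {X. \<forall>Y\<in>lie_subalg G K. Kil G X Y = 0}"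

text \<open>Only the restrictions of \<open>g0\<close> and \<open>J\<close> to the subspace \<open>m\<close> matter.\<close>

definition inner_product_on :: "'e::real_vector set \<Rightarrow> ('e \<Rightarrow> 'e \<Rightarrow> real) \<Rightarrow> bool" where
  "inner_product_on m g0 \<longleftrightarrow>
     (\<forall>X\<in>m. \<forall>Y\<in>m. \<forall>Z\<in>m. g0 (X + Y) Z = g0 X Z + g0 Y Z) \<and>
     (\<forall>X\<in>m. \<forall>Y\<in>m. \<forall>c. g0 (c *\<^sub>R X) Y = c * g0 X Y) \<and>
     (\<forall>X\<in>m. \<forall>Y\<in>m. g0 X Y = g0 Y X) \<and>
     (\<forall>X\<in>m. X \<noteq> 0 \<longrightarrow> 0 < g0 X X)"

definition complex_structure_on :: "'e::real_vector set \<Rightarrow> ('e \<Rightarrow> 'e) \<Rightarrow> bool" where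
  "complex_structure_on m J \<longleftrightarrow>
     (\<forall>X\<in>m. J X \<in> m) \<and>
     (\<forall>X\<in>m. \<forall>Y\<in>m. J (X + Y) = J X + J Y) \<and>
     (\<forall>X\<in>m. \<forall>c. J (c *\<^sub>R X) = c *\<^sub>R J X) \<and>
     (\<forall>X\<in>m. J (J X) = - X)"

definition almost_hermitian ::
    "('g::{t2_space, second_countable_topology}, 'e::euclidean_space) lie_struct \<Rightarrow> 'g set \<Rightarrow>
     ('e \<Rightarrow> 'e \<Rightarrow> real) \<Rightarrow> ('e \<Rightarrow> 'e) \<Rightarrow> bool" where
  "almost_hermitian G K g0 J \<longleftrightarrow>
     inner_product_on (m_space G K) g0 \<and>
     (\<forall>s\<in>K. \<forall>X\<in>m_space G K. \<forall>Y\<in>m_space G K. g0 (Ad G s X) (Ad G s Y) = g0 X Y) \<and>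
     complex_structure_on (m_space G K) J \<and>
     (\<forall>X\<in>m_space G K. \<forall>Y\<in>m_space G K. g0 (J X) (J Y) = g0 X Y) \<and>
     (\<forall>s\<in>K. \<forall>X\<in>m_space G K. J (Ad G s X) = Ad G s (J X))"

definition vector_field ::
    "('g::{t2_space, second_countable_topology}, 'e::euclidean_space) lie_struct \<Rightarrow> 'g set \<Rightarrow>
     ('g \<Rightarrow> 'e) \<Rightarrow> bool" where
  "vector_field G K V \<longleftrightarrow> smooth_fun G V \<and> (\<forall>x. V x \<in> m_space G K) \<and>
     (\<forall>x. \<forall>s\<in>K. V (x \<otimes>\<^bsub>G\<^esub> s) = inv_into (m_space G K) (Ad G s) (V x))"

definition standard_module_frame ::
    "('g::{t2_space, second_countable_topology}, 'e::euclidean_space) lie_struct \<Rightarrow> 'g set \<Rightarrow>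
     ('e \<Rightarrow> 'e \<Rightarrow> real) \<Rightarrow> nat \<Rightarrow> (nat \<Rightarrow> 'g \<Rightarrow> 'e) \<Rightarrow> bool" where
  "standard_module_frame G K g0 n W \<longleftrightarrow> (\<forall>j<n. vector_field G K (W j)) \<and>
     (\<forall>V. vector_field G K V \<longrightarrow> (\<forall>x. V x = (\<Sum>j<n. g0 (W j x) (V x) *\<^sub>R W j x)))"

text \<open>The same formula gives the canonical connection on vector fields and, applied to
  spinor fields, the spinor connection derived from it.\<close>

definition canonical_connection ::
    "('g::{t2_space, second_countable_topology}, 'e::euclidean_space) lie_struct \<Rightarrow>
     ('g \<Rightarrow> 'e) \<Rightarrow> ('g \<Rightarrow> 'b::real_normed_vector) \<Rightarrow> 'g \<Rightarrow> 'b" where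
  "canonical_connection G V f x =
     vector_derivative (\<lambda>t. f (x \<otimes>\<^bsub>G\<^esub> lie_exp G (t *\<^sub>R V x))) (at 0)"

text \<open>Integration over the space of left cosets, with the quotient topology: a set of cosets is
  open iff its union is open in the group. A right-invariant function \<open>f\<close> on the group is integrated
  as the function on cosets it induces.\<close>

definition left_cosets :: "('g::{t2_space, second_countable_topology}, 'e::euclidean_space) lie_struct \<Rightarrow>
    'g set \<Rightarrow> 'g set set" where
  "left_cosets G K = (\<lambda>x. x <#\<^bsub>G\<^esub> K) ` carrier G"

definition coset_borel :: "('g::{t2_space, second_countable_topology}, 'e::euclidean_space) lie_struct \<Rightarrow>
    'g set \<Rightarrow> 'g set measure" where
  "coset_borel G K = sigma (left_cosets G K) {U. U \<subseteq> left_cosets G K \<and> open (\<Union>U)}"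

definition invariant_measure ::
    "('g::{t2_space, second_countable_topology}, 'e::euclidean_space) lie_struct \<Rightarrow> 'g set \<Rightarrow>
     'g set measure \<Rightarrow> bool" where
  "invariant_measure G K \<mu> \<longleftrightarrow> sets \<mu> = sets (coset_borel G K) \<and> finite_measure \<mu> \<and>
     emeasure \<mu> (space \<mu>) \<noteq> 0 \<and>
     (\<forall>x. \<forall>B\<in>sets \<mu>. emeasure \<mu> ((\<lambda>C. x <#\<^bsub>G\<^esub> C) ` B) = emeasure \<mu> B)"

definition coset_integral :: "'g set measure \<Rightarrow> ('g \<Rightarrow> complex) \<Rightarrow> complex" where
  "coset_integral \<mu> f = (\<integral>C. f (SOME x. x \<in> C) \<partial>\<mu>)"

definition character :: "('g::{t2_space, second_countable_topology}, 'e::euclidean_space) lie_struct \<Rightarrow>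
    'g set \<Rightarrow> ('g \<Rightarrow> complex) \<Rightarrow> bool" where
  "character G K chi \<longleftrightarrow> continuous_on K chi \<and> (\<forall>s\<in>K. norm (chi s) = 1) \<and>
     (\<forall>s\<in>K. \<forall>t\<in>K. chi (s \<otimes>\<^bsub>G\<^esub> t) = chi s * chi t)"


section \<open>Spinors\<close>

record ('e, 's) ext_alg =
  cscale :: "complex \<Rightarrow> 's \<Rightarrow> 's"
  wedge :: "'s \<Rightarrow> 's \<Rightarrow> 's"
  ext_one :: "'s"
  embed :: "'e \<Rightarrow> 's"
  ip :: "'s \<Rightarrow> 's \<Rightarrow> complex"

definition wedges :: "('e, 's) ext_alg \<Rightarrow> 'e list \<Rightarrow> 's" where
  "wedges E Xs = foldr (\<lambda>X v. wedge E (embed E X) v) Xs (ext_one E)"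

definition clinear :: "('e, 's::ab_group_add) ext_alg \<Rightarrow> ('s \<Rightarrow> 's) \<Rightarrow> bool" where
  "clinear E T \<longleftrightarrow> Vector_Spaces.linear (cscale E) (cscale E) T"

text \<open>\<open>E\<close> is a realisation, on the type 's, of the complex exterior algebra of the
  subspace \<open>m\<close> regarded as a complex vector space by means of \<open>J\<close>. It is an associative unital
  complex algebra generated by \<open>m\<close> with all squares of elements of \<open>m\<close> zero, hence a
  quotient of the exterior algebra; the last condition, that its complex dimension is 2 to the
  power of the complex dimension of \<open>m\<close>, says that it is the whole exterior algebra.
  The type 's carries the topology of a finite-dimensional vector space.\<close>

definition exterior_algebra :: "'e::euclidean_space set \<Rightarrow> ('e \<Rightarrow> 'e) \<Rightarrow> ('e, 's::euclidean_space) ext_alg \<Rightarrow> bool" where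
  "exterior_algebra m J E \<longleftrightarrow>
     vector_space (cscale E) \<and> (\<forall>r v. cscale E (complex_of_real r) v = r *\<^sub>R v) \<and>
     (\<forall>v. clinear E (\<lambda>w. wedge E v w)) \<and> (\<forall>w. clinear E (\<lambda>v. wedge E v w)) \<and>
     (\<forall>u v w. wedge E (wedge E u v) w = wedge E u (wedge E v w)) \<and>
     (\<forall>v. wedge E (ext_one E) v = v) \<and> (\<forall>v. wedge E v (ext_one E) = v) \<and>
     (\<forall>X\<in>m. \<forall>Y\<in>m. embed E (X + Y) = embed E X + embed E Y) \<and>
     (\<forall>X\<in>m. \<forall>c. embed E (c *\<^sub>R X) = c *\<^sub>R embed E X) \<and>
     (\<forall>X\<in>m. embed E (J X) = cscale E \<i> (embed E X)) \<and>
     (\<forall>X\<in>m. wedge E (embed E X) (embed E X) = 0) \<and>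
     module.span (cscale E) {wedges E Xs |Xs. set Xs \<subseteq> m} = UNIV \<and>
     vector_space.dim (cscale E) UNIV = 2 ^ (dim m div 2)"

text \<open>The Hermitian inner product on \<open>m\<close>, conjugate-linear in the first variable.\<close>

definition herm :: "('e \<Rightarrow> 'e \<Rightarrow> real) \<Rightarrow> ('e \<Rightarrow> 'e) \<Rightarrow> 'e \<Rightarrow> 'e \<Rightarrow> complex" where
  "herm g0 J X Y = Complex (g0 X Y) (g0 (J X) Y)"

definition spinor_space :: "'e::euclidean_space set \<Rightarrow> ('e \<Rightarrow> 'e \<Rightarrow> real) \<Rightarrow> ('e \<Rightarrow> 'e) \<Rightarrow>
    ('e, 's::euclidean_space) ext_alg \<Rightarrow> bool" where
  "spinor_space m g0 J E \<longleftrightarrow> exterior_algebra m J E \<and>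
     (\<forall>v. Vector_Spaces.linear (cscale E) (*) (ip E v)) \<and>
     (\<forall>v w. ip E v w = cnj (ip E w v)) \<and>
     (\<forall>v. v \<noteq> 0 \<longrightarrow> 0 < Re (ip E v v)) \<and>
     (\<forall>Xs Ys. set Xs \<subseteq> m \<and> set Ys \<subseteq> m \<longrightarrow>
        ip E (wedges E Xs) (wedges E Ys) =
          (if length Xs = length Ys
           then Determinant.det (Matrix.mat (length Xs) (length Xs) (\<lambda>(k, l). herm g0 J (Xs ! k) (Ys ! l)))
           else 0))"

definition creation :: "('e, 's) ext_alg \<Rightarrow> 'e \<Rightarrow> 's \<Rightarrow> 's" where
  "creation E X v = wedge E (embed E X) v"

text \<open>Positions in a list are counted from 0, whence the sign.\<close>

definition annihilation :: "'e set \<Rightarrow> ('e \<Rightarrow> 'e \<Rightarrow> real) \<Rightarrow> ('e \<Rightarrow> 'e) \<Rightarrow>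
    ('e, 's::ab_group_add) ext_alg \<Rightarrow> 'e \<Rightarrow> 's \<Rightarrow> 's" where
  "annihilation m g0 J E X = (THE T. clinear E T \<and>
     (\<forall>Xs. set Xs \<subseteq> m \<longrightarrow>
        T (wedges E Xs) = (\<Sum>j<length Xs. cscale E ((-1) ^ j * herm g0 J X (Xs ! j))
                                         (wedges E (take j Xs @ drop (Suc j) Xs)))))"

definition clifford :: "'e set \<Rightarrow> ('e \<Rightarrow> 'e \<Rightarrow> real) \<Rightarrow> ('e \<Rightarrow> 'e) \<Rightarrow>
    ('e, 's::ab_group_add) ext_alg \<Rightarrow> 'e \<Rightarrow> 's \<Rightarrow> 's" where
  "clifford m g0 J E X v = cscale E \<i> (annihilation m g0 J E X v + creation E X v)"

text \<open>The algebra endomorphism of the exterior algebra that extends a map \<open>T\<close> of \<open>m\<close>.\<close>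

definition ext_map :: "'e set \<Rightarrow> ('e, 's::ab_group_add) ext_alg \<Rightarrow> ('e \<Rightarrow> 'e) \<Rightarrow> 's \<Rightarrow> 's" where
  "ext_map m E T = (THE F. clinear E F \<and> F (ext_one E) = ext_one E \<and>
     (\<forall>v w. F (wedge E v w) = wedge E (F v) (F w)) \<and>
     (\<forall>X\<in>m. F (embed E X) = embed E (T X)))"

definition spinor_field ::
    "('g::{t2_space, second_countable_topology}, 'e::euclidean_space) lie_struct \<Rightarrow> 'g set \<Rightarrow>
     ('g \<Rightarrow> complex) \<Rightarrow> ('e, 's::euclidean_space) ext_alg \<Rightarrow> ('g \<Rightarrow> 's) \<Rightarrow> bool" where
  "spinor_field G K chi E \<psi> \<longleftrightarrow> smooth_fun G \<psi> \<and>
     (\<forall>x. \<forall>s\<in>K. \<psi> (x \<otimes>\<^bsub>G\<^esub> s) =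
        cscale E (cnj (chi s)) (inv_into UNIV (ext_map (m_space G K) E (Ad G s)) (\<psi> x)))"

definition dirac ::
    "('g::{t2_space, second_countable_topology}, 'e::euclidean_space) lie_struct \<Rightarrow> 'g set \<Rightarrow>
     ('e \<Rightarrow> 'e \<Rightarrow> real) \<Rightarrow> ('e \<Rightarrow> 'e) \<Rightarrow> ('e, 's::euclidean_space) ext_alg \<Rightarrow>
     nat \<Rightarrow> (nat \<Rightarrow> 'g \<Rightarrow> 'e) \<Rightarrow> ('g \<Rightarrow> 's) \<Rightarrow> 'g \<Rightarrow> 's" where
  "dirac G K g0 J E n W \<psi> x =
     (\<Sum>j<n. clifford (m_space G K) g0 J E (W j x) (canonical_connection G (W j) \<psi> x))"

definition spinor_inner :: "('e, 's) ext_alg \<Rightarrow> 'g set measure \<Rightarrow> ('g \<Rightarrow> 's) \<Rightarrow> ('g \<Rightarrow> 's) \<Rightarrow> complex" where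
  "spinor_inner E \<mu> \<psi> \<phi> = coset_integral \<mu> (\<lambda>x. ip E (\<psi> x) (\<phi> x))"

definition formally_self_adjoint ::
    "('g::{t2_space, second_countable_topology}, 'e::euclidean_space) lie_struct \<Rightarrow> 'g set \<Rightarrow>
     ('g \<Rightarrow> complex) \<Rightarrow> ('e, 's::euclidean_space) ext_alg \<Rightarrow> 'g set measure \<Rightarrow>
     (('g \<Rightarrow> 's) \<Rightarrow> 'g \<Rightarrow> 's) \<Rightarrow> bool" where
  "formally_self_adjoint G K chi E \<mu> D \<longleftrightarrow>
     (\<forall>\<psi> \<phi>. spinor_field G K chi E \<psi> \<and> spinor_field G K chi E \<phi> \<longrightarrow>
        spinor_inner E \<mu> (D \<psi>) \<phi> = spinor_inner E \<mu> \<psi> (D \<phi>))"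

end

(*
  Choose an Ad(G)-invariant inner product B on the Lie algebra and let X run through a B-orthonormal
  basis. Let P from the Lie algebra to m be the transpose of the inclusion for g0 and B. Then
  V_X(x) = P(Ad(x^-1) X) is a vector field on G/K, and for spinor fields psi, phi the function
  f_X(x) = <psi(x), kappa(V_X(x)) phi(x)> descends to G/K. Differentiating f_X along the left
  translations by exp(tX), along which V_X is constant, gives
  <psi, kappa(V_X) D_X phi> + <D_X psi, kappa(V_X) phi> with D_X the derivative in the direction
  Ad(x^-1) X; its integral over G/K vanishes by invariance of the measure. The frame property, applied
  to V_X, identifies the sum over X of the tensors Ad(x^-1) X \<otimes> V_X(x) with the sum over j of
  W_j(x) \<otimes> W_j(x). As kappa is skew, the sum of these derivatives is <psi, D phi> - <D psi, phi>.
*)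
theory Submission
  imports Defs
begin

text \<open>The flow of a frame field \<open>W j\<close> need not preserve the measure on G/K,
  whereas left translations do; this is why the frame is traded for the fields V_X. The direction of
  differentiation Ad(x^-1) X also has components outside m. They disappear in the sum because P is a
  transpose: the vectors u = Ad(x^-1) X are again B-orthonormal, so the sum of u \<otimes> P u is
  the inverse of g0 in m \<otimes> m, for every g0. The B-orthogonal projection in place of P would
  give the inverse of the restriction of B instead. The frame property speaks of global fields only;
  the fields V_X are what makes it usable at a single point. Neither <D psi, phi> nor <psi, D phi>
  is shown to descend to G/K or to be integrable; only their difference is integrated.
  \<open>lie_exp\<close> is a definite description, so existence and uniqueness of one-parameter
  subgroups must be proved before the connection can be computed. This accounts for the calculus and
  the differential equations.\<close>

no_notation Matrix.scalar_prod (infix \<open>\<bullet>\<close> 70)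

section \<open>Calculus of smooth maps\<close>

lemma frechet_derivative_eqI:
  "(f has_derivative f') (at x) \<Longrightarrow> frechet_derivative f (at x) v = f' v"
  using frechet_derivative_at by metis

lemma differentiable_has_frechet_derivative:
  "f differentiable at x \<Longrightarrow> (f has_derivative frechet_derivative f (at x)) (at x)"
  by (simp add: frechet_derivative_works[symmetric])

lemma linear_euclidean_expand:
  fixes h :: "'a::euclidean_space \<Rightarrow> 'b::real_vector"
  assumes "linear h"
  shows "h w = (\<Sum>b\<in>Basis. (w \<bullet> b) *\<^sub>R h b)"
proof -
  have "h w = h (\<Sum>b\<in>Basis. (w \<bullet> b) *\<^sub>R b)" by (simp add: euclidean_representation)
  also have "\<dots> = (\<Sum>b\<in>Basis. (w \<bullet> b) *\<^sub>R h b)"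
    by (simp add: linear_sum[OF assms] linear_cmul[OF assms])
  finally show ?thesis .
qed

lemma Ck_on_imp_continuous_on: "Ck_on k S f \<Longrightarrow> continuous_on S f"
  by (cases k) (auto simp: continuous_at_imp_continuous_on differentiable_imp_continuous_within)

lemma Ck_on_SucD: "Ck_on (Suc k) S f \<Longrightarrow> Ck_on k S f"
proof (induction k arbitrary: f)
  case 0
  then show ?case using Ck_on_imp_continuous_on[OF 0] by simp
next
  case (Suc k)
  from Suc.prems have "\<And>v. Ck_on (Suc k) S (\<lambda>x. frechet_derivative f (at x) v)"
    by (metis Ck_on.simps(2))
  then show ?case using Suc.IH Suc.prems by (metis Ck_on.simps(2))
qed

text \<open>\<open>Ck_on\<close> takes derivatives \<open>at x\<close> in the whole space, so they
  see the values near \<open>x\<close> and not only those on \<open>S\<close>; openness of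
  \<open>S\<close> makes agreement on \<open>S\<close> enough.\<close>

lemma Ck_on_cong:
  assumes "open S" "\<And>x. x \<in> S \<Longrightarrow> f x = g x" "Ck_on k S f"
  shows "Ck_on k S g"
  using assms(2,3)
proof (induction k arbitrary: f g)
  case 0
  then show ?case using continuous_on_cong by (metis Ck_on.simps(1))
next
  case (Suc k)
  have D: "(g has_derivative frechet_derivative f (at x)) (at x)" if "x \<in> S" for x
    using Suc.prems that assms(1)
    by (metis Ck_on.simps(2) differentiable_has_frechet_derivative has_derivative_transform_within_open)
  have "g differentiable at x" if "x \<in> S" for x
    using D[OF that] differentiable_def by blast
  moreover have "Ck_on k S (\<lambda>x. frechet_derivative g (at x) v)" for v
  proof (rule Suc.IH)
    show "Ck_on k S (\<lambda>x. frechet_derivative f (at x) v)" using Suc.prems by simp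
  qed (use D frechet_derivative_eqI in metis)
  ultimately show ?case by simp
qed

lemma Ck_on_subset: "Ck_on k S f \<Longrightarrow> T \<subseteq> S \<Longrightarrow> Ck_on k T f"
  by (induction k arbitrary: f) (auto intro: continuous_on_subset)

text \<open>Allows smoothness in a pair of charts to be checked near each point separately, where a
  further chart can be inserted.\<close>

lemma Ck_on_local:
  assumes "\<And>x. x \<in> S \<Longrightarrow> \<exists>T. open T \<and> x \<in> T \<and> Ck_on k T f"
  shows "Ck_on k S f"
  using assms
proof (induction k arbitrary: f)
  case 0
  then have "\<forall>x\<in>S. isCont f x"
    by (metis Ck_on.simps(1) continuous_on_eq_continuous_at)
  then show ?case by (simp add: continuous_at_imp_continuous_on)
next
  case (Suc k)
  have "f differentiable at x" if "x \<in> S" for x using Suc.prems[OF that] by auto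
  moreover have "Ck_on k S (\<lambda>x. frechet_derivative f (at x) v)" for v
  proof (rule Suc.IH)
    show "\<exists>T. open T \<and> x \<in> T \<and> Ck_on k T (\<lambda>x. frechet_derivative f (at x) v)" if "x \<in> S" for x
      using Suc.prems[OF that] by auto
  qed
  ultimately show ?case by simp
qed

lemma Ck_on_const: "Ck_on k S (\<lambda>x. c)"
  by (induction k arbitrary: c) auto

lemma Ck_on_bounded_linear_comp:
  assumes "open S" "bounded_linear h" "Ck_on k S f"
  shows "Ck_on k S (\<lambda>x. h (f x))"
  using assms(3)
proof (induction k arbitrary: f)
  case 0
  then show ?case using bounded_linear.continuous_on[OF assms(2)] by simp
next
  case (Suc k)
  have D: "((\<lambda>x. h (f x)) has_derivative (\<lambda>v. h (frechet_derivative f (at x) v))) (at x)"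
    if "x \<in> S" for x
    using Suc.prems that
    by (intro bounded_linear.has_derivative[OF assms(2)] differentiable_has_frechet_derivative) auto
  have "Ck_on k S (\<lambda>x. frechet_derivative (\<lambda>x. h (f x)) (at x) v)" for v
    by (rule Ck_on_cong[OF assms(1) _ Suc.IH[of "\<lambda>x. frechet_derivative f (at x) v"]])
      (use frechet_derivative_eqI[OF D] Suc.prems in auto)
  then show ?case using D differentiable_def by (metis Ck_on.simps(2))
qed

lemma Ck_on_add:
  assumes "open S" "Ck_on k S f" "Ck_on k S g"
  shows "Ck_on k S (\<lambda>x. f x + g x)"
  using assms(2,3)
proof (induction k arbitrary: f g)
  case 0
  then show ?case by (auto intro: continuous_on_add)
next
  case (Suc k)
  have D: "((\<lambda>x. f x + g x) has_derivative
      (\<lambda>v. frechet_derivative f (at x) v + frechet_derivative g (at x) v)) (at x)"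
    if "x \<in> S" for x
    using Suc.prems that
    by (intro has_derivative_add differentiable_has_frechet_derivative) auto
  have "Ck_on k S (\<lambda>x. frechet_derivative (\<lambda>x. f x + g x) (at x) v)" for v
    by (rule Ck_on_cong[OF assms(1) _ Suc.IH[of "\<lambda>x. frechet_derivative f (at x) v"
            "\<lambda>x. frechet_derivative g (at x) v"]])
      (use frechet_derivative_eqI[OF D] Suc.prems in auto)
  then show ?case using D differentiable_def by (metis Ck_on.simps(2))
qed

lemma Ck_on_sum:
  assumes "open S" "\<And>i. i \<in> I \<Longrightarrow> Ck_on k S (f i)"
  shows "Ck_on k S (\<lambda>x. \<Sum>i\<in>I. f i x)"
proof (cases "finite I")
  case True
  then show ?thesis using assms(2)
    by (induction I rule: finite_induct) (auto simp: Ck_on_const intro!: Ck_on_add assms(1))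
qed (simp add: Ck_on_const)

lemma Ck_on_bounded_bilinear:
  assumes "open S" "bounded_bilinear h" "Ck_on k S f" "Ck_on k S g"
  shows "Ck_on k S (\<lambda>x. h (f x) (g x))"
  using assms(3,4)
proof (induction k arbitrary: f g)
  case 0
  then show ?case using bounded_bilinear.continuous_on[OF assms(2)] by auto
next
  case (Suc k)
  have D: "((\<lambda>x. h (f x) (g x)) has_derivative
      (\<lambda>v. h (f x) (frechet_derivative g (at x) v) + h (frechet_derivative f (at x) v) (g x))) (at x)"
    if "x \<in> S" for x
    using Suc.prems that
    by (intro bounded_bilinear.FDERIV[OF assms(2)] differentiable_has_frechet_derivative) auto
  have ck: "Ck_on k S f" "Ck_on k S g" using Suc.prems Ck_on_SucD by blast+
  have "Ck_on k S (\<lambda>x. frechet_derivative (\<lambda>x. h (f x) (g x)) (at x) v)" for v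
  proof (rule Ck_on_cong[OF assms(1)])
    show "Ck_on k S (\<lambda>x. h (f x) (frechet_derivative g (at x) v) + h (frechet_derivative f (at x) v) (g x))"
      using Suc.prems ck by (intro Ck_on_add[OF assms(1)] Suc.IH) simp_all
  qed (use frechet_derivative_eqI[OF D] in simp)
  then show ?case using D differentiable_def by (metis Ck_on.simps(2))
qed

text \<open>\<open>Ck_on\<close> differentiates in fixed directions, but the chain rule yields the
  derivative of \<open>f\<close> in the moving direction Dg(x)v. Expanding that direction over
  \<open>Basis\<close> gives a sum of products of a coordinate of Dg(x)v with a fixed partial
  derivative of \<open>f\<close> composed with \<open>g\<close>. The latter falls under the
  induction hypothesis, which is why \<open>f\<close> is generalised.\<close>

lemma Ck_on_compose:
  fixes f :: "'b::euclidean_space \<Rightarrow> 'c::real_normed_vector" and g :: "'a::real_normed_vector \<Rightarrow> 'b"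
  assumes "open S" "Ck_on k S g" "Ck_on k T f" "g ` S \<subseteq> T"
  shows "Ck_on k S (f \<circ> g)"
  using assms(2,3)
proof (induction k arbitrary: f)
  case 0
  then show ?case using continuous_on_compose2[of T f S g, OF _ _ assms(4)] by (simp add: o_def)
next
  case (Suc k)
  have D: "(f \<circ> g has_derivative (\<lambda>v. \<Sum>b\<in>Basis. (frechet_derivative g (at x) v \<bullet> b) *\<^sub>R
       frechet_derivative f (at (g x)) b)) (at x)"
    if "x \<in> S" for x
  proof -
    have df: "(f has_derivative frechet_derivative f (at (g x))) (at (g x))"
      using Suc.prems that assms(4) by (intro differentiable_has_frechet_derivative) auto
    have "(f \<circ> g has_derivative frechet_derivative f (at (g x)) \<circ> frechet_derivative g (at x)) (at x)"
      using Suc.prems that by (intro diff_chain_at df differentiable_has_frechet_derivative) auto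
    moreover have "linear (frechet_derivative f (at (g x)))"
      using df has_derivative_bounded_linear bounded_linear.linear by blast
    then have "frechet_derivative f (at (g x)) \<circ> frechet_derivative g (at x) =
        (\<lambda>v. \<Sum>b\<in>Basis. (frechet_derivative g (at x) v \<bullet> b) *\<^sub>R frechet_derivative f (at (g x)) b)"
      unfolding o_def by (intro ext linear_euclidean_expand)
    ultimately show ?thesis by metis
  qed
  have ck: "Ck_on k S g" using Suc.prems Ck_on_SucD by blast
  have "Ck_on k S (\<lambda>x. \<Sum>b\<in>Basis. (frechet_derivative g (at x) v \<bullet> b) *\<^sub>R
       frechet_derivative f (at (g x)) b)" for v
  proof (intro Ck_on_sum assms(1) Ck_on_bounded_bilinear[OF assms(1) bounded_bilinear_scaleR])
    fix b :: 'b
    show "Ck_on k S (\<lambda>x. frechet_derivative g (at x) v \<bullet> b)"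
      using Suc.prems by (intro Ck_on_bounded_linear_comp[OF assms(1) bounded_linear_inner_left]) auto
    show "Ck_on k S (\<lambda>x. frechet_derivative f (at (g x)) b)"
      using Suc.IH[of "\<lambda>y. frechet_derivative f (at y) b"] Suc.prems ck by (simp add: o_def)
  qed
  then have "Ck_on k S (\<lambda>x. frechet_derivative (f \<circ> g) (at x) v)" for v
    by (rule Ck_on_cong[OF assms(1), rotated]) (use frechet_derivative_eqI[OF D] in auto)
  moreover have "\<forall>x\<in>S. f \<circ> g differentiable at x" using D differentiable_def by blast
  ultimately show ?case unfolding Ck_on.simps(2) by blast
qed

lemma smooth_on_imp_continuous_on: "smooth_on S f \<Longrightarrow> continuous_on S f"
  using Ck_on_imp_continuous_on unfolding smooth_on_def by blast

lemma smooth_on_imp_differentiable: "smooth_on S f \<Longrightarrow> x \<in> S \<Longrightarrow> f differentiable at x"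
  unfolding smooth_on_def by (metis Ck_on.simps(2))

lemma smooth_on_frechet_derivative:
  "smooth_on S f \<Longrightarrow> smooth_on S (\<lambda>x. frechet_derivative f (at x) v)"
  unfolding smooth_on_def by (metis Ck_on.simps(2))

lemma smooth_on_cong:
  "open S \<Longrightarrow> (\<And>x. x \<in> S \<Longrightarrow> f x = g x) \<Longrightarrow> smooth_on S f \<Longrightarrow> smooth_on S g"
  unfolding smooth_on_def using Ck_on_cong by blast

lemma smooth_on_subset: "smooth_on S f \<Longrightarrow> T \<subseteq> S \<Longrightarrow> smooth_on T f"
  unfolding smooth_on_def using Ck_on_subset by blast

lemma smooth_on_local:
  assumes "\<And>x. x \<in> S \<Longrightarrow> \<exists>T. open T \<and> x \<in> T \<and> smooth_on T f"
  shows "smooth_on S f"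
  using assms Ck_on_local unfolding smooth_on_def by metis

lemma smooth_on_const: "smooth_on S (\<lambda>x. c)"
  unfolding smooth_on_def by (simp add: Ck_on_const)

lemma smooth_on_bounded_linear_comp:
  "open S \<Longrightarrow> bounded_linear h \<Longrightarrow> smooth_on S f \<Longrightarrow> smooth_on S (\<lambda>x. h (f x))"
  unfolding smooth_on_def using Ck_on_bounded_linear_comp by blast

lemma smooth_on_add:
  "open S \<Longrightarrow> smooth_on S f \<Longrightarrow> smooth_on S g \<Longrightarrow> smooth_on S (\<lambda>x. f x + g x)"
  unfolding smooth_on_def using Ck_on_add by blast

lemma smooth_on_compose:
  fixes f :: "'b::euclidean_space \<Rightarrow> 'c::real_normed_vector" and g :: "'a::real_normed_vector \<Rightarrow> 'b"
  shows "open S \<Longrightarrow> smooth_on S g \<Longrightarrow> smooth_on T f \<Longrightarrow> g ` S \<subseteq> T \<Longrightarrow> smooth_on S (f \<circ> g)"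
  unfolding smooth_on_def using Ck_on_compose by blast

lemma Ck_on_ident: "Ck_on k S (\<lambda>x. x)"
  by (cases k) (auto simp: Ck_on_const)

lemma smooth_on_ident: "smooth_on S (\<lambda>x. x)"
  unfolding smooth_on_def by (simp add: Ck_on_ident)

lemma smooth_on_bounded_linear: "bounded_linear h \<Longrightarrow> smooth_on S h"
  using smooth_on_subset[OF smooth_on_bounded_linear_comp[OF open_UNIV _ smooth_on_ident]] by simp

lemma smooth_on_Pair:
  assumes "open S" "smooth_on S f" "smooth_on S g"
  shows "smooth_on S (\<lambda>x. (f x, g x))"
proof -
  have "bounded_linear (\<lambda>x. (x, 0))" "bounded_linear (\<lambda>x. (0, x))"
    by (auto intro: bounded_linear_Pair bounded_linear_ident bounded_linear_zero)
  with smooth_on_add[OF assms(1) smooth_on_bounded_linear_comp[OF assms(1) _ assms(2)]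
      smooth_on_bounded_linear_comp[OF assms(1) _ assms(3)]]
  show ?thesis by (fastforce simp: plus_prod_def)
qed

section \<open>Ordinary differential equations\<close>

text \<open>Compactness of the ball bounds each partial derivative separately; the sum of these
  bounds over \<open>Basis\<close> dominates the operator norm, and convexity of the ball makes it a
  Lipschitz constant.\<close>

lemma C1_bounded_lipschitz:
  fixes F :: "'e::euclidean_space \<Rightarrow> 'b::real_normed_vector"
  assumes S: "cball p r \<subseteq> S" and F: "Ck_on (Suc 0) S F"
  obtains M L where "0 \<le> M" "0 \<le> L" "\<And>x. x \<in> cball p r \<Longrightarrow> norm (F x) \<le> M"
    "\<And>x y. x \<in> cball p r \<Longrightarrow> y \<in> cball p r \<Longrightarrow> norm (F x - F y) \<le> L * norm (x - y)"
proof -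
  have bdd: "\<exists>B\<ge>0. \<forall>x\<in>cball p r. norm (h x) \<le> B" if "continuous_on S h" for h :: "'e \<Rightarrow> 'b"
  proof -
    have "bounded (h ` cball p r)"
      using that S by (intro compact_imp_bounded compact_continuous_image) (auto intro: continuous_on_subset)
    then obtain B where "\<forall>x\<in>cball p r. norm (h x) \<le> B" by (auto simp: bounded_iff)
    then show ?thesis by (intro exI[of _ "max B 0"]) (auto simp: le_max_iff_disj)
  qed
  obtain M where M: "M \<ge> 0" "\<forall>x\<in>cball p r. norm (F x) \<le> M"
    using bdd[OF Ck_on_imp_continuous_on[OF F]] by auto
  have "\<forall>v. \<exists>B\<ge>0. \<forall>x\<in>cball p r. norm (frechet_derivative F (at x) v) \<le> B"
    using F by (intro allI bdd) auto
  then obtain B where B: "\<And>v. B v \<ge> 0" "\<And>x v. x \<in> cball p r \<Longrightarrow> norm (frechet_derivative F (at x) v) \<le> B v"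
    by metis
  define L where "L = (\<Sum>b\<in>Basis. B b)"
  have D: "(F has_derivative frechet_derivative F (at x)) (at x)" if "x \<in> cball p r" for x
    using F S that by (intro differentiable_has_frechet_derivative) auto
  have on: "onorm (frechet_derivative F (at x)) \<le> L" if "x \<in> cball p r" for x
  proof (rule onorm_bound)
    show "0 \<le> L" unfolding L_def using B by (intro sum_nonneg) auto
    fix w :: 'e
    have lin: "linear (frechet_derivative F (at x))"
      using D[OF that] has_derivative_bounded_linear bounded_linear.linear by blast
    have "frechet_derivative F (at x) w = (\<Sum>b\<in>Basis. (w \<bullet> b) *\<^sub>R frechet_derivative F (at x) b)"
      by (rule linear_euclidean_expand[OF lin])
    also have "norm \<dots> \<le> (\<Sum>b\<in>Basis. norm w * B b)"
      using B(1) B(2)[OF that]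
      by (intro sum_norm_le) (auto intro!: mult_mono Basis_le_norm)
    finally show "norm (frechet_derivative F (at x) w) \<le> L * norm w"
      by (simp add: L_def sum_distrib_left mult.commute)
  qed
  have "norm (F x - F y) \<le> L * norm (x - y)" if "x \<in> cball p r" "y \<in> cball p r" for x y
    by (rule differentiable_bound[OF convex_cball has_derivative_at_withinI[OF D] on that(1,2)])
  moreover have "L \<ge> 0" unfolding L_def using B by (intro sum_nonneg) auto
  ultimately show ?thesis using M that by blast
qed

text \<open>The Picard operator is a contraction on the continuous functions with values in the
  closed ball. They form a closed subset of \<open>bcontfun\<close> and so are defined on the whole
  real line, although the equation is solved only near 0.\<close>

lemma picard_local:
  fixes F :: "'e::euclidean_space \<Rightarrow> 'e"
  assumes S: "open S" "p \<in> S" and F: "Ck_on (Suc 0) S F"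
  obtains e c where "0 < e" "c 0 = p"
    "\<And>t. \<bar>t\<bar> < e \<Longrightarrow> c t \<in> S" "\<And>t. \<bar>t\<bar> < e \<Longrightarrow> (c has_vector_derivative F (c t)) (at t)"
proof -
  obtain r where r: "r > 0" "cball p r \<subseteq> S"
    using S open_contains_cball by blast
  obtain M L where M: "0 \<le> M" "\<And>x. x \<in> cball p r \<Longrightarrow> norm (F x) \<le> M"
    and L: "0 \<le> L" "\<And>x y. x \<in> cball p r \<Longrightarrow> y \<in> cball p r \<Longrightarrow> norm (F x - F y) \<le> L * norm (x - y)"
    using C1_bounded_lipschitz[OF r(2) F] by metis
  \<comment> \<open>Each integral runs over an interval of length at most 2e, and the operator
    contains two of them: it moves \<open>p\<close> by at most 4eM and has Lipschitz constant 4eL.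
    The choice of \<open>e\<close> makes these at most \<open>r\<close> and 1/2; the summands 1 keep
    the denominators positive.\<close>
  define e where "e = min (r / (4 * (M + 1))) (1 / (8 * (L + 1)))"
  have e: "e > 0" "4 * e * M \<le> r" "4 * e * L \<le> 1 / 2"
  proof -
    show "e > 0" using M L r by (auto simp: e_def)
    then have "4 * e * M \<le> 4 * e * (M + 1)" "4 * e * L \<le> 4 * e * (L + 1)" by auto
    moreover have "4 * e * (M + 1) \<le> r" "4 * e * (L + 1) \<le> 1 / 2"
    proof -
      have "e \<le> r / (4 * (M + 1))" "e \<le> 1 / (8 * (L + 1))" by (simp_all add: e_def)
      then show "4 * e * (M + 1) \<le> r" "4 * e * (L + 1) \<le> 1 / 2"
        using M(1) L(1) by (simp_all add: pos_le_divide_eq algebra_simps)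
    qed
    ultimately show "4 * e * M \<le> r" "4 * e * L \<le> 1 / 2" by linarith+
  qed
  define X where "X = (PiC UNIV (\<lambda>_. cball p r) :: (real, 'e) bcontfun set)"
  have contF: "continuous_on (cball p r) F"
    using Ck_on_imp_continuous_on[OF F] r continuous_on_subset by blast
  have Xc: "continuous_on T (\<lambda>t. F (u t))" and Xr: "u t \<in> cball p r" if "u \<in> X" for u T t
  proof -
    show 1: "u t \<in> cball p r" for t using that unfolding X_def by (auto simp: mem_PiC_iff)
    show "continuous_on T (\<lambda>t. F (u t))"
      by (rule continuous_on_compose2[OF contF]) (use 1 in auto)
  qed
  \<comment> \<open>Starting the integral at -e, and later subtracting its value at 0, avoids
    oriented integrals for negative \<open>t\<close>.\<close>
  define I where "I u t = integral {-e..t} (\<lambda>s. F (apply_bcontfun u s))" for u t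
  have Ib: "norm (I u t) \<le> 2 * e * M" if "u \<in> X" "t \<in> {-e..e}" for u t
  proof -
    have "norm (I u t) \<le> M * (t - - e)" unfolding I_def
      by (rule integral_bound) (use that Xc Xr M in auto)
    also have "\<dots> \<le> M * (2 * e)" using that M by (intro mult_left_mono) auto
    finally show ?thesis by (simp add: mult_ac)
  qed
  have Id: "norm (I u t - I w t) \<le> 2 * e * (L * dist u w)" if "u \<in> X" "w \<in> X" "t \<in> {-e..e}" for u w t
  proof -
    have "I u t - I w t = integral {-e..t} (\<lambda>s. F (u s) - F (w s))"
      unfolding I_def by (intro integral_diff[symmetric] integrable_continuous_real Xc that)
    also have "norm \<dots> \<le> (L * dist u w) * (t - - e)"
    proof (rule integral_bound)
      fix s
      have "norm (F (u s) - F (w s)) \<le> L * norm (u s - w s)" using L(2) Xr that by blast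
      also have "\<dots> \<le> L * dist u w" using L(1) dist_bounded[of u s w] by (intro mult_left_mono) (auto simp: dist_norm)
      finally show "norm (F (u s) - F (w s)) \<le> L * dist u w" .
    qed (use that Xc in \<open>auto intro!: continuous_on_diff\<close>)
    also have "\<dots> \<le> (L * dist u w) * (2 * e)" using that L by (intro mult_left_mono) auto
    finally show ?thesis by (simp add: mult_ac)
  qed
  have dI: "(I u has_vector_derivative F (u t)) (at t within {-e..e})" if "u \<in> X" "t \<in> {-e..e}" for u t
    using integral_has_vector_derivative[OF Xc[OF that(1)], of t "-e" e] that(2) unfolding I_def by auto
  define H where "H u t = p + I u t - I u 0" for u t
  have dH: "(H u has_vector_derivative F (u t)) (at t within {-e..e})" if "u \<in> X" "t \<in> {-e..e}" for u t
    unfolding H_def using dI[OF that] by (auto intro!: derivative_eq_intros)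
  \<comment> \<open>\<open>clamp\<close> freezes the argument at the ends of [-e,e]; this extends a
    continuous function on the interval to a bounded continuous one on the line.\<close>
  have "\<forall>u\<in>X. \<exists>g :: (real, 'e) bcontfun. \<forall>t. g t = H u (clamp (-e) e t)"
  proof
    fix u assume "u \<in> X"
    then have "continuous_on (cbox (-e) e) (H u)"
      unfolding cbox_interval continuous_on_eq_continuous_within
      by (intro ballI has_vector_derivative_continuous[OF dH])
    then show "\<exists>g :: (real, 'e) bcontfun. \<forall>t. g t = H u (clamp (-e) e t)"
      by (rule continuous_on_cbox_bcontfunE) blast
  qed
  then obtain \<Phi> where \<Phi>: "\<And>u t. u \<in> X \<Longrightarrow> apply_bcontfun (\<Phi> u) t = H u (clamp (-e) e t)" by metis
  have cl: "clamp (-e) e t \<in> {-e..e}" for t :: real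
    using clamp_in_interval[of "-e" e t] e by auto
  have zero: "0 \<in> {-e..e}" using e(1) by simp
  have "\<exists>!u\<in>X. \<Phi> u = u"
  proof (rule Banach_fix[of X "1/2"])
    show "complete X" unfolding X_def complete_eq_closed by (rule closed_PiC) auto
    have "const_bcontfun p \<in> X" using r by (auto simp: X_def mem_PiC_iff)
    then show "X \<noteq> {}" by auto
    show "\<Phi> ` X \<subseteq> X"
    proof safe
      fix u assume u: "u \<in> X"
      have "norm (H u t - p) \<le> r" if "t \<in> {-e..e}" for t
      proof -
        have "norm (I u t - I u 0) \<le> 2 * e * M + 2 * e * M"
          using Ib[OF u that] Ib[OF u zero] norm_triangle_ineq4[of "I u t" "I u 0"] by linarith
        moreover have "H u t - p = I u t - I u 0" by (simp add: H_def)
        ultimately show ?thesis using e(2) by (simp add: mult_ac)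
      qed
      then show "\<Phi> u \<in> X" using cl u
        by (auto simp: X_def mem_PiC_iff \<Phi>[OF u] dist_norm norm_minus_commute)
    qed
    show "dist (\<Phi> u) (\<Phi> w) \<le> 1 / 2 * dist u w" if uw: "u \<in> X" "w \<in> X" for u w
    proof -
      have "dist (\<Phi> u t) (\<Phi> w t) \<le> 1 / 2 * dist u w" for t
      proof -
        define s where "s = clamp (-e) e t"
        have s: "s \<in> {-e..e}" using cl s_def by auto
        have "norm (H u s - H w s) = norm ((I u s - I w s) - (I u 0 - I w 0))"
          by (simp add: H_def algebra_simps)
        also have "\<dots> \<le> 2 * e * (L * dist u w) + 2 * e * (L * dist u w)"
          using Id[OF uw s] Id[OF uw zero] norm_triangle_ineq4[of "I u s - I w s" "I u 0 - I w 0"] by linarith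
        also have "\<dots> = 4 * e * L * dist u w" by simp
        also have "\<dots> \<le> 1 / 2 * dist u w" by (rule mult_right_mono[OF e(3) zero_le_dist])
        finally show ?thesis by (simp add: \<Phi> uw s_def dist_norm)
      qed
      then show "dist (\<Phi> u) (\<Phi> w) \<le> 1 / 2 * dist u w" by (rule dist_bound)
    qed
  qed auto
  then obtain u where u: "u \<in> X" "\<Phi> u = u" by blast
  have uH: "u t = H u t" if "t \<in> {-e..e}" for t
    using \<Phi>[OF u(1), of t] u(2) that clamp_cancel_cbox[of t "-e" e] by auto
  show thesis
  proof
    show "u 0 = p" using uH[OF zero] by (simp add: H_def)
    show "u t \<in> S" if "\<bar>t\<bar> < e" for t using Xr[OF u(1)] r by blast
    show "(u has_vector_derivative F (u t)) (at t)" if "\<bar>t\<bar> < e" for t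
    proof -
      have "(H u has_vector_derivative F (u t)) (at t within {-e<..<e})"
        by (rule has_vector_derivative_within_subset[OF dH[OF u(1)]]) (use that in auto)
      then have "(H u has_vector_derivative F (u t)) (at t)"
        using that at_within_open[of t "{-e<..<e}"] by (simp add: abs_less_iff minus_less_iff)
      then show ?thesis
        by (rule has_vector_derivative_transform_within_open[where S = "{-e<..<e}"]) (use that uH in auto)
    qed
  qed fact
qed

text \<open>Bootstrapping: the derivative of \<open>c\<close> is \<open>F\<close> composed with
  \<open>c\<close>, hence as often differentiable as \<open>c\<close>, so one order is gained at
  each step.\<close>

lemma ode_solution_smooth:
  fixes F :: "'e::euclidean_space \<Rightarrow> 'e"
  assumes "smooth_on S F" "\<And>t. \<bar>t\<bar> < e \<Longrightarrow> c t \<in> S"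
    and D: "\<And>t. \<bar>t\<bar> < e \<Longrightarrow> (c has_vector_derivative F (c t)) (at t)"
  shows "smooth_on {-e<..<e} c"
proof -
  have D': "(c has_derivative (\<lambda>v. v *\<^sub>R F (c t))) (at t)" if "t \<in> {-e<..<e}" for t
    using D[of t] that by (auto simp: has_vector_derivative_def)
  have "Ck_on k {-e<..<e} c" for k
  proof (induction k)
    case 0
    have "isCont c t" if "t \<in> {-e<..<e}" for t
      using that by (intro has_vector_derivative_continuous[OF D]) auto
    then show ?case by (simp add: continuous_at_imp_continuous_on)
  next
    case (Suc k)
    have "Ck_on k {-e<..<e} (F \<circ> c)"
      by (rule Ck_on_compose[OF _ Suc]) (use assms in \<open>auto simp: smooth_on_def\<close>)
    then have "Ck_on k {-e<..<e} (\<lambda>t. v *\<^sub>R (F \<circ> c) t)" for v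
      by (intro Ck_on_bounded_linear_comp[OF open_greaterThanLessThan bounded_linear_scaleR_right])
    then have "Ck_on k {-e<..<e} (\<lambda>t. frechet_derivative c (at t) v)" for v
      by (rule Ck_on_cong[rotated -1]) (use frechet_derivative_eqI[OF D'] in auto)
    moreover have "\<forall>t\<in>{-e<..<e}. c differentiable at t" using D' differentiable_def by blast
    ultimately show ?case by simp
  qed
  then show ?thesis unfolding smooth_on_def by blast
qed

section \<open>Smooth maps in charts\<close>

lemma is_chart_open: "is_chart c \<Longrightarrow> open (fst c)" "is_chart c \<Longrightarrow> open (snd c ` fst c)"
  by (auto simp: is_chart_def)

lemma chart_inv_right: "is_chart c \<Longrightarrow> x \<in> fst c \<Longrightarrow> chart_inv c (snd c x) = x"
  unfolding is_chart_def homeomorphism_def by blast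

lemma chart_inv_left: "is_chart c \<Longrightarrow> q \<in> snd c ` fst c \<Longrightarrow> snd c (chart_inv c q) = q"
  using chart_inv_right by fastforce

lemma chart_inv_mem: "is_chart c \<Longrightarrow> q \<in> snd c ` fst c \<Longrightarrow> chart_inv c q \<in> fst c"
  using chart_inv_right by fastforce

lemma continuous_on_chart: "is_chart c \<Longrightarrow> continuous_on (fst c) (snd c)"
  unfolding is_chart_def homeomorphism_def by blast

lemma continuous_on_chart_inv: "is_chart c \<Longrightarrow> continuous_on (snd c ` fst c) (chart_inv c)"
  unfolding is_chart_def homeomorphism_def by blast

lemma chart_image_iff:
  assumes "is_chart c"
  shows "q \<in> snd c ` (fst c \<inter> U) \<longleftrightarrow> q \<in> snd c ` fst c \<and> chart_inv c q \<in> U"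
proof
  assume "q \<in> snd c ` (fst c \<inter> U)"
  then obtain x where "x \<in> fst c" "x \<in> U" "q = snd c x" by auto
  then show "q \<in> snd c ` fst c \<and> chart_inv c q \<in> U" using chart_inv_right[OF assms] by simp
next
  assume q: "q \<in> snd c ` fst c \<and> chart_inv c q \<in> U"
  then have "q = snd c (chart_inv c q)" "chart_inv c q \<in> fst c \<inter> U"
    using chart_inv_left[OF assms, of q] chart_inv_mem[OF assms, of q] by auto
  then show "q \<in> snd c ` (fst c \<inter> U)" by blast
qed

lemma open_chart_image:
  assumes "is_chart c" "open U"
  shows "open (snd c ` (fst c \<inter> U))"
proof -
  have "snd c ` (fst c \<inter> U) = chart_inv c -` U \<inter> snd c ` fst c"
    using chart_image_iff[OF assms(1)] by blast
  then show ?thesis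
    using continuous_on_open_vimage[OF is_chart_open(2)[OF assms(1)], of "chart_inv c"]
      continuous_on_chart_inv[OF assms(1)] assms(2) by auto
qed

section \<open>Charted spaces and smooth maps between them\<close>

text \<open>The part of \<open>smooth_atlas\<close> that does not mention transition maps. It
  suffices for composing and pairing smooth maps, and it passes to product atlases by a direct
  check.\<close>

definition charted :: "('a::topological_space, 'e::euclidean_space) chart set \<Rightarrow> bool" where
  "charted A \<longleftrightarrow> (\<forall>c\<in>A. is_chart c) \<and> (\<Union>c\<in>A. fst c) = UNIV"

lemma chartedD: "charted A \<Longrightarrow> c \<in> A \<Longrightarrow> is_chart c"
  by (simp add: charted_def)

lemma charted_ex: "charted A \<Longrightarrow> \<exists>c\<in>A. x \<in> fst c"
  unfolding charted_def by blast

lemma smooth_atlas_charted: "smooth_atlas A \<Longrightarrow> charted A"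
  by (simp add: smooth_atlas_def charted_def)

lemma smooth_map_continuous: "smooth_map A B f \<Longrightarrow> continuous_on UNIV f"
  by (simp add: smooth_map_def)

lemma smooth_map_preimage_open:
  assumes "smooth_map A B f" "open U"
  shows "open (f -` U)"
  using assms by (simp add: smooth_map_continuous open_vimage)

lemma chart_inv_vector [simp]: "chart_inv (UNIV, \<lambda>x. x) q = q"
  unfolding chart_inv_def by (metis UNIV_I f_inv_into_f fst_conv image_ident snd_conv)

lemma is_chart_vector: "is_chart (UNIV, \<lambda>x. x)"
  unfolding is_chart_def homeomorphism_def by (auto simp: continuous_on_id)

lemma charted_vector: "charted vector_atlas"
  unfolding charted_def vector_atlas_def using is_chart_vector by simp

lemma smooth_map_compose:
  assumes A: "charted A" and B: "charted B" and C: "charted C"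
    and f: "smooth_map A B f" and g: "smooth_map B C g"
  shows "smooth_map A C (g \<circ> f)"
  unfolding smooth_map_def
proof (intro conjI ballI)
  have "continuous_on UNIV f" "continuous_on UNIV g"
    using f g by (auto simp: smooth_map_def)
  then show "continuous_on UNIV (g \<circ> f)"
    by (intro continuous_on_compose) (auto intro: continuous_on_subset)
  fix c e assume ce: "c \<in> A" "e \<in> C"
  have c: "is_chart c" and e: "is_chart e" using ce A C by (auto simp: chartedD)
  show "smooth_on (snd c ` (fst c \<inter> (g \<circ> f) -` fst e)) (snd e \<circ> (g \<circ> f) \<circ> chart_inv c)"
  proof (rule smooth_on_local)
    fix q assume "q \<in> snd c ` (fst c \<inter> (g \<circ> f) -` fst e)"
    then have q: "q \<in> snd c ` fst c" "g (f (chart_inv c q)) \<in> fst e"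
      by (auto simp: chart_image_iff[OF c])
    obtain d where dB: "d \<in> B" and d: "f (chart_inv c q) \<in> fst d"
      using charted_ex[OF B] by blast
    have dc: "is_chart d" using chartedD[OF B dB] .
    \<comment> \<open>On \<open>U\<close> the intermediate point lies in the chart \<open>d\<close>
      and the end point in \<open>e\<close>, so the composite factors through the two coordinate
      expressions.\<close>
    define U where "U = f -` (fst d \<inter> g -` fst e)"
    have "open U" unfolding U_def
      by (intro smooth_map_preimage_open[OF f] open_Int smooth_map_preimage_open[OF g] is_chart_open dc e)
    then have T: "open (snd c ` (fst c \<inter> U))" by (rule open_chart_image[OF c])
    have inT: "chart_inv c r \<in> U" if "r \<in> snd c ` (fst c \<inter> U)" for r
      using that chart_image_iff[OF c] by blast
    have "smooth_on (snd c ` (fst c \<inter> U)) ((snd e \<circ> g \<circ> chart_inv d) \<circ> (snd d \<circ> f \<circ> chart_inv c))"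
    proof (rule smooth_on_compose[OF T])
      show "smooth_on (snd c ` (fst c \<inter> U)) (snd d \<circ> f \<circ> chart_inv c)"
      proof -
        have "smooth_on (snd c ` (fst c \<inter> f -` fst d)) (snd d \<circ> f \<circ> chart_inv c)"
          using f ce dB unfolding smooth_map_def by blast
        then show ?thesis by (rule smooth_on_subset) (auto simp: U_def)
      qed
      show "smooth_on (snd d ` (fst d \<inter> g -` fst e)) (snd e \<circ> g \<circ> chart_inv d)"
        using g ce dB unfolding smooth_map_def by blast
      show "(snd d \<circ> f \<circ> chart_inv c) ` snd c ` (fst c \<inter> U) \<subseteq> snd d ` (fst d \<inter> g -` fst e)"
        using inT by (auto simp: U_def)
    qed
    then have "smooth_on (snd c ` (fst c \<inter> U)) (snd e \<circ> (g \<circ> f) \<circ> chart_inv c)"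
      by (rule smooth_on_cong[OF T, rotated])
        (use inT chart_inv_right[OF dc] in \<open>simp add: U_def\<close>)
    moreover have "q \<in> snd c ` (fst c \<inter> U)"
      using q d unfolding chart_image_iff[OF c] U_def by auto
    ultimately show "\<exists>T. open T \<and> q \<in> T \<and> smooth_on T (snd e \<circ> (g \<circ> f) \<circ> chart_inv c)"
      using T by blast
  qed
qed

lemma smooth_map_ident: "smooth_atlas A \<Longrightarrow> smooth_map A A (\<lambda>x. x)"
  unfolding smooth_map_def smooth_atlas_def by (auto simp: o_def vimage_def)

lemma smooth_map_const: "smooth_map A B (\<lambda>x. y)"
  unfolding smooth_map_def by (auto simp: o_def intro: smooth_on_const)

lemma is_chart_prod:
  assumes c: "is_chart c" and d: "is_chart d"
  shows "is_chart (fst c \<times> fst d, map_prod (snd c) (snd d))"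
    and chart_inv_prod: "\<And>q r. q \<in> snd c ` fst c \<Longrightarrow> r \<in> snd d ` fst d \<Longrightarrow>
      chart_inv (fst c \<times> fst d, map_prod (snd c) (snd d)) (q, r) = (chart_inv c q, chart_inv d r)"
proof -
  let ?p = "(fst c \<times> fst d, map_prod (snd c) (snd d))"
  have im: "map_prod (snd c) (snd d) ` (fst c \<times> fst d) = (snd c ` fst c) \<times> (snd d ` fst d)"
    by force
  have inj: "inj_on (map_prod (snd c) (snd d)) (fst c \<times> fst d)"
    by (rule inj_onI) (use chart_inv_right[OF c] chart_inv_right[OF d] in \<open>auto simp: map_prod_def, metis+\<close>)
  show inv: "chart_inv ?p (q, r) = (chart_inv c q, chart_inv d r)"
    if "q \<in> snd c ` fst c" "r \<in> snd d ` fst d" for q r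
    unfolding chart_inv_def[of ?p] fst_conv snd_conv
    by (rule inv_into_f_eq[OF inj])
      (use that in \<open>auto simp: chart_inv_mem[OF c] chart_inv_mem[OF d] chart_inv_left[OF c] chart_inv_left[OF d]\<close>)
  have 1: "continuous_on (fst c \<times> fst d) (map_prod (snd c) (snd d))"
    unfolding map_prod_def split_def
    by (intro continuous_on_Pair continuous_on_compose2[OF continuous_on_chart[OF c]]
        continuous_on_compose2[OF continuous_on_chart[OF d]] continuous_on_fst continuous_on_snd continuous_on_id) auto
  have "continuous_on ((snd c ` fst c) \<times> (snd d ` fst d)) (\<lambda>z. (chart_inv c (fst z), chart_inv d (snd z)))"
    by (intro continuous_on_Pair continuous_on_compose2[OF continuous_on_chart_inv[OF c]]
        continuous_on_compose2[OF continuous_on_chart_inv[OF d]] continuous_on_fst continuous_on_snd continuous_on_id) auto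
  then have 2: "continuous_on ((snd c ` fst c) \<times> (snd d ` fst d)) (chart_inv ?p)"
    by (rule continuous_on_eq) (use inv in auto)
  have "homeomorphism (fst c \<times> fst d) ((snd c ` fst c) \<times> (snd d ` fst d)) (map_prod (snd c) (snd d)) (chart_inv ?p)"
  proof (rule homeomorphismI[OF 1 2])
    show "chart_inv ?p ` (snd c ` fst c \<times> snd d ` fst d) \<subseteq> fst c \<times> fst d"
      using inv chart_inv_mem[OF c] chart_inv_mem[OF d] by auto
  qed (use inv chart_inv_right[OF c] chart_inv_right[OF d] in auto)
  then show "is_chart ?p"
    unfolding is_chart_def fst_conv snd_conv im
    using is_chart_open[OF c] is_chart_open[OF d] by (auto intro: open_Times)
qed

lemma charted_prod:
  assumes "charted A" "charted B"
  shows "charted (prod_atlas A B)"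
proof -
  have "\<exists>p\<in>prod_atlas A B. z \<in> fst p" for z
  proof -
    obtain c d where "c \<in> A" "fst z \<in> fst c" "d \<in> B" "snd z \<in> fst d"
      using charted_ex[OF assms(1)] charted_ex[OF assms(2)] by metis
    then have "(fst c \<times> fst d, map_prod (snd c) (snd d)) \<in> prod_atlas A B" "z \<in> fst c \<times> fst d"
      unfolding prod_atlas_def by (blast, simp add: mem_Times_iff)
    then show ?thesis by (metis fst_conv)
  qed
  moreover have "is_chart p" if p: "p \<in> prod_atlas A B" for p
  proof -
    obtain c d where cd: "c \<in> A" "d \<in> B" "p = (fst c \<times> fst d, map_prod (snd c) (snd d))"
      using p unfolding prod_atlas_def by blast
    show ?thesis unfolding cd(3)
      by (rule is_chart_prod(1)[OF chartedD[OF assms(1) cd(1)] chartedD[OF assms(2) cd(2)]])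
  qed
  ultimately show ?thesis unfolding charted_def by blast
qed

lemma smooth_map_Pair:
  assumes A: "charted A" and B: "charted B" and C: "charted C"
    and f: "smooth_map A B f" and g: "smooth_map A C g"
  shows "smooth_map A (prod_atlas B C) (\<lambda>x. (f x, g x))"
  unfolding smooth_map_def
proof (intro conjI ballI)
  show "continuous_on UNIV (\<lambda>x. (f x, g x))"
    using f g by (auto simp: smooth_map_def intro: continuous_on_Pair)
  fix c p assume cA: "c \<in> A" and "p \<in> prod_atlas B C"
  then obtain d e where d: "d \<in> B" and e: "e \<in> C" and p: "p = (fst d \<times> fst e, map_prod (snd d) (snd e))"
    unfolding prod_atlas_def by blast
  define U where "U = f -` fst d \<inter> g -` fst e"
  have "open U" unfolding U_def
    by (intro open_Int smooth_map_preimage_open[OF f] smooth_map_preimage_open[OF g] is_chart_open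
        chartedD[OF B d] chartedD[OF C e])
  then have T: "open (snd c ` (fst c \<inter> U))" by (rule open_chart_image[OF chartedD[OF A cA]])
  have "smooth_on (snd c ` (fst c \<inter> U)) (\<lambda>q. ((snd d \<circ> f \<circ> chart_inv c) q, (snd e \<circ> g \<circ> chart_inv c) q))"
  proof (rule smooth_on_Pair[OF T])
    show "smooth_on (snd c ` (fst c \<inter> U)) (snd d \<circ> f \<circ> chart_inv c)"
    proof -
      have "smooth_on (snd c ` (fst c \<inter> f -` fst d)) (snd d \<circ> f \<circ> chart_inv c)"
        using f cA d unfolding smooth_map_def by blast
      then show ?thesis by (rule smooth_on_subset) (auto simp: U_def)
    qed
    show "smooth_on (snd c ` (fst c \<inter> U)) (snd e \<circ> g \<circ> chart_inv c)"
    proof -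
      have "smooth_on (snd c ` (fst c \<inter> g -` fst e)) (snd e \<circ> g \<circ> chart_inv c)"
        using g cA e unfolding smooth_map_def by blast
      then show ?thesis by (rule smooth_on_subset) (auto simp: U_def)
    qed
  qed
  moreover have "(\<lambda>x. (f x, g x)) -` fst p = U" by (auto simp: U_def p)
  ultimately show "smooth_on (snd c ` (fst c \<inter> (\<lambda>x. (f x, g x)) -` fst p)) (snd p \<circ> (\<lambda>x. (f x, g x)) \<circ> chart_inv c)"
    by (simp add: p o_def)
qed

lemma smooth_map_proj:
  assumes A: "smooth_atlas A" and B: "smooth_atlas B"
  shows smooth_map_fst: "smooth_map (prod_atlas A B) A fst"
    and smooth_map_snd: "smooth_map (prod_atlas A B) B snd"
proof -
  note ch = smooth_atlas_charted[OF A] smooth_atlas_charted[OF B]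
  have gen: "smooth_on (snd p ` (fst p \<inter> fst -` fst a)) (snd a \<circ> fst \<circ> chart_inv p)"
    "smooth_on (snd p ` (fst p \<inter> snd -` fst b)) (snd b \<circ> snd \<circ> chart_inv p)"
    if a: "a \<in> A" and b: "b \<in> B" and pp: "p \<in> prod_atlas A B" for p a b
  proof -
    obtain c d where c: "c \<in> A" and d: "d \<in> B" and p: "p = (fst c \<times> fst d, map_prod (snd c) (snd d))"
      using pp unfolding prod_atlas_def by blast
    note cd = chartedD[OF ch(1) c] chartedD[OF ch(2) d]
    have oa: "open (fst a)" "open (fst b)" using chartedD[OF ch(1) a] chartedD[OF ch(2) b] by (auto intro: is_chart_open)
    have im: "snd p ` (fst p \<inter> fst -` fst a) = (snd c ` (fst c \<inter> fst a)) \<times> (snd d ` fst d)"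
      "snd p ` (fst p \<inter> snd -` fst b) = (snd c ` fst c) \<times> (snd d ` (fst d \<inter> fst b))"
      unfolding p by force+
    have o: "open ((snd c ` (fst c \<inter> fst a)) \<times> (snd d ` fst d))" "open ((snd c ` fst c) \<times> (snd d ` (fst d \<inter> fst b)))"
      using cd oa by (auto intro!: open_Times open_chart_image is_chart_open)
    have "smooth_on (snd c ` (fst c \<inter> fst a)) (snd a \<circ> chart_inv c)"
      "smooth_on (snd d ` (fst d \<inter> fst b)) (snd b \<circ> chart_inv d)"
      using A B a b c d unfolding smooth_atlas_def by blast+
    note s = smooth_on_compose[OF o(1) smooth_on_bounded_linear[OF bounded_linear_fst] this(1)]
      smooth_on_compose[OF o(2) smooth_on_bounded_linear[OF bounded_linear_snd] this(2)]
    have "smooth_on ((snd c ` (fst c \<inter> fst a)) \<times> (snd d ` fst d)) (snd a \<circ> fst \<circ> chart_inv p)"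
      by (rule smooth_on_cong[OF o(1) _ s(1)]) (use chart_inv_prod[OF cd] p in auto)
    then show "smooth_on (snd p ` (fst p \<inter> fst -` fst a)) (snd a \<circ> fst \<circ> chart_inv p)" by (simp add: im)
    have "smooth_on ((snd c ` fst c) \<times> (snd d ` (fst d \<inter> fst b))) (snd b \<circ> snd \<circ> chart_inv p)"
      by (rule smooth_on_cong[OF o(2) _ s(2)]) (use chart_inv_prod[OF cd] p in auto)
    then show "smooth_on (snd p ` (fst p \<inter> snd -` fst b)) (snd b \<circ> snd \<circ> chart_inv p)" by (simp add: im)
  qed
  \<comment> \<open>\<open>gen\<close> asks for a chart of each factor, while each projection
    supplies only one of them.\<close>
  have "A \<noteq> {}" "B \<noteq> {}" using ch unfolding charted_def by auto
  then show "smooth_map (prod_atlas A B) A fst" "smooth_map (prod_atlas A B) B snd"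
    unfolding smooth_map_def using gen
    by (auto intro: continuous_on_fst continuous_on_snd continuous_on_id)
qed

text \<open>The partial derivative in the second variable is the derivative of the joint coordinate
  map in the direction (0,v), so joint smoothness makes it smooth in the first variable.
  Left-invariant fields, \<open>Ad\<close> and \<open>lder\<close> owe their smoothness to
  this.\<close>

lemma smooth_map_partial:
  fixes H :: "'a::topological_space \<times> 'b::topological_space \<Rightarrow> 'c::topological_space"
    and A :: "('a, 'e::euclidean_space) chart set" and B :: "('b, 'f::euclidean_space) chart set"
    and C :: "('c, 'h::euclidean_space) chart set"
  assumes A: "charted A" and B: "charted B" and C: "charted C" and H: "smooth_map (prod_atlas A B) C H"
    and c: "c \<in> A" and b: "b \<in> B" "n \<in> fst b" and d: "d \<in> C"
  shows "smooth_on (snd c ` (fst c \<inter> {x. H (x, n) \<in> fst d}))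
      ((\<lambda>x. frechet_derivative ((\<lambda>y. snd d (H (x, y))) \<circ> chart_inv b) (at (snd b n)) v) \<circ> chart_inv c)"
proof -
  note ch = chartedD[OF B b(1)] chartedD[OF C d]
  define \<Omega> where "\<Omega> a = snd (fst a \<times> fst b, map_prod (snd a) (snd b)) ` ((fst a \<times> fst b) \<inter> H -` fst d)"
    for a :: "('a, 'e) chart"
  define \<Phi> where "\<Phi> a = snd d \<circ> H \<circ> chart_inv (fst a \<times> fst b, map_prod (snd a) (snd b))"
    for a :: "('a, 'e) chart"
  have pa: "(fst a \<times> fst b, map_prod (snd a) (snd b)) \<in> prod_atlas A B" if "a \<in> A" for a
    using that b unfolding prod_atlas_def by blast
  have sm: "smooth_on (\<Omega> a) (\<Phi> a)" and op: "open (\<Omega> a)" if "a \<in> A" for a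
  proof -
    show "smooth_on (\<Omega> a) (\<Phi> a)" using H d pa[OF that] unfolding smooth_map_def \<Omega>_def \<Phi>_def by auto
    show "open (\<Omega> a)" unfolding \<Omega>_def
      using open_chart_image[OF chartedD[OF charted_prod[OF A B] pa[OF that]], of "H -` fst d"]
        smooth_map_preimage_open[OF H is_chart_open(1)[OF ch(2)]] by simp
  qed
  have key: "((\<lambda>y. snd d (H (x, y))) \<circ> chart_inv b has_derivative
      (\<lambda>w. frechet_derivative (\<Phi> a) (at (snd a x, snd b n)) (0, w))) (at (snd b n))"
    and mem: "(snd a x, snd b n) \<in> \<Omega> a"
    if a: "a \<in> A" "x \<in> fst a" and x: "H (x, n) \<in> fst d" for a x
  proof -
    note ac = chartedD[OF A a(1)]
    show mem: "(snd a x, snd b n) \<in> \<Omega> a" using a x b unfolding \<Omega>_def by force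
    have "(\<Phi> a has_derivative frechet_derivative (\<Phi> a) (at (snd a x, snd b n))) (at (snd a x, snd b n))"
      by (intro differentiable_has_frechet_derivative smooth_on_imp_differentiable[OF sm[OF a(1)] mem])
    moreover have "((\<lambda>r. (snd a x, r)) has_derivative (\<lambda>w. (0, w))) (at (snd b n))"
      by (intro has_derivative_Pair has_derivative_const has_derivative_ident)
    ultimately have "((\<lambda>r. \<Phi> a (snd a x, r)) has_derivative
        (\<lambda>w. frechet_derivative (\<Phi> a) (at (snd a x, snd b n)) (0, w))) (at (snd b n))"
      using diff_chain_at[of "\<lambda>r. (snd a x, r)" _ "snd b n" "\<Phi> a"] by (simp add: o_def)
    then show "((\<lambda>y. snd d (H (x, y))) \<circ> chart_inv b has_derivative
      (\<lambda>w. frechet_derivative (\<Phi> a) (at (snd a x, snd b n)) (0, w))) (at (snd b n))"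
    proof (rule has_derivative_transform_within_open[where s = "snd b ` fst b"])
      show "\<Phi> a (snd a x, r) = ((\<lambda>y. snd d (H (x, y))) \<circ> chart_inv b) r" if "r \<in> snd b ` fst b" for r
        using chart_inv_prod[OF ac ch(1), of "snd a x" r] that a chart_inv_right[OF ac] by (simp add: \<Phi>_def)
    qed (use b is_chart_open(2)[OF ch(1)] in auto)
  qed
  let ?S = "snd c ` (fst c \<inter> {x. H (x, n) \<in> fst d})"
  have "open {x. H (x, n) \<in> fst d}"
  proof -
    have "continuous_on UNIV (\<lambda>x. H (x, n))"
      by (rule continuous_on_compose2[OF smooth_map_continuous[OF H]])
        (auto intro: continuous_on_Pair continuous_on_id continuous_on_const)
    then show ?thesis using open_vimage[OF is_chart_open(1)[OF ch(2)]] by (simp add: vimage_def)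
  qed
  then have S: "open ?S" by (rule open_chart_image[OF chartedD[OF A c]])
  have "smooth_on ?S ((\<lambda>z. frechet_derivative (\<Phi> c) (at z) (0, v)) \<circ> (\<lambda>q. (q, snd b n)))"
  proof (rule smooth_on_compose[OF S])
    show "smooth_on ?S (\<lambda>q. (q, snd b n))"
      by (intro smooth_on_Pair[OF S] smooth_on_ident smooth_on_const)
    show "smooth_on (\<Omega> c) (\<lambda>z. frechet_derivative (\<Phi> c) (at z) (0, v))"
      by (intro smooth_on_frechet_derivative sm c)
    show "(\<lambda>q. (q, snd b n)) ` ?S \<subseteq> \<Omega> c" using mem[OF c] by auto
  qed
  then show "smooth_on ?S ((\<lambda>x. frechet_derivative ((\<lambda>y. snd d (H (x, y))) \<circ> chart_inv b) (at (snd b n)) v) \<circ> chart_inv c)"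
  proof (rule smooth_on_cong[OF S, rotated])
    fix q assume "q \<in> ?S"
    then obtain x where x: "x \<in> fst c" "H (x, n) \<in> fst d" "q = snd c x" by auto
    then show "((\<lambda>z. frechet_derivative (\<Phi> c) (at z) (0, v)) \<circ> (\<lambda>q. (q, snd b n))) q =
      ((\<lambda>x. frechet_derivative ((\<lambda>y. snd d (H (x, y))) \<circ> chart_inv b) (at (snd b n)) v) \<circ> chart_inv c) q"
      using frechet_derivative_eqI[OF key[OF c x(1,2)]] chart_inv_right[OF chartedD[OF A c] x(1)] by simp
  qed
qed

section \<open>Inner products\<close>

lemma inner_product_on_zero_left:
  "inner_product_on m g \<Longrightarrow> subspace m \<Longrightarrow> Y \<in> m \<Longrightarrow> g 0 Y = 0"
  unfolding inner_product_on_def by (metis mult_zero_left scale_zero_left subspace_0)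

lemma inner_product_on_add_left:
  "inner_product_on m g \<Longrightarrow> X \<in> m \<Longrightarrow> Y \<in> m \<Longrightarrow> Z \<in> m \<Longrightarrow> g (X + Y) Z = g X Z + g Y Z"
  unfolding inner_product_on_def by simp

lemma inner_product_on_scale_left:
  "inner_product_on m g \<Longrightarrow> X \<in> m \<Longrightarrow> Y \<in> m \<Longrightarrow> g (c *\<^sub>R X) Y = c * g X Y"
  unfolding inner_product_on_def by simp

lemma inner_product_on_pos:
  "inner_product_on m g \<Longrightarrow> X \<in> m \<Longrightarrow> X \<noteq> 0 \<Longrightarrow> 0 < g X X"
  unfolding inner_product_on_def by simp

lemma inner_product_on_commute:
  "inner_product_on m g \<Longrightarrow> X \<in> m \<Longrightarrow> Y \<in> m \<Longrightarrow> g X Y = g Y X"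
  unfolding inner_product_on_def by blast

lemma inner_product_on_sum_left:
  assumes g: "inner_product_on m g" and m: "subspace m" and Y: "Y \<in> m" and f: "\<And>i. i \<in> I \<Longrightarrow> f i \<in> m"
  shows "g (\<Sum>i\<in>I. c i *\<^sub>R f i) Y = (\<Sum>i\<in>I. c i * g (f i) Y)"
proof (cases "finite I")
  case True
  then show ?thesis using f
  proof (induction I rule: finite_induct)
    case (insert i I)
    have "(\<Sum>i\<in>I. c i *\<^sub>R f i) \<in> m" "c i *\<^sub>R f i \<in> m"
      using insert by (auto intro!: subspace_sum[OF m] subspace_scale[OF m])
    then have "g (c i *\<^sub>R f i + (\<Sum>i\<in>I. c i *\<^sub>R f i)) Y = g (c i *\<^sub>R f i) Y + g (\<Sum>i\<in>I. c i *\<^sub>R f i) Y"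
      using inner_product_on_add_left[OF g _ _ Y] by blast
    moreover have "g (c i *\<^sub>R f i) Y = c i * g (f i) Y"
      using inner_product_on_scale_left[OF g _ Y] insert.prems by blast
    ultimately show ?case using insert by simp
  qed (use inner_product_on_zero_left[OF g m Y] in simp)
qed (use inner_product_on_zero_left[OF g m Y] in simp)

lemma inner_product_on_sum_right:
  assumes g: "inner_product_on m g" and m: "subspace m" and Y: "Y \<in> m" and f: "\<And>i. i \<in> I \<Longrightarrow> f i \<in> m"
  shows "g Y (\<Sum>i\<in>I. c i *\<^sub>R f i) = (\<Sum>i\<in>I. c i * g Y (f i))"
proof -
  have "(\<Sum>i\<in>I. c i *\<^sub>R f i) \<in> m"
    using f by (auto intro!: subspace_sum[OF m] subspace_scale[OF m])
  then have "g Y (\<Sum>i\<in>I. c i *\<^sub>R f i) = g (\<Sum>i\<in>I. c i *\<^sub>R f i) Y"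
    using inner_product_on_commute[OF g] Y by blast
  also have "\<dots> = (\<Sum>i\<in>I. c i * g Y (f i))"
    using inner_product_on_commute[OF g Y] f by (simp add: inner_product_on_sum_left[OF g m Y f])
  finally show ?thesis .
qed

text \<open>Gram-Schmidt, for an arbitrary inner product on a subspace: it is applied to
  \<open>g0\<close> on \<open>m\<close> and to the invariant form on the Lie algebra, neither of
  which is the inner product of the type. Orthonormality serves to identify the
  coefficients.\<close>

lemma orthonormal_expansion_exists:
  fixes m :: "'e::euclidean_space set"
  assumes g: "inner_product_on m g" and m: "subspace m"
  shows "\<exists>F. finite F \<and> F \<subseteq> m \<and> (\<forall>Y\<in>m. Y = (\<Sum>e\<in>F. g e Y *\<^sub>R e))"
proof -
  have ex: "\<exists>F. finite F \<and> F \<subseteq> m \<and> (\<forall>x\<in>F. \<forall>y\<in>F. g x y = (if x = y then 1 else 0)) \<and> S \<subseteq> span F"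
    if "finite S" "S \<subseteq> m" for S
    using that
  proof (induction S rule: finite_induct)
    case (insert a S)
    then obtain F where F: "finite F" "F \<subseteq> m" "\<forall>x\<in>F. \<forall>y\<in>F. g x y = (if x = y then 1 else 0)" "S \<subseteq> span F"
      by auto
    define p where "p = (\<Sum>e\<in>F. g e a *\<^sub>R e)"
    have p: "p \<in> m" "p \<in> span F" unfolding p_def using F
      by (auto intro!: subspace_sum[OF m] subspace_scale[OF m] span_sum span_scale intro: span_base)
    show ?case
    proof (cases "a = p")
      case True
      with F p show ?thesis by (intro exI[of _ F]) simp
    next
      case False
      define d where "d = (a - p)"
      have d: "d \<in> m" "d \<noteq> 0" using insert.prems p False m by (auto simp: d_def subspace_diff)
      have orth: "g e d = 0" if "e \<in> F" for e
      proof -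
        have em: "e \<in> m" using that F by auto
        have "g e p = (\<Sum>e'\<in>F. g e' a * g e e')"
          unfolding p_def by (rule inner_product_on_sum_right[OF g m em]) (use F in auto)
        also have "\<dots> = (\<Sum>e'\<in>F. if e' = e then g e a else 0)"
          using F that by (intro sum.cong) auto
        finally have 1: "g e p = g e a" using F that by simp
        have "g (d + p) e = g d e + g p e"
          by (rule inner_product_on_add_left[OF g d(1) p(1) em])
        then have "g e a = g e d + g e p"
          using inner_product_on_commute[OF g em] d p insert.prems by (simp add: d_def)
        with 1 show ?thesis by simp
      qed
      have gd: "g d d > 0" using inner_product_on_pos[OF g d] .
      define u where "u = (1 / sqrt (g d d)) *\<^sub>R d"
      have u: "u \<in> m" unfolding u_def using d m by (simp add: subspace_scale)
      have gu: "g u Y = (1 / sqrt (g d d)) * g d Y" if "Y \<in> m" for Y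
        unfolding u_def by (rule inner_product_on_scale_left[OF g d(1) that])
      have "g u u = (1 / sqrt (g d d)) * ((1 / sqrt (g d d)) * g d d)"
        using gu[OF u] gu[OF d(1)] inner_product_on_commute[OF g d(1) u] by simp
      then have guu: "g u u = 1" using gd by (simp add: field_simps)
      have gue: "g u e = 0" "g e u = 0" if "e \<in> F" for e
        using gu[of e] orth[OF that] inner_product_on_commute[OF g d(1), of e]
          inner_product_on_commute[OF g u, of e] F that by auto
      have "a = sqrt (g d d) *\<^sub>R u + p" using gd by (simp add: u_def d_def)
      moreover have "p \<in> span (insert u F)" "u \<in> span (insert u F)"
        using p span_mono[of F "insert u F", OF subset_insertI] by (auto intro: span_base)
      ultimately have "a \<in> span (insert u F)" by (metis span_add span_scale)
      moreover have "u \<notin> F" using gue guu by fastforce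
      moreover have "S \<subseteq> span (insert u F)" using F span_mono[of F "insert u F", OF subset_insertI] by simp
      moreover have "g x y = (if x = y then 1 else 0)" if "x \<in> insert u F" "y \<in> insert u F" for x y
        using that F guu gue \<open>u \<notin> F\<close> by (cases "x = u"; cases "y = u") auto
      ultimately show ?thesis using F u
        by (intro exI[of _ "insert u F"] conjI ballI) simp_all
    qed
  qed (intro exI[of _ "{}"], simp)
  obtain S where S: "S \<subseteq> m" "independent S" "m \<subseteq> span S" using basis_exists[of m] by metis
  then have "finite S" using independent_imp_finite by blast
  from ex[OF this S(1)] obtain F where F: "finite F" "F \<subseteq> m"
    "\<forall>x\<in>F. \<forall>y\<in>F. g x y = (if x = y then 1 else 0)" "S \<subseteq> span F" by auto
  have "Y = (\<Sum>e\<in>F. g e Y *\<^sub>R e)" if "Y \<in> m" for Y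
  proof -
    have "Y \<in> span F" using that S F span_minimal[of S "span F"] by auto
    then obtain c where c: "Y = (\<Sum>e\<in>F. c e *\<^sub>R e)" using F(1) by (auto simp: span_finite)
    have "g e Y = c e" if "e \<in> F" for e
    proof -
      have "g e Y = (\<Sum>e'\<in>F. c e' * g e e')"
        unfolding c by (rule inner_product_on_sum_right[OF g m]) (use F that in auto)
      also have "\<dots> = (\<Sum>e'\<in>F. if e' = e then c e else 0)"
        using F that by (intro sum.cong) auto
      finally show ?thesis using F that by simp
    qed
    with c show ?thesis by simp
  qed
  then show ?thesis by (intro exI[of _ F] conjI ballI F(1,2))
qed

section \<open>Invariant inner products for bounded groups of linear maps\<close>

definition hs_norm2 :: "('e::euclidean_space \<Rightarrow> 'e \<Rightarrow> real) \<Rightarrow> real" where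
  "hs_norm2 B = (\<Sum>b\<in>Basis. \<Sum>c\<in>Basis. (B b c)\<^sup>2)"

lemma bilinear_expand:
  fixes B :: "'e::euclidean_space \<Rightarrow> 'e \<Rightarrow> real"
  assumes "bilinear B"
  shows "B Y Z = (\<Sum>b\<in>Basis. \<Sum>c\<in>Basis. (Y \<bullet> b) * (Z \<bullet> c) * B b c)"
proof -
  have "B Y Z = B (\<Sum>b\<in>Basis. (Y \<bullet> b) *\<^sub>R b) (\<Sum>c\<in>Basis. (Z \<bullet> c) *\<^sub>R c)"
    by (simp add: euclidean_representation)
  also have "\<dots> = (\<Sum>(b,c)\<in>Basis \<times> Basis. B ((Y \<bullet> b) *\<^sub>R b) ((Z \<bullet> c) *\<^sub>R c))"
    by (rule bilinear_sum[OF assms])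
  also have "\<dots> = (\<Sum>b\<in>Basis. \<Sum>c\<in>Basis. (Y \<bullet> b) * (Z \<bullet> c) * B b c)"
    unfolding sum.cartesian_product
    by (intro sum.cong) (auto simp: bilinear_lmul[OF assms] bilinear_rmul[OF assms])
  finally show ?thesis .
qed

text \<open>An entry of the transformed form is at most M^2 times the sum of all absolute entries;
  Cauchy-Schwarz over DIM^2 entries bounds the square of that sum, and summing over DIM^2 entries
  gives DIM^4 M^4. Applied to an inverse map, the estimate becomes a lower bound along the
  orbit.\<close>

lemma hs_norm2_comp_le:
  fixes E :: "'e::euclidean_space \<Rightarrow> 'e \<Rightarrow> real" and T :: "'e \<Rightarrow> 'e"
  assumes "bilinear E" "\<And>Z. norm (T Z) \<le> M * norm Z" "0 \<le> M"
  shows "hs_norm2 (\<lambda>Y Z. E (T Y) (T Z)) \<le> real DIM('e) ^ 4 * M ^ 4 * hs_norm2 E"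
proof -
  have *: "(E (T b) (T c))\<^sup>2 \<le> real DIM('e) ^ 2 * M ^ 4 * hs_norm2 E" if "b \<in> Basis" "c \<in> Basis" for b c
  proof -
    define s where "s = (\<Sum>b\<in>Basis. \<Sum>c\<in>Basis. \<bar>E b c\<bar>)"
    have "\<bar>E (T b) (T c)\<bar> \<le> (\<Sum>b'\<in>Basis. \<Sum>c'\<in>Basis. M\<^sup>2 * \<bar>E b' c'\<bar>)"
      unfolding bilinear_expand[OF assms(1), of "T b" "T c"]
    proof (intro order_trans[OF sum_abs] sum_mono)
      fix b' c' :: 'e assume "b' \<in> Basis" "c' \<in> Basis"
      then have "\<bar>T b \<bullet> b'\<bar> \<le> M" "\<bar>T c \<bullet> c'\<bar> \<le> M"
        using assms(2)[of b] assms(2)[of c] Basis_le_norm[of b' "T b"] Basis_le_norm[of c' "T c"] that by auto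
      then show "\<bar>T b \<bullet> b' * (T c \<bullet> c') * E b' c'\<bar> \<le> M\<^sup>2 * \<bar>E b' c'\<bar>"
        by (auto simp: abs_mult power2_eq_square intro!: mult_mono)
    qed
    then have "\<bar>E (T b) (T c)\<bar> \<le> M\<^sup>2 * s" by (simp add: s_def sum_distrib_left)
    then have "(E (T b) (T c))\<^sup>2 \<le> (M\<^sup>2 * s)\<^sup>2" by (metis abs_ge_zero power2_abs power_mono)
    also have "\<dots> = M ^ 4 * s\<^sup>2" by (simp add: power_mult_distrib)
    finally have 1: "(E (T b) (T c))\<^sup>2 \<le> M ^ 4 * s\<^sup>2" .
    have "s\<^sup>2 \<le> real DIM('e) ^ 2 * hs_norm2 E"
    proof -
      have "s = (\<Sum>p\<in>Basis\<times>Basis. \<bar>E (fst p) (snd p)\<bar>)"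
        by (simp add: s_def sum.cartesian_product split_def)
      also have "\<dots>\<^sup>2 \<le> (\<Sum>p\<in>Basis\<times>Basis. \<bar>E (fst p) (snd p)\<bar>\<^sup>2) * (card (Basis \<times> Basis :: ('e \<times> 'e) set))"
        by (rule sum_squared_le_sum_of_squares)
      also have "\<dots> = real DIM('e) ^ 2 * hs_norm2 E"
        by (simp add: hs_norm2_def sum.cartesian_product split_def card_cartesian_product power2_eq_square)
      finally show ?thesis .
    qed
    then have "M ^ 4 * s\<^sup>2 \<le> M ^ 4 * (real DIM('e) ^ 2 * hs_norm2 E)" by (rule mult_left_mono) simp
    with 1 show ?thesis by (simp only: mult_ac)
  qed
  have "hs_norm2 (\<lambda>Y Z. E (T Y) (T Z)) \<le> (\<Sum>b\<in>(Basis::'e set). \<Sum>c\<in>(Basis::'e set). real DIM('e) ^ 2 * M ^ 4 * hs_norm2 E)"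
    unfolding hs_norm2_def[of "\<lambda>Y Z. E (T Y) (T Z)"] by (intro sum_mono) (rule *)
  also have "\<dots> = real DIM('e) ^ 4 * M ^ 4 * hs_norm2 E" by (simp add: power2_eq_square power4_eq_xxxx)
  finally show ?thesis .
qed

lemma hs_norm2_parallelogram:
  "hs_norm2 (\<lambda>Y Z. (B Y Z + C Y Z) / 2) =
   (hs_norm2 B + hs_norm2 C) / 2 - hs_norm2 (\<lambda>Y Z. B Y Z - C Y Z) / 4"
  unfolding hs_norm2_def sum_divide_distrib sum.distrib[symmetric] sum_subtractf[symmetric]
  by (intro sum.cong refl) (simp add: field_simps power2_eq_square)

lemma hs_norm2_entry_le:
  assumes "b \<in> Basis" "c \<in> Basis"
  shows "(B b c)\<^sup>2 \<le> hs_norm2 B"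
proof -
  have "(B b c)\<^sup>2 \<le> (\<Sum>c\<in>Basis. (B b c)\<^sup>2)" by (rule member_le_sum) (use assms in auto)
  also have "\<dots> \<le> hs_norm2 B" unfolding hs_norm2_def
    by (rule member_le_sum) (use assms in \<open>auto intro!: sum_nonneg\<close>)
  finally show ?thesis .
qed

lemma bilinear_comp_linear: "bilinear B \<Longrightarrow> linear T \<Longrightarrow> bilinear (\<lambda>Y Z. B (T Y) (T Z))"
  unfolding bilinear_def by (auto intro: linear_compose[unfolded o_def])

text \<open>The invariant form is the unique minimiser, over a convex invariant set of forms, of the supremum
  of the Hilbert--Schmidt norm over the orbit; uniqueness comes from the parallelogram law, and
  invariance from uniqueness. This avoids Haar measure.\<close>

theorem invariant_inner_product_exists:
  fixes \<G> :: "('e::euclidean_space \<Rightarrow> 'e) set"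
  assumes lin: "\<And>T. T \<in> \<G> \<Longrightarrow> linear T" and id: "id \<in> \<G>"
    and comp: "\<And>S T. S \<in> \<G> \<Longrightarrow> T \<in> \<G> \<Longrightarrow> S \<circ> T \<in> \<G>"
    and inv: "\<And>T. T \<in> \<G> \<Longrightarrow> \<exists>T'\<in>\<G>. T \<circ> T' = id"
    and bound: "\<And>T Z. T \<in> \<G> \<Longrightarrow> norm (T Z) \<le> M * norm Z"
  obtains B where "inner_product_on UNIV B" "bilinear B" "\<And>T X Y. T \<in> \<G> \<Longrightarrow> B (T X) (T Y) = B X Y"
proof -
  \<comment> \<open>The maximum with 1 makes the bound positive, so that its square can be divided
    by.\<close>
  define M' where "M' = max M 1"
  have M': "M' > 0" "\<And>T Z. T \<in> \<G> \<Longrightarrow> norm (T Z) \<le> M' * norm Z"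
  proof -
    show "M' > 0" by (simp add: M'_def)
    fix T Z assume "T \<in> \<G>"
    then have "norm (T Z) \<le> M * norm Z" by (rule bound)
    also have "\<dots> \<le> M' * norm Z" by (intro mult_right_mono) (auto simp: M'_def)
    finally show "norm (T Z) \<le> M' * norm Z" .
  qed
  \<comment> \<open>A right inverse of a right inverse of \<open>T\<close> is \<open>T\<close>
    itself, so right inverses are two-sided here.\<close>
  have inv2: "\<exists>T'\<in>\<G>. (\<forall>Z. T (T' Z) = Z) \<and> (\<forall>Z. T' (T Z) = Z)" if T: "T \<in> \<G>" for T
  proof -
    obtain T' where T': "T' \<in> \<G>" "T \<circ> T' = id" using inv[OF T] by blast
    obtain T'' where T'': "T' \<circ> T'' = id" using inv[OF T'(1)] by blast
    have "T = T''" using T' T'' by (metis comp_assoc comp_id id_comp)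
    with T' T'' show ?thesis by (metis comp_apply id_apply)
  qed
  define K where "K = real DIM('e) ^ 4 * M' ^ 4"
  have K: "K > 0" using M' by (simp add: K_def)
  \<comment> \<open>The lower bound, demanded along the whole orbit, is invariant and survives
    limits; it keeps the limit form positive definite. The Euclidean product meets it because the
    inverse of \<open>T\<close> is bounded by \<open>M'\<close> as well.\<close>
  define adm where "adm B \<longleftrightarrow> bilinear B \<and> (\<forall>X Y. B X Y = B Y X) \<and>
      (\<forall>T\<in>\<G>. \<forall>Z. (norm Z)\<^sup>2 / M'\<^sup>2 \<le> B (T Z) (T Z))" for B :: "'e \<Rightarrow> 'e \<Rightarrow> real"
  \<comment> \<open>A sublevel set of the supremum of \<open>hs_norm2\<close> over the orbit: the
    infimum of all admissible \<open>r\<close> is the minimal supremum, without any supremum being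
    formed.\<close>
  define good where "good r B \<longleftrightarrow> adm B \<and> (\<forall>T\<in>\<G>. hs_norm2 (\<lambda>Y Z. B (T Y) (T Z)) \<le> r)" for r B
  have act: "good r (\<lambda>Y Z. B (S Y) (S Z))" if "good r B" and S: "S \<in> \<G>" for r B S
  proof -
    have "S \<circ> T \<in> \<G>" if "T \<in> \<G>" for T using comp S that by blast
    then have "(norm Z)\<^sup>2 / M'\<^sup>2 \<le> B (S (T Z)) (S (T Z))" "hs_norm2 (\<lambda>Y Z. B (S (T Y)) (S (T Z))) \<le> r"
      if "T \<in> \<G>" for T Z using \<open>good r B\<close> that by (fastforce simp: good_def adm_def)+
    then show ?thesis using \<open>good r B\<close> lin[OF S] unfolding good_def adm_def
      by (auto intro: bilinear_comp_linear)
  qed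
  define R where "R = {r. \<exists>B. good r B}"
  have "good (K * hs_norm2 ((\<bullet>) :: 'e \<Rightarrow> _)) (\<bullet>)"
  proof -
    have "(norm Z)\<^sup>2 / M'\<^sup>2 \<le> T Z \<bullet> T Z" if "T \<in> \<G>" for T Z
    proof -
      obtain T' where T': "T' \<in> \<G>" "T' (T Z) = Z" using inv2[OF \<open>T \<in> \<G>\<close>] by blast
      have "norm Z \<le> M' * norm (T Z)" using M'(2)[OF T'(1), of "T Z"] T'(2) by simp
      then have "(norm Z)\<^sup>2 \<le> (M' * norm (T Z))\<^sup>2" by (intro power_mono) auto
      then show ?thesis using M'(1) by (simp add: power_mult_distrib divide_simps power2_norm_eq_inner mult.commute)
    qed
    moreover have "bilinear ((\<bullet>) :: 'e \<Rightarrow> _)" by (simp add: bilinear_conv_bounded_bilinear bounded_bilinear_inner)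
    moreover from this have "hs_norm2 (\<lambda>Y Z. T Y \<bullet> T Z) \<le> real DIM('e) ^ 4 * M' ^ 4 * hs_norm2 ((\<bullet>) :: 'e \<Rightarrow> _)"
      if "T \<in> \<G>" for T by (rule hs_norm2_comp_le) (use M'(1) M'(2)[OF that] in auto)
    ultimately show ?thesis unfolding good_def adm_def K_def by (simp add: inner_commute)
  qed
  then have Rne: "R \<noteq> {}" unfolding R_def by blast
  have hs0: "hs_norm2 B \<ge> 0" for B :: "'e \<Rightarrow> 'e \<Rightarrow> real" unfolding hs_norm2_def by (intro sum_nonneg) auto
  have Rb: "bdd_below R"
    by (rule bdd_belowI[of _ 0]) (use hs0 id in \<open>auto simp: R_def good_def intro: order_trans\<close>)
  define I where "I = Inf R"
  \<comment> \<open>Uniform convexity in quantitative form: nearly minimal forms are close. Along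
    the orbit the squared distance of the two forms stays above \<delta>/K, so by the parallelogram
    law the midpoint lies at level (r + s)/2 - \<delta>/(4K), and no level is below
    \<open>I\<close>.\<close>
  have close: "hs_norm2 (\<lambda>Y Z. B Y Z - C Y Z) \<le> 4 * K * ((r + s) / 2 - I)" if B: "good r B" and C: "good s C" for r s B C
  proof -
    define \<delta> where "\<delta> = hs_norm2 (\<lambda>Y Z. B Y Z - C Y Z)"
    have bil: "bilinear B" "bilinear C" using B C by (auto simp: good_def adm_def)
    have bd: "bilinear (\<lambda>Y Z. B Y Z - C Y Z)" "bilinear (\<lambda>Y Z. (B Y Z + C Y Z) / 2)"
      using bil by (auto simp: bilinear_def linear_iff algebra_simps add_divide_distrib)
    have "good ((r + s) / 2 - \<delta> / (4 * K)) (\<lambda>Y Z. (B Y Z + C Y Z) / 2)"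
      unfolding good_def
    proof (intro conjI ballI)
      show "adm (\<lambda>Y Z. (B Y Z + C Y Z) / 2)" unfolding adm_def
      proof (intro conjI ballI allI)
        show "(B X Y + C X Y) / 2 = (B Y X + C Y X) / 2" for X Y
          using B C by (metis good_def adm_def)
        show "(norm Z)\<^sup>2 / M'\<^sup>2 \<le> (B (T Z) (T Z) + C (T Z) (T Z)) / 2" if "T \<in> \<G>" for T Z
        proof -
          have "(norm Z)\<^sup>2 / M'\<^sup>2 \<le> B (T Z) (T Z)" "(norm Z)\<^sup>2 / M'\<^sup>2 \<le> C (T Z) (T Z)"
            using B C that by (simp_all add: good_def adm_def)
          then show ?thesis unfolding add_divide_distrib by linarith
        qed
      qed (rule bd(2))
      fix T assume T: "T \<in> \<G>"
      obtain T' where T': "T' \<in> \<G>" "\<And>Z. T (T' Z) = Z" using inv2[OF T] by blast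
      \<comment> \<open>\<open>T'\<close> undoes \<open>T\<close>, so the comparison estimate for
        \<open>T'\<close> bounds the untransformed difference by the transformed one.\<close>
      have "\<delta> \<le> K * hs_norm2 (\<lambda>Y Z. B (T Y) (T Z) - C (T Y) (T Z))"
        using hs_norm2_comp_le[OF bilinear_comp_linear[OF bd(1) lin[OF T]], of T' M'] M' T'
        by (simp add: K_def \<delta>_def)
      then have "\<delta> / (4 * K) \<le> hs_norm2 (\<lambda>Y Z. B (T Y) (T Z) - C (T Y) (T Z)) / 4"
        using K by (simp add: field_simps)
      moreover have "hs_norm2 (\<lambda>Y Z. B (T Y) (T Z)) \<le> r" "hs_norm2 (\<lambda>Y Z. C (T Y) (T Z)) \<le> s"
        using B C T by (auto simp: good_def)
      ultimately show "hs_norm2 (\<lambda>Y Z. (B (T Y) (T Z) + C (T Y) (T Z)) / 2) \<le> (r + s) / 2 - \<delta> / (4 * K)"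
        unfolding hs_norm2_parallelogram[of "\<lambda>Y Z. B (T Y) (T Z)"]
          by (intro diff_mono divide_right_mono add_mono) simp_all
    qed
    then have "(r + s) / 2 - \<delta> / (4 * K) \<in> R" unfolding R_def by blast
    then have "I \<le> (r + s) / 2 - \<delta> / (4 * K)" unfolding I_def using Rb by (rule cInf_lower)
    then show ?thesis using K by (simp add: \<delta>_def field_simps)
  qed
  have "\<exists>B. good (I + 1 / real (Suc n)) B" for n
  proof -
    have "Inf R < I + 1 / real (Suc n)" by (simp add: I_def)
    then obtain r where r: "r \<in> R" "r < I + 1 / real (Suc n)" using cInf_lessD[OF Rne] by blast
    then show ?thesis unfolding R_def good_def by fastforce
  qed
  then obtain Bn where Bn: "\<And>n. good (I + 1 / real (Suc n)) (Bn n)" by metis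
  \<comment> \<open>From index N on, both levels are within 1/(N+1) of \<open>I\<close>, so
    \<open>close\<close> bounds the squared differences of entries by 4K/(N+1): a minimising
    sequence is Cauchy entry by entry.\<close>
  have conv: "convergent (\<lambda>n. Bn n b c)" if bc: "b \<in> Basis" "c \<in> Basis" for b c
  proof (rule Cauchy_convergent, rule metric_CauchyI)
    fix e :: real assume e: "e > 0"
    obtain N where "4 * K / e\<^sup>2 < real N" using reals_Archimedean2 by blast
    then have N: "4 * K / e\<^sup>2 < real (Suc N)" by simp
    have "dist (Bn i b c) (Bn j b c) < e" if "i \<ge> N" "j \<ge> N" for i j
    proof -
      have "(Bn i b c - Bn j b c)\<^sup>2 \<le> 4 * K * ((1 / real (Suc i) + 1 / real (Suc j)) / 2)"
      proof -
        have "(I + a + (I + b)) / 2 - I = (a + b) / 2" for a b by (simp add: field_simps)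
        then show ?thesis
          using order_trans[OF hs_norm2_entry_le[OF bc, of "\<lambda>Y Z. Bn i Y Z - Bn j Y Z"] close[OF Bn Bn, of i j]]
          by metis
      qed
      also have "\<dots> \<le> 4 * K * ((1 / real (Suc N) + 1 / real (Suc N)) / 2)"
        using that K by (intro mult_left_mono divide_right_mono add_mono divide_left_mono) auto
      also have "\<dots> = 4 * K / real (Suc N)" by (simp add: field_simps)
      also have "\<dots> < e\<^sup>2" using N e by (simp add: field_simps del: of_nat_Suc)
      finally have "\<bar>Bn i b c - Bn j b c\<bar>\<^sup>2 < e\<^sup>2" by simp
      then show ?thesis using e by (simp add: dist_real_def power2_less_imp_less)
    qed
    then show "\<exists>M. \<forall>m\<ge>M. \<forall>n\<ge>M. dist (Bn m b c) (Bn n b c) < e" by blast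
  qed
  have bilBn: "bilinear (Bn n)" for n using Bn by (auto simp: good_def adm_def)
  define B where "B Y Z = lim (\<lambda>n. Bn n Y Z)" for Y Z
  have B: "(\<lambda>n. Bn n Y Z) \<longlonglongrightarrow> B Y Z" for Y Z
  proof -
    have "(\<lambda>n. \<Sum>b\<in>Basis. \<Sum>c\<in>Basis. (Y \<bullet> b) * (Z \<bullet> c) * Bn n b c) \<longlonglongrightarrow>
       (\<Sum>b\<in>Basis. \<Sum>c\<in>Basis. (Y \<bullet> b) * (Z \<bullet> c) * lim (\<lambda>n. Bn n b c))"
      using conv by (intro tendsto_intros) (simp add: convergent_LIMSEQ_iff)
    then have "convergent (\<lambda>n. Bn n Y Z)"
      unfolding bilinear_expand[OF bilBn, of _ Y Z] by (rule convergentI)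
    then show ?thesis unfolding B_def by (simp add: convergent_LIMSEQ_iff)
  qed
  have goodB: "good I B"
    unfolding good_def adm_def
  proof (intro conjI ballI allI)
    show "bilinear B" unfolding bilinear_def linear_iff
    proof (intro conjI allI)
      fix x y z :: 'e and r :: real
      show "B x (y + z) = B x y + B x z"
        by (rule LIMSEQ_unique[OF B]) (simp add: bilinear_radd[OF bilBn] tendsto_add[OF B B])
      show "B (y + z) x = B y x + B z x"
        by (rule LIMSEQ_unique[OF B]) (simp add: bilinear_ladd[OF bilBn] tendsto_add[OF B B])
      show "B x (r *\<^sub>R y) = r *\<^sub>R B x y"
        by (rule LIMSEQ_unique[OF B]) (simp add: bilinear_rmul[OF bilBn] tendsto_mult[OF tendsto_const B])
      show "B (r *\<^sub>R y) x = r *\<^sub>R B y x"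
        by (rule LIMSEQ_unique[OF B]) (simp add: bilinear_lmul[OF bilBn] tendsto_mult[OF tendsto_const B])
    qed
    show "B X Y = B Y X" for X Y
      by (rule LIMSEQ_unique[OF B]) (use Bn B[of Y X] in \<open>auto simp: good_def adm_def\<close>)
    fix T assume T: "T \<in> \<G>"
    show "(norm Z)\<^sup>2 / M'\<^sup>2 \<le> B (T Z) (T Z)" for Z
      by (rule LIMSEQ_le_const[OF B]) (use Bn T in \<open>auto simp: good_def adm_def\<close>)
    have "(\<lambda>n. hs_norm2 (\<lambda>Y Z. Bn n (T Y) (T Z))) \<longlonglongrightarrow> hs_norm2 (\<lambda>Y Z. B (T Y) (T Z))"
      unfolding hs_norm2_def by (intro tendsto_intros B)
    moreover have "(\<lambda>n. I + 1 / real (Suc n)) \<longlonglongrightarrow> I + 0"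
      by (intro tendsto_add tendsto_const) (use LIMSEQ_Suc[OF lim_1_over_n] in auto)
    ultimately show "hs_norm2 (\<lambda>Y Z. B (T Y) (T Z)) \<le> I"
      using LIMSEQ_le[of _ "hs_norm2 (\<lambda>Y Z. B (T Y) (T Z))" _ "I + 0"] Bn T by (fastforce simp: good_def)
  qed
  then have bil: "bilinear B" and sym: "\<And>X Y. B X Y = B Y X" by (auto simp: good_def adm_def)
  show thesis
  proof
    show "bilinear B" by fact
    have "B X X > 0" if "X \<noteq> 0" for X
    proof -
      have "(norm X)\<^sup>2 / M'\<^sup>2 \<le> B X X" using goodB id unfolding good_def adm_def by fastforce
      moreover have "(norm X)\<^sup>2 / M'\<^sup>2 > 0" using that M' by simp
      ultimately show ?thesis by linarith
    qed
    then show "inner_product_on UNIV B" unfolding inner_product_on_def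
      by (intro conjI ballI allI impI)
        (simp_all add: bilinear_ladd[OF bil] bilinear_lmul[OF bil], rule sym)
    fix T X Y assume T: "T \<in> \<G>"
    \<comment> \<open>The transformed form is again at level \<open>I\<close>, and
      \<open>close\<close> with both levels equal to \<open>I\<close> leaves distance zero.\<close>
    have h: "hs_norm2 (\<lambda>Y Z. B (T Y) (T Z) - B Y Z) \<le> 0"
      using close[OF act[OF goodB T] goodB] by simp
    have "B (T b) (T c) = B b c" if "b \<in> Basis" "c \<in> Basis" for b c
      using order_trans[OF hs_norm2_entry_le[OF that, of "\<lambda>Y Z. B (T Y) (T Z) - B Y Z"] h] by simp
    then show "B (T X) (T Y) = B X Y"
      unfolding bilinear_expand[OF bil, of X Y] bilinear_expand[OF bilinear_comp_linear[OF bil lin[OF T]], of X Y]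
      by simp
  qed
qed

section \<open>Spinors\<close>

locale spinor_module =
  fixes m :: "'e::euclidean_space set" and g0 :: "'e \<Rightarrow> 'e \<Rightarrow> real" and J :: "'e \<Rightarrow> 'e"
    and E :: "('e, 's::euclidean_space) ext_alg"
  assumes spinor: "spinor_space m g0 J E" and sub: "subspace m"
    and inner: "inner_product_on m g0" and J: "complex_structure_on m J"
begin

lemma ext: "exterior_algebra m J E"
  using spinor unfolding spinor_space_def by blast

lemma vs: "vector_space (cscale E)"
  using ext by (simp add: exterior_algebra_def)

sublocale V: vector_space "cscale E" by (rule vs)
sublocale VV: vector_space_pair "cscale E" "cscale E" by unfold_locales

lemma cscale_of_real: "cscale E (complex_of_real r) v = r *\<^sub>R v"
  using ext by (simp add: exterior_algebra_def)

lemma clinear_wedge_right: "clinear E (wedge E v)"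
  and clinear_wedge_left: "clinear E (\<lambda>v. wedge E v w)"
  using ext by (auto simp: exterior_algebra_def)

lemma clinearD:
  assumes "clinear E T"
  shows clinear_add: "T (v + w) = T v + T w" and clinear_scale: "T (cscale E c v) = cscale E c (T v)"
    and clinear_zero: "T 0 = 0" and clinear_scaleR: "T (r *\<^sub>R v) = r *\<^sub>R T v"
proof -
  have T: "Vector_Spaces.linear (cscale E) (cscale E) T" using assms by (simp add: clinear_def)
  interpret T: Vector_Spaces.linear "cscale E" "cscale E" T by (rule T)
  show "T (v + w) = T v + T w" by (rule T.add)
  show s: "T (cscale E c v) = cscale E c (T v)" for c v by (rule T.scale)
  show "T 0 = 0" by (rule T.zero)
  show "T (r *\<^sub>R v) = r *\<^sub>R T v" using s[of "complex_of_real r" v] by (simp add: cscale_of_real)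
qed

lemma clinearI:
  "(\<And>v w. T (v + w) = T v + T w) \<Longrightarrow> (\<And>c v. T (cscale E c v) = cscale E c (T v)) \<Longrightarrow> clinear E T"
  unfolding clinear_def Vector_Spaces.linear_iff using vs by blast

lemma embed_add: "X \<in> m \<Longrightarrow> Y \<in> m \<Longrightarrow> embed E (X + Y) = embed E X + embed E Y"
  and embed_scaleR: "X \<in> m \<Longrightarrow> embed E (c *\<^sub>R X) = c *\<^sub>R embed E X"
  and wedge_assoc: "wedge E (wedge E u v) w = wedge E u (wedge E v w)"
  and wedge_one_left: "wedge E (ext_one E) v = v" and wedge_one_right: "wedge E v (ext_one E) = v"
  using ext by (auto simp: exterior_algebra_def)

lemma span_wedges: "V.span {wedges E Xs |Xs. set Xs \<subseteq> m} = UNIV"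
  using ext by (simp add: exterior_algebra_def)

lemma wedges_induct:
  assumes "P 0" "\<And>c Xs v. set Xs \<subseteq> m \<Longrightarrow> P v \<Longrightarrow> P (cscale E c (wedges E Xs) + v)"
  shows "P v"
proof -
  have "v \<in> V.span {wedges E Xs |Xs. set Xs \<subseteq> m}" using span_wedges by simp
  then show ?thesis by (induction rule: V.span_induct_alt) (use assms in auto)
qed

lemma ip_add_right: "ip E u (v + w) = ip E u v + ip E u w"
  and ip_scale_right: "ip E u (cscale E c v) = c * ip E u v"
  and ip_zero_right: "ip E u 0 = 0"
proof -
  have "Vector_Spaces.linear (cscale E) (*) (ip E u)" using spinor unfolding spinor_space_def by blast
  then interpret I: Vector_Spaces.linear "cscale E" "(*)" "ip E u" .
  show "ip E u (v + w) = ip E u v + ip E u w" by (rule I.add)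
  show "ip E u (cscale E c v) = c * ip E u v" by (rule I.scale)
  show "ip E u 0 = 0" by (rule I.zero)
qed

lemma ip_commute: "ip E v w = cnj (ip E w v)"
  using spinor unfolding spinor_space_def by blast

lemma ip_add_left: "ip E (v + w) u = ip E v u + ip E w u"
  and ip_scale_left: "ip E (cscale E c v) u = cnj c * ip E v u"
  and ip_zero_left: "ip E 0 u = 0"
  by (subst ip_commute, simp add: ip_add_right ip_scale_right ip_zero_right ip_commute[symmetric])+

lemma ip_scaleR: "ip E u (r *\<^sub>R v) = r *\<^sub>R ip E u v" "ip E (r *\<^sub>R v) u = r *\<^sub>R ip E v u"
  using ip_scale_right[of u "complex_of_real r" v] ip_scale_left[of "complex_of_real r" v u]
  by (simp_all add: cscale_of_real scaleR_conv_of_real)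

lemma ip_diff_right: "ip E u (v - w) = ip E u v - ip E u w"
  using ip_add_right[of u "v - w" w] by simp

lemma ip_sum_right: "ip E u (\<Sum>i\<in>I. f i) = (\<Sum>i\<in>I. ip E u (f i))"
  by (induction I rule: infinite_finite_induct) (auto simp: ip_add_right ip_zero_right)

lemma ip_sum_left: "ip E (\<Sum>i\<in>I. f i) u = (\<Sum>i\<in>I. ip E (f i) u)"
  by (induction I rule: infinite_finite_induct) (auto simp: ip_add_left ip_zero_left)

lemma ip_self_eq_0: "ip E v v = 0 \<Longrightarrow> v = 0"
proof (rule ccontr)
  assume "ip E v v = 0" "v \<noteq> 0"
  moreover have "\<forall>v. v \<noteq> 0 \<longrightarrow> 0 < Re (ip E v v)" using spinor unfolding spinor_space_def by blast
  ultimately show False by (metis less_irrefl zero_complex.sel(1))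
qed

lemma bounded_bilinear_ip: "bounded_bilinear (ip E)"
  unfolding bilinear_conv_bounded_bilinear[symmetric] bilinear_def
  by (auto intro!: linearI simp: ip_add_right ip_add_left ip_scaleR)

lemma ip_wedges_cong_0:
  assumes "\<And>Xs. set Xs \<subseteq> m \<Longrightarrow> ip E (wedges E Xs) u = 0"
  shows "u = 0"
proof (rule ip_self_eq_0)
  have "ip E v u = 0" for v
    by (induction v rule: wedges_induct) (simp_all add: ip_zero_left ip_add_left ip_scale_left assms)
  then show "ip E u u = 0" .
qed

lemma ip_eqI:
  assumes "\<And>v. ip E v u = ip E v w"
  shows "u = w"
proof -
  have "u - w = 0" by (rule ip_self_eq_0) (use assms in \<open>simp add: ip_diff_right\<close>)
  then show ?thesis by simp
qed

lemma ip_wedges: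
  "set Xs \<subseteq> m \<Longrightarrow> set Ys \<subseteq> m \<Longrightarrow> ip E (wedges E Xs) (wedges E Ys) =
    (if length Xs = length Ys
     then Determinant.det (Matrix.mat (length Xs) (length Xs) (\<lambda>(k, l). herm g0 J (Xs ! k) (Ys ! l)))
     else 0)"
  using spinor unfolding spinor_space_def by blast

section \<open>Linear operators prescribed on decomposable spinors\<close>

text \<open>Values on a spanning family extend linearly only if every linear relation is respected.
  By \<open>dual\<close>, pairing \<open>g\<close> with \<open>p j\<close> is the same as pairing
  \<open>f\<close> with \<open>w j\<close>, so a relation among the \<open>f i\<close> makes the
  corresponding combination of the \<open>g i\<close> pair to zero with all \<open>p j\<close>, and
  \<open>sep\<close> concludes. This takes the place of the universal property of the exterior
  algebra.\<close>

lemma clinear_extension_exists: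
  assumes span: "V.span (f ` I) = UNIV"
    and dual: "\<And>i j. i \<in> I \<Longrightarrow> j \<in> K \<Longrightarrow> ip E (p j) (g i) = ip E (w j) (f i)"
    and sep: "\<And>u. (\<And>j. j \<in> K \<Longrightarrow> ip E (p j) u = 0) \<Longrightarrow> u = 0"
  obtains F where "clinear E F" "\<And>i. i \<in> I \<Longrightarrow> F (f i) = g i"
proof -
  obtain B where B: "B \<subseteq> f ` I" "V.independent B" "f ` I \<subseteq> V.span B"
    using V.maximal_independent_subset[of "f ` I"] by blast
  from B(1) have "\<forall>b\<in>B. \<exists>i\<in>I. f i = b" by auto
  then obtain s where s: "\<And>b. b \<in> B \<Longrightarrow> s b \<in> I" "\<And>b. b \<in> B \<Longrightarrow> f (s b) = b" by metis
  \<comment> \<open>\<open>F\<close> is fixed on an independent subfamily \<open>B\<close>; its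
    values on the remaining \<open>f i\<close> are then checked through the pairings.\<close>
  define F where "F = VV.construct B (\<lambda>b. g (s b))"
  have lin: "Vector_Spaces.linear (cscale E) (cscale E) F"
    unfolding F_def by (rule VV.linear_construct[OF B(2)])
  have Fb: "F b = g (s b)" if "b \<in> B" for b
    unfolding F_def by (rule VV.construct_basis[OF B(2) that])
  have "F (f i) = g i" if i: "i \<in> I" for i
  proof -
    have "f i \<in> V.span B" using B(3) i by auto
    then obtain t r where t: "finite t" "t \<subseteq> B" "f i = (\<Sum>b\<in>t. cscale E (r b) b)"
      by (auto simp: V.span_explicit)
    interpret F: Vector_Spaces.linear "cscale E" "cscale E" F by (rule lin)
    have "F (f i) = (\<Sum>b\<in>t. cscale E (r b) (g (s b)))"
      unfolding t(3) F.sum F.scale using t(2) Fb by (intro sum.cong) auto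
    then have "ip E (p j) (F (f i)) = ip E (p j) (g i)" if j: "j \<in> K" for j
    proof -
      have "ip E (p j) (F (f i)) = (\<Sum>b\<in>t. r b * ip E (p j) (g (s b)))"
        using \<open>F (f i) = _\<close> by (simp add: ip_sum_right ip_scale_right)
      also have "\<dots> = (\<Sum>b\<in>t. r b * ip E (w j) b)"
        using dual[OF s(1) j] s(2) t(2) by (intro sum.cong) (auto simp: subset_iff)
      also have "\<dots> = ip E (w j) (f i)" by (simp add: t(3) ip_sum_right ip_scale_right)
      finally show ?thesis using dual[OF i j] by simp
    qed
    then have "F (f i) - g i = 0" by (intro sep) (simp add: ip_diff_right)
    then show ?thesis by simp
  qed
  then show thesis using that lin unfolding clinear_def by blast
qed

lemma clinear_eqI:
  assumes "clinear E S" "clinear E T" "\<And>Xs. set Xs \<subseteq> m \<Longrightarrow> S (wedges E Xs) = T (wedges E Xs)"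
  shows "S = T"
proof
  fix v show "S v = T v"
    by (induction v rule: wedges_induct) (simp_all add: clinearD[OF assms(1)] clinearD[OF assms(2)] assms(3))
qed

lemma wedges_Cons: "wedges E (X # Xs) = wedge E (embed E X) (wedges E Xs)"
  and wedges_Nil: "wedges E [] = ext_one E"
  by (simp_all add: wedges_def)

text \<open>The value required of the annihilation operator on a decomposable, before a linear
  operator with these values is known to exist.\<close>

definition contract :: "'e \<Rightarrow> 'e list \<Rightarrow> 's" where
  "contract X Xs = (\<Sum>j<length Xs. cscale E ((-1) ^ j * herm g0 J X (Xs ! j))
      (wedges E (take j Xs @ drop (Suc j) Xs)))"

text \<open>Laplace expansion of the Gram determinant of \<open>X # Ys\<close> and \<open>Xs\<close>
  along the row of \<open>X\<close>: the minors are Gram determinants with one entry of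
  \<open>Xs\<close> deleted. If the lengths do not match, both sides vanish. Contraction is thus
  adjoint to wedging before any operator is available.\<close>

lemma ip_contract:
  assumes X: "X \<in> m" and Xs: "set Xs \<subseteq> m" and Ys: "set Ys \<subseteq> m"
  shows "ip E (wedges E Ys) (contract X Xs) = ip E (wedges E (X # Ys)) (wedges E Xs)"
proof -
  define del where "del j = take j Xs @ drop (Suc j) Xs" for j
  have del: "set (del j) \<subseteq> m" for j
    using Xs set_take_subset[of j Xs] set_drop_subset[of "Suc j" Xs] unfolding del_def by auto
  have "ip E (wedges E Ys) (contract X Xs) =
      (\<Sum>j<length Xs. (-1) ^ j * herm g0 J X (Xs ! j) * ip E (wedges E Ys) (wedges E (del j)))"
    by (simp add: contract_def ip_sum_right ip_scale_right del_def)
  also have "\<dots> = ip E (wedges E (X # Ys)) (wedges E Xs)"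
  proof (cases "length Xs = Suc (length Ys)")
    case False
    then have "length Ys \<noteq> length (del j)" if "j < length Xs" for j using that by (auto simp: del_def)
    then show ?thesis using False X Xs Ys del by (simp add: ip_wedges)
  next
    case True
    define n where "n = length Ys"
    define A where "A = Matrix.mat (Suc n) (Suc n) (\<lambda>(k, l). herm g0 J ((X # Ys) ! k) (Xs ! l))"
    have A: "A \<in> carrier_mat (Suc n) (Suc n)" by (simp add: A_def)
    have "ip E (wedges E (X # Ys)) (wedges E Xs) = Determinant.det A"
      using True X Xs Ys by (simp add: ip_wedges A_def n_def)
    also have "\<dots> = (\<Sum>j<Suc n. A $$ (0, j) * cofactor A 0 j)"
      by (rule laplace_expansion_row[OF A]) simp
    also have "\<dots> = (\<Sum>j<length Xs. (-1) ^ j * herm g0 J X (Xs ! j) * ip E (wedges E Ys) (wedges E (del j)))"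
    proof (rule sum.cong)
      fix j assume "j \<in> {..<length Xs}"
      then have j: "j < Suc n" using True by (simp add: n_def)
      \<comment> \<open>Deleting entry \<open>j\<close> of the list shifts the later indices by one,
        exactly as deleting column \<open>j\<close> of the matrix does.\<close>
      have nth: "del j ! l = Xs ! (if l < j then l else Suc l)" if "l < n" for l
        using that True j by (auto simp: del_def nth_append n_def min_def)
      have "mat_delete A 0 j = Matrix.mat n n (\<lambda>(k, l). herm g0 J (Ys ! k) (del j ! l))"
        by (rule eq_matI) (use j nth in \<open>auto simp: mat_delete_def A_def\<close>)
      moreover have "length (del j) = n" using True j by (simp add: del_def n_def)
      ultimately have "ip E (wedges E Ys) (wedges E (del j)) = Determinant.det (mat_delete A 0 j)"
        using Ys del by (simp add: ip_wedges n_def)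
      then show "A $$ (0, j) * cofactor A 0 j =
          (-1) ^ j * herm g0 J X (Xs ! j) * ip E (wedges E Ys) (wedges E (del j))"
        using j by (simp add: cofactor_def A_def)
    qed (use True in \<open>simp add: n_def\<close>)
    finally show ?thesis by simp
  qed
  finally show ?thesis .
qed

lemma span_wedges_image: "V.span (wedges E ` {Xs. set Xs \<subseteq> m}) = UNIV"
  using span_wedges by (simp add: setcompr_eq_image)

text \<open>Existence is the extension lemma with \<open>ip_contract\<close> as the duality;
  uniqueness holds because decomposables span. Together they make the definite description denote an
  operator.\<close>

lemma annihilation_props:
  assumes X: "X \<in> m"
  shows clinear_annihilation: "clinear E (annihilation m g0 J E X)"
    and annihilation_wedges: "\<And>Xs. set Xs \<subseteq> m \<Longrightarrow> annihilation m g0 J E X (wedges E Xs) = contract X Xs"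
proof -
  obtain T where T: "clinear E T" "\<And>Xs. Xs \<in> {Xs. set Xs \<subseteq> m} \<Longrightarrow> T (wedges E Xs) = contract X Xs"
  proof (rule clinear_extension_exists[OF span_wedges_image, where g = "contract X" and K = "{Xs. set Xs \<subseteq> m}"
        and p = "wedges E" and w = "\<lambda>Ys. wedges E (X # Ys)"])
    show "u = 0" if "\<And>j. j \<in> {Xs. set Xs \<subseteq> m} \<Longrightarrow> ip E (wedges E j) u = 0" for u
      using ip_wedges_cong_0 that by simp
  qed (use ip_contract[OF X] in auto)
  have "annihilation m g0 J E X = T"
    unfolding annihilation_def contract_def[symmetric]
  proof (rule the_equality)
    fix S assume S: "clinear E S \<and> (\<forall>Xs. set Xs \<subseteq> m \<longrightarrow> S (wedges E Xs) = contract X Xs)"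
    show "S = T" by (rule clinear_eqI) (use S T in auto)
  qed (use T in auto)
  with T show "clinear E (annihilation m g0 J E X)"
    "\<And>Xs. set Xs \<subseteq> m \<Longrightarrow> annihilation m g0 J E X (wedges E Xs) = contract X Xs" by auto
qed

lemma clinear_creation: "clinear E (creation E X)"
  unfolding creation_def by (rule clinear_wedge_right)

lemma ip_annihilation:
  assumes X: "X \<in> m"
  shows "ip E v (annihilation m g0 J E X w) = ip E (creation E X v) w"
proof -
  note a = clinearD[OF clinear_annihilation[OF X]] and c = clinearD[OF clinear_creation[of X]]
  have w: "ip E (wedges E Ys) (annihilation m g0 J E X w) = ip E (creation E X (wedges E Ys)) w"
    if Ys: "set Ys \<subseteq> m" for Ys
    by (induction w rule: wedges_induct)
      (simp_all add: a ip_zero_right ip_add_right ip_scale_right annihilation_wedges[OF X]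
        ip_contract[OF X _ Ys] creation_def wedges_Cons)
  show ?thesis
    by (induction v rule: wedges_induct)
      (simp_all add: c ip_zero_left ip_add_left ip_scale_left w)
qed

lemma ip_annihilation_left:
  assumes X: "X \<in> m"
  shows "ip E (annihilation m g0 J E X w) v = ip E w (creation E X v)"
  by (subst (1 2) ip_commute) (simp add: ip_annihilation[OF X])

text \<open>Creation and annihilation are mutually adjoint, so their sum is self-adjoint and the
  factor i makes it skew.\<close>

lemma ip_clifford:
  assumes X: "X \<in> m"
  shows "ip E (clifford m g0 J E X v) w = - ip E v (clifford m g0 J E X w)"
  unfolding clifford_def
  by (simp add: ip_scale_left ip_scale_right ip_add_left ip_add_right ip_annihilation[OF X]
      ip_annihilation_left[OF X] algebra_simps)

lemma clinear_clifford: "X \<in> m \<Longrightarrow> clinear E (clifford m g0 J E X)"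
  unfolding clifford_def
  by (intro clinearI)
    (simp_all add: clinearD[OF clinear_annihilation] clinearD[OF clinear_creation]
      V.scale_right_distrib V.scale_scale mult.commute)

lemma creation_vector:
  assumes "X \<in> m"
  shows creation_add: "Y \<in> m \<Longrightarrow> creation E (X + Y) v = creation E X v + creation E Y v"
    and creation_scaleR: "creation E (c *\<^sub>R X) v = c *\<^sub>R creation E X v"
  using assms by (simp_all add: creation_def embed_add embed_scaleR clinearD[OF clinear_wedge_left])

text \<open>Real linearity in the vector is inherited from \<open>creation\<close> by adjointness
  and nondegeneracy, without going back to the contraction formula.\<close>

lemma annihilation_vector:
  assumes X: "X \<in> m"
  shows annihilation_add: "Y \<in> m \<Longrightarrow> annihilation m g0 J E (X + Y) v = annihilation m g0 J E X v + annihilation m g0 J E Y v"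
    and annihilation_scaleR: "annihilation m g0 J E (c *\<^sub>R X) v = c *\<^sub>R annihilation m g0 J E X v"
proof -
  show "annihilation m g0 J E (X + Y) v = annihilation m g0 J E X v + annihilation m g0 J E Y v" if Y: "Y \<in> m"
    by (rule ip_eqI) (simp add: ip_annihilation X Y subspace_add[OF sub] creation_vector ip_add_left ip_add_right)
  show "annihilation m g0 J E (c *\<^sub>R X) v = c *\<^sub>R annihilation m g0 J E X v"
    by (rule ip_eqI) (simp add: ip_annihilation X subspace_scale[OF sub] creation_vector ip_scaleR)
qed

lemma clifford_vector:
  assumes X: "X \<in> m"
  shows clifford_add: "Y \<in> m \<Longrightarrow> clifford m g0 J E (X + Y) v = clifford m g0 J E X v + clifford m g0 J E Y v"
    and clifford_scaleR: "clifford m g0 J E (c *\<^sub>R X) v = c *\<^sub>R clifford m g0 J E X v"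
proof -
  show "clifford m g0 J E (X + Y) v = clifford m g0 J E X v + clifford m g0 J E Y v" if Y: "Y \<in> m"
    by (simp add: clifford_def annihilation_vector X Y creation_vector V.scale_right_distrib)
  show "clifford m g0 J E (c *\<^sub>R X) v = c *\<^sub>R clifford m g0 J E X v"
    by (simp add: clifford_def annihilation_vector X creation_vector V.scale_right_distrib
        cscale_of_real[symmetric] mult.commute scaleR_right_distrib)
qed

lemma clifford_sum:
  assumes "\<And>i. i \<in> I \<Longrightarrow> f i \<in> m"
  shows "clifford m g0 J E (\<Sum>i\<in>I. c i *\<^sub>R f i) v = (\<Sum>i\<in>I. c i *\<^sub>R clifford m g0 J E (f i) v)"
  using assms
proof (induction I rule: infinite_finite_induct)
  case (insert i I)
  then show ?case
    by (simp add: clifford_vector subspace_scale[OF sub] subspace_sum[OF sub])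
qed (use clifford_scaleR[OF subspace_0[OF sub], of 0] in simp_all)

end

section \<open>The action of an isometry of m on the spinors\<close>

locale spinor_isometry = spinor_module m g0 J E
  for m :: "'e::euclidean_space set" and g0 :: "'e \<Rightarrow> 'e \<Rightarrow> real" and J :: "'e \<Rightarrow> 'e"
    and E :: "('e, 's::euclidean_space) ext_alg" +
  fixes T :: "'e \<Rightarrow> 'e"
  assumes image: "T ` m = m"
    and isom: "\<And>X Y. X \<in> m \<Longrightarrow> Y \<in> m \<Longrightarrow> g0 (T X) (T Y) = g0 X Y"
    and J_commute: "\<And>X. X \<in> m \<Longrightarrow> J (T X) = T (J X)"
begin

lemma mem: "X \<in> m \<Longrightarrow> T X \<in> m"
  using image by auto

lemma herm_isom: "X \<in> m \<Longrightarrow> Y \<in> m \<Longrightarrow> herm g0 J (T X) (T Y) = herm g0 J X Y"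
  using J unfolding herm_def complex_structure_on_def by (simp add: isom J_commute)

lemma set_map_subset: "set Xs \<subseteq> m \<Longrightarrow> set (map T Xs) \<subseteq> m"
  using mem by auto

lemma ip_wedges_map:
  assumes "set Xs \<subseteq> m" "set Ys \<subseteq> m"
  shows "ip E (wedges E (map T Xs)) (wedges E (map T Ys)) = ip E (wedges E Xs) (wedges E Ys)"
proof -
  have "Matrix.mat (length Xs) (length Xs) (\<lambda>(k, l). herm g0 J (map T Xs ! k) (map T Ys ! l)) =
      Matrix.mat (length Xs) (length Xs) (\<lambda>(k, l). herm g0 J (Xs ! k) (Ys ! l))"
    if "length Xs = length Ys"
    by (rule eq_matI) (use that assms in \<open>auto simp: herm_isom subset_iff\<close>)
  then show ?thesis
    unfolding ip_wedges[OF assms] ip_wedges[OF set_map_subset[OF assms(1)] set_map_subset[OF assms(2)]] by simp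
qed

lemma list_preimage: "set Xs \<subseteq> m \<Longrightarrow> \<exists>Ys. set Ys \<subseteq> m \<and> Xs = map T Ys"
proof (induction Xs)
  case (Cons X Xs)
  then obtain Ys where Ys: "set Ys \<subseteq> m" "Xs = map T Ys" by auto
  obtain Y where "Y \<in> m" "X = T Y" using Cons.prems image by auto
  then show ?case using Ys by (intro exI[of _ "Y # Ys"]) auto
qed auto

lemma wedges_append: "wedges E (Xs @ Ys) = wedge E (wedges E Xs) (wedges E Ys)"
  by (induction Xs) (simp_all add: wedges_Nil wedges_Cons wedge_one_left wedge_assoc)

text \<open>\<open>T\<close> preserves Gram determinants, which is the duality for the extension
  lemma; as \<open>T\<close> maps \<open>m\<close> onto \<open>m\<close>, the images of
  decomposables still separate spinors. On decomposables multiplicativity is concatenation of lists,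
  and linearity in each factor does the rest.\<close>

lemma ext_map_props:
  shows clinear_ext_map: "clinear E (ext_map m E T)"
    and ext_map_wedges: "\<And>Xs. set Xs \<subseteq> m \<Longrightarrow> ext_map m E T (wedges E Xs) = wedges E (map T Xs)"
    and ext_map_wedge: "\<And>v w. ext_map m E T (wedge E v w) = wedge E (ext_map m E T v) (ext_map m E T w)"
    and ext_map_embed: "\<And>X. X \<in> m \<Longrightarrow> ext_map m E T (embed E X) = embed E (T X)"
proof -
  obtain F where F: "clinear E F" "\<And>Xs. Xs \<in> {Xs. set Xs \<subseteq> m} \<Longrightarrow> F (wedges E Xs) = wedges E (map T Xs)"
  proof (rule clinear_extension_exists[OF span_wedges_image, where g = "\<lambda>Xs. wedges E (map T Xs)"
        and K = "{Xs. set Xs \<subseteq> m}" and p = "\<lambda>Xs. wedges E (map T Xs)" and w = "wedges E"])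
    show "u = 0" if u: "\<And>j. j \<in> {Xs. set Xs \<subseteq> m} \<Longrightarrow> ip E (wedges E (map T j)) u = 0" for u
      by (rule ip_wedges_cong_0) (use u list_preimage in blast)
  qed (use ip_wedges_map in auto)
  note Fl = clinearD[OF F(1)] and l = clinearD[OF clinear_wedge_left] and r = clinearD[OF clinear_wedge_right]
  have w1: "F (wedge E (wedges E Xs) w) = wedge E (F (wedges E Xs)) (F w)" if Xs: "set Xs \<subseteq> m" for Xs w
  proof (induction w rule: wedges_induct)
    case (2 c Ys v)
    have "F (wedges E (Xs @ Ys)) = wedges E (map T Xs @ map T Ys)"
      using F(2)[of "Xs @ Ys"] Xs 2 by simp
    then have "F (wedge E (wedges E Xs) (wedges E Ys)) = wedge E (F (wedges E Xs)) (F (wedges E Ys))"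
      using F(2)[of Xs] F(2)[of Ys] Xs 2 by (simp add: wedges_append)
    with 2 show ?case by (simp add: Fl r)
  qed (simp add: Fl r)
  have w: "F (wedge E v w) = wedge E (F v) (F w)" for v w
    by (induction v rule: wedges_induct) (simp_all add: Fl l w1)
  have e: "F (embed E X) = embed E (T X)" if "X \<in> m" for X
    using F(2)[of "[X]"] that by (simp add: wedges_Cons wedges_Nil wedge_one_right)
  have "ext_map m E T = F"
    unfolding ext_map_def
  proof (rule the_equality)
    show "clinear E F \<and> F (ext_one E) = ext_one E \<and> (\<forall>v w. F (wedge E v w) = wedge E (F v) (F w)) \<and>
      (\<forall>X\<in>m. F (embed E X) = embed E (T X))"
      using F(1) F(2)[of "[]"] w e by (simp add: wedges_Nil)
    fix S assume S: "clinear E S \<and> S (ext_one E) = ext_one E \<and>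
      (\<forall>v w. S (wedge E v w) = wedge E (S v) (S w)) \<and> (\<forall>X\<in>m. S (embed E X) = embed E (T X))"
    have "S (wedges E Xs) = wedges E (map T Xs)" if "set Xs \<subseteq> m" for Xs
      using that S by (induction Xs) (auto simp: wedges_Nil wedges_Cons)
    then show "S = F" by (intro clinear_eqI) (use S F in auto)
  qed
  with F w e show "clinear E (ext_map m E T)"
    "\<And>Xs. set Xs \<subseteq> m \<Longrightarrow> ext_map m E T (wedges E Xs) = wedges E (map T Xs)"
    "\<And>v w. ext_map m E T (wedge E v w) = wedge E (ext_map m E T v) (ext_map m E T w)"
    "\<And>X. X \<in> m \<Longrightarrow> ext_map m E T (embed E X) = embed E (T X)" by auto
qed

lemma ip_ext_map: "ip E (ext_map m E T v) (ext_map m E T w) = ip E v w"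
proof -
  note l = clinearD[OF clinear_ext_map]
  have 1: "ip E (ext_map m E T (wedges E Xs)) (ext_map m E T w) = ip E (wedges E Xs) w" if Xs: "set Xs \<subseteq> m" for Xs w
    by (induction w rule: wedges_induct)
      (simp_all add: l ip_zero_right ip_add_right ip_scale_right ext_map_wedges Xs ip_wedges_map)
  show ?thesis
    by (induction v rule: wedges_induct) (simp_all add: l ip_zero_left ip_add_left ip_scale_left 1)
qed

lemma surj_ext_map: "surj (ext_map m E T)"
proof -
  note l = clinearD[OF clinear_ext_map]
  have "\<exists>w. v = ext_map m E T w" for v
  proof (induction v rule: wedges_induct)
    case 1
    then show ?case using l(3) by metis
  next
    case (2 c Xs v)
    then obtain w where w: "v = ext_map m E T w" by auto
    obtain Ys where "set Ys \<subseteq> m" "Xs = map T Ys" using list_preimage 2 by blast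
    then have "cscale E c (wedges E Xs) + v = ext_map m E T (cscale E c (wedges E Ys) + w)"
      by (simp add: l w ext_map_wedges)
    then show ?case by blast
  qed
  then show ?thesis by (simp add: surj_def)
qed

lemma ext_map_inv: "ext_map m E T (inv_into UNIV (ext_map m E T) v) = v"
  using surj_ext_map by (simp add: surj_f_inv_f)

text \<open>For \<open>creation\<close> this is multiplicativity. For \<open>annihilation\<close> it
  follows by adjointness, because the induced map preserves the inner product and is onto.\<close>

lemma ext_map_clifford:
  assumes X: "X \<in> m"
  shows "ext_map m E T (clifford m g0 J E X v) = clifford m g0 J E (T X) (ext_map m E T v)"
proof -
  note l = clinearD[OF clinear_ext_map]
  have c: "ext_map m E T (creation E X v) = creation E (T X) (ext_map m E T v)" for v
    by (simp add: creation_def ext_map_wedge ext_map_embed X)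
  have a: "ext_map m E T (annihilation m g0 J E X v) = annihilation m g0 J E (T X) (ext_map m E T v)"
  proof (rule ip_eqI)
    fix u
    obtain u' where u: "u = ext_map m E T u'" using surj_ext_map by blast
    show "ip E u (ext_map m E T (annihilation m g0 J E X v)) =
        ip E u (annihilation m g0 J E (T X) (ext_map m E T v))"
      by (simp add: u ip_ext_map ip_annihilation X mem c[symmetric])
  qed
  show ?thesis by (simp add: clifford_def l a c)
qed

text \<open>Pointwise reason for the right invariance of \<open>flux\<close>: the scalar
  \<open>c\<close> has modulus one and cancels against its conjugate, and the induced isometry drops
  out of the inner product.\<close>

lemma ip_clifford_equivariant:
  assumes X: "X \<in> m" and c: "norm c = 1"
  shows "ip E (cscale E c (inv_into UNIV (ext_map m E T) v))
      (clifford m g0 J E X (cscale E c (inv_into UNIV (ext_map m E T) w))) =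
    ip E v (clifford m g0 J E (T X) w)"
proof -
  have "c * cnj c = 1" using c by (simp add: complex_norm_square[symmetric])
  then have "ip E (cscale E c (inv_into UNIV (ext_map m E T) v))
      (clifford m g0 J E X (cscale E c (inv_into UNIV (ext_map m E T) w))) =
    ip E (inv_into UNIV (ext_map m E T) v) (clifford m g0 J E X (inv_into UNIV (ext_map m E T) w))"
    by (simp add: clinearD[OF clinear_clifford[OF X]] ip_scale_left ip_scale_right)
  also have "\<dots> = ip E v (clifford m g0 J E (T X) w)"
    by (subst ip_ext_map[symmetric]) (simp add: ext_map_clifford[OF X] ext_map_inv)
  finally show ?thesis .
qed

end

section \<open>Lie groups and one-parameter subgroups\<close>

lemma smooth_fun_of_charts:
  fixes f :: "'a::topological_space \<Rightarrow> 'b::euclidean_space" and A :: "('a, 'e::euclidean_space) chart set"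
  assumes A: "charted A" and f: "\<And>c. c \<in> A \<Longrightarrow> smooth_on (snd c ` fst c) (f \<circ> chart_inv c)"
  shows "smooth_map A vector_atlas f"
proof -
  have "continuous_on (\<Union>c\<in>A. fst c) f"
  proof (rule continuous_on_open_Union)
    fix S assume "S \<in> fst ` A"
    then obtain c where c: "c \<in> A" "S = fst c" by auto
    note cc = chartedD[OF A c(1)]
    show "open S" using is_chart_open(1)[OF cc] c by simp
    have "continuous_on (fst c) ((f \<circ> chart_inv c) \<circ> snd c)"
      by (intro continuous_on_compose continuous_on_chart[OF cc] smooth_on_imp_continuous_on[OF f[OF c(1)]])
    then show "continuous_on S f" unfolding c(2)
      by (rule continuous_on_eq) (simp add: chart_inv_right[OF cc])
  qed
  then have "continuous_on UNIV f" using A by (simp add: charted_def)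
  then show ?thesis unfolding smooth_map_def vector_atlas_def using f by (auto simp: o_def)
qed

lemma has_vector_derivative_at_shift:
  assumes "((\<lambda>h. k (t + h)) has_vector_derivative D) (at 0)"
  shows "(k has_vector_derivative D) (at t)"
proof -
  have "((\<lambda>s. s - t) has_vector_derivative 1) (at t)"
    by (auto intro!: derivative_eq_intros)
  from vector_diff_chain_at[OF this, of "\<lambda>h. k (t + h)" D] assms show ?thesis by (simp add: o_def)
qed

locale lie_grp =
  fixes G :: "('g::{t2_space, second_countable_topology}, 'e::euclidean_space) lie_struct" (structure)
  assumes lie: "lie_group G"
begin

sublocale group G using lie by (simp add: lie_group_def)

lemma carrier_eq [simp]: "carrier G = UNIV"
  using lie by (simp add: lie_group_def)

lemma inv_cancel [simp]: "inv x \<otimes> (x \<otimes> y) = y" "x \<otimes> (inv x \<otimes> y) = y"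
  by (simp_all add: m_assoc[symmetric])

lemma atl: "smooth_atlas (atlas G)"
  using lie by (simp add: lie_group_def)

lemma ch: "charted (atlas G)"
  by (rule smooth_atlas_charted[OF atl])

lemma chart1: "chart1 G \<in> atlas G" and one_chart1: "\<one> \<in> fst (chart1 G)"
  using lie by (simp_all add: lie_group_def)

lemma is_chart1: "is_chart (chart1 G)"
  by (rule chartedD[OF ch chart1])

abbreviation phi :: "'g \<Rightarrow> 'e" where "phi \<equiv> snd (chart1 G)"
abbreviation psi :: "'e \<Rightarrow> 'g" where "psi \<equiv> chart_inv (chart1 G)"
abbreviation U1 :: "'g set" where "U1 \<equiv> fst (chart1 G)"

lemma smooth_mult:
  assumes M: "charted M" and "smooth_map M (atlas G) f" "smooth_map M (atlas G) g"
  shows "smooth_map M (atlas G) (\<lambda>x. f x \<otimes> g x)"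
proof -
  have "smooth_map (prod_atlas (atlas G) (atlas G)) (atlas G) (\<lambda>(x, y). x \<otimes> y)"
    using lie by (simp add: lie_group_def)
  from smooth_map_compose[OF M charted_prod[OF ch ch] ch smooth_map_Pair[OF M ch ch assms(2,3)] this]
  show ?thesis by (simp add: o_def)
qed

lemma smooth_inv:
  assumes M: "charted M" and "smooth_map M (atlas G) f"
  shows "smooth_map M (atlas G) (\<lambda>x. inv (f x))"
proof -
  have "smooth_map (atlas G) (atlas G) (\<lambda>x. inv x)" using lie by (simp add: lie_group_def)
  from smooth_map_compose[OF M ch ch assms(2) this] show ?thesis by (simp add: o_def)
qed

lemmas smooth_rules = smooth_mult[OF ch] smooth_inv[OF ch] smooth_map_const smooth_map_ident[OF atl]
lemmas smooth_prod_rules = smooth_mult[OF charted_prod[OF ch ch]] smooth_inv[OF charted_prod[OF ch ch]]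
  smooth_map_const smooth_map_fst[OF atl atl] smooth_map_snd[OF atl atl]

lemma chart_map_differentiable:
  assumes f: "smooth_map (atlas G) B f" and "d \<in> B" "x \<in> fst c" "c \<in> atlas G" "f x \<in> fst d"
  shows "snd d \<circ> f \<circ> chart_inv c differentiable at (snd c x)"
  by (rule smooth_on_imp_differentiable[of "snd c ` (fst c \<inter> f -` fst d)"])
    (use assms in \<open>auto simp: smooth_map_def\<close>)

lemma diffable_self:
  "smooth_map (atlas G) (atlas G) f \<Longrightarrow> f \<one> \<in> U1 \<Longrightarrow> (\<lambda>y. phi (f y)) \<circ> psi differentiable at (phi \<one>)"
  using chart_map_differentiable[of "atlas G" f "chart1 G" \<one> "chart1 G"] chart1 one_chart1 by (simp add: o_def)

lemma diffable_vector:
  "smooth_fun G f \<Longrightarrow> f \<circ> psi differentiable at (phi \<one>)"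
  using chart_map_differentiable[of vector_atlas f "(UNIV, \<lambda>x. x)" \<one> "chart1 G"] chart1 one_chart1
  by (simp add: o_def smooth_fun_def vector_atlas_def)

section \<open>Tangent vectors of curves through the identity\<close>

text \<open>Continuity is required besides the derivative because the values of \<open>phi\<close>
  outside \<open>U1\<close> are arbitrary: differentiability of the coordinates alone would not keep
  the curve near the identity.\<close>

definition tangent :: "(real \<Rightarrow> 'g) \<Rightarrow> 'e \<Rightarrow> bool" where
  "tangent \<delta> X \<longleftrightarrow> \<delta> 0 = \<one> \<and> isCont \<delta> 0 \<and> ((\<lambda>t. phi (\<delta> t)) has_vector_derivative X) (at 0)"

lemma tangentD:
  assumes "tangent \<delta> X"
  shows "\<delta> 0 = \<one>" "isCont \<delta> 0" "((\<lambda>t. phi (\<delta> t)) has_vector_derivative X) (at 0)"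
    "\<forall>\<^sub>F t in at 0. \<delta> t \<in> U1"
proof -
  show 1: "\<delta> 0 = \<one>" "isCont \<delta> 0" "((\<lambda>t. phi (\<delta> t)) has_vector_derivative X) (at 0)"
    using assms by (auto simp: tangent_def)
  have "(\<delta> \<longlongrightarrow> \<one>) (at 0)" using 1 by (simp add: isCont_def)
  then show "\<forall>\<^sub>F t in at 0. \<delta> t \<in> U1"
    using topological_tendstoD is_chart_open(1)[OF is_chart1] one_chart1 by blast
qed

lemma tangent_exists: "\<exists>\<delta>. tangent \<delta> X"
proof -
  let ?S = "phi ` U1"
  have S: "open ?S" "phi \<one> \<in> ?S" using is_chart_open[OF is_chart1] one_chart1 by auto
  define l where "l t = phi \<one> + t *\<^sub>R X" for t :: real
  have l: "isCont l 0" unfolding l_def by (intro continuous_intros)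
  have "isCont psi (phi \<one>)"
    using continuous_on_chart_inv[OF is_chart1] S(2) continuous_on_eq_continuous_at[OF S(1)] by blast
  then have "isCont psi (l 0)" by (simp add: l_def)
  then have "isCont (\<lambda>t. psi (l t)) 0" by (rule isCont_o2[OF l])
  moreover have "psi (l 0) = \<one>" using chart_inv_right[OF is_chart1 one_chart1] by (simp add: l_def)
  moreover have "((\<lambda>t. phi (psi (l t))) has_vector_derivative X) (at 0)"
  proof (rule has_vector_derivative_transform_within_open)
    show "(l has_vector_derivative X) (at 0)" unfolding l_def by (auto intro!: derivative_eq_intros)
    have "continuous_on UNIV l" unfolding l_def by (intro continuous_intros)
    then show "open (l -` ?S)" using S(1) open_vimage by blast
    show "0 \<in> l -` ?S" using S by (simp add: l_def)
  qed (use chart_inv_left[OF is_chart1] in auto)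
  ultimately show ?thesis unfolding tangent_def by (intro exI[of _ "\<lambda>t. psi (l t)"]) simp
qed

text \<open>A differential at the identity may be computed along any curve with the given tangent.
  Many identities below are proved by differentiating one curve in two ways.\<close>

lemma tangent_curve:
  assumes \<delta>: "tangent \<delta> X" and f: "f \<circ> psi differentiable at (phi \<one>)"
  shows "((\<lambda>t. f (\<delta> t)) has_vector_derivative diff1 G f X) (at 0)"
proof -
  have D: "(f \<circ> psi has_derivative diff1 G f) (at (phi \<one>))"
    unfolding diff1_def[abs_def] by (rule differentiable_has_frechet_derivative[OF f])
  then have "(f \<circ> psi has_derivative diff1 G f) (at (phi (\<delta> 0)) within range (\<lambda>t. phi (\<delta> t)))"
    using tangentD(1)[OF \<delta>] has_derivative_at_withinI by metis
  from vector_derivative_diff_chain_within[OF tangentD(3)[OF \<delta>] this]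
  have "((f \<circ> psi) \<circ> (\<lambda>t. phi (\<delta> t)) has_vector_derivative diff1 G f X) (at 0)" .
  then show ?thesis unfolding has_vector_derivative_def
  proof (rule has_derivative_transform_eventually)
    show "\<forall>\<^sub>F t in at 0. ((f \<circ> psi) \<circ> (\<lambda>t. phi (\<delta> t))) t = f (\<delta> t)"
      using tangentD(4)[OF \<delta>] by eventually_elim (simp add: chart_inv_right[OF is_chart1])
    show "((f \<circ> psi) \<circ> (\<lambda>t. phi (\<delta> t))) 0 = f (\<delta> 0)"
      using tangentD(1)[OF \<delta>] by (simp add: chart_inv_right[OF is_chart1 one_chart1])
  qed auto
qed

lemma diff1_eqI:
  assumes "tangent \<delta> X" "f \<circ> psi differentiable at (phi \<one>)" "((\<lambda>t. f (\<delta> t)) has_vector_derivative Y) (at 0)"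
  shows "diff1 G f X = Y"
  using vector_derivative_unique_at[OF tangent_curve[OF assms(1,2)] assms(3)] .

lemma linear_diff1: "f \<circ> psi differentiable at (phi \<one>) \<Longrightarrow> linear (diff1 G f)"
  unfolding diff1_def[abs_def] by (rule linear_frechet_derivative)

lemma tangent_map:
  assumes \<delta>: "tangent \<delta> X" and h: "smooth_map (atlas G) (atlas G) h" "h \<one> = \<one>"
  shows "tangent (\<lambda>t. h (\<delta> t)) (diff1 G (\<lambda>y. phi (h y)) X)"
  unfolding tangent_def
proof (intro conjI)
  show "h (\<delta> 0) = \<one>" using h tangentD[OF \<delta>] by simp
  have "isCont h (\<delta> 0)" using smooth_map_continuous[OF h(1)] by (simp add: continuous_on_eq_continuous_at)
  then show "isCont (\<lambda>t. h (\<delta> t)) 0" by (rule isCont_o2[OF tangentD(2)[OF \<delta>]])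
  show "((\<lambda>t. phi (h (\<delta> t))) has_vector_derivative diff1 G (\<lambda>y. phi (h y)) X) (at 0)"
    by (rule tangent_curve[OF \<delta> diffable_self[OF h(1)]]) (simp add: h one_chart1)
qed

text \<open>One \<open>D\<close> serves all pairs of curves: the tangent of the combined curve
  depends on the two tangents only, which \<open>tangent_mult_inv\<close> exploits.\<close>

lemma tangent_map2:
  assumes h: "smooth_map (prod_atlas (atlas G) (atlas G)) (atlas G) h" "h (\<one>, \<one>) = \<one>"
  shows "\<exists>D. \<forall>\<delta> \<epsilon> X Y. tangent \<delta> X \<longrightarrow> tangent \<epsilon> Y \<longrightarrow> tangent (\<lambda>t. h (\<delta> t, \<epsilon> t)) (D (X, Y))"
proof -
  let ?c = "(U1 \<times> U1, map_prod phi phi)"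
  have c: "?c \<in> prod_atlas (atlas G) (atlas G)" using chart1 unfolding prod_atlas_def by blast
  define F where "F = phi \<circ> h \<circ> chart_inv ?c"
  have "smooth_on (map_prod phi phi ` (U1 \<times> U1 \<inter> h -` U1)) F"
    using h(1) c chart1 unfolding smooth_map_def F_def by fastforce
  moreover have "(phi \<one>, phi \<one>) \<in> map_prod phi phi ` (U1 \<times> U1 \<inter> h -` U1)"
    using one_chart1 h(2) by (intro image_eqI[of _ _ "(\<one>, \<one>)"]) auto
  ultimately have "F differentiable at (phi \<one>, phi \<one>)" by (rule smooth_on_imp_differentiable)
  then obtain D where D: "(F has_derivative D) (at (phi \<one>, phi \<one>))" unfolding differentiable_def by blast
  have "tangent (\<lambda>t. h (\<delta> t, \<epsilon> t)) (D (X, Y))" if \<delta>: "tangent \<delta> X" and \<epsilon>: "tangent \<epsilon> Y" for \<delta> \<epsilon> X Y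
    unfolding tangent_def
  proof (intro conjI)
    show "h (\<delta> 0, \<epsilon> 0) = \<one>" using h tangentD[OF \<delta>] tangentD[OF \<epsilon>] by simp
    have "isCont h (\<delta> 0, \<epsilon> 0)" using smooth_map_continuous[OF h(1)] by (simp add: continuous_on_eq_continuous_at)
    then show "isCont (\<lambda>t. h (\<delta> t, \<epsilon> t)) 0"
      using isCont_o2[OF continuous_Pair[OF tangentD(2)[OF \<delta>] tangentD(2)[OF \<epsilon>]]] by blast
    have "((\<lambda>t. (phi (\<delta> t), phi (\<epsilon> t))) has_vector_derivative (X, Y)) (at 0)"
      using has_derivative_Pair[OF tangentD(3)[OF \<delta>, unfolded has_vector_derivative_def]
          tangentD(3)[OF \<epsilon>, unfolded has_vector_derivative_def]]
      by (simp add: has_vector_derivative_def)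
    then have "(F \<circ> (\<lambda>t. (phi (\<delta> t), phi (\<epsilon> t))) has_vector_derivative D (X, Y)) (at 0)"
      by (rule vector_derivative_diff_chain_within)
        (use D tangentD(1)[OF \<delta>] tangentD(1)[OF \<epsilon>] in \<open>simp add: has_derivative_at_withinI\<close>)
    then show "((\<lambda>t. phi (h (\<delta> t, \<epsilon> t))) has_vector_derivative D (X, Y)) (at 0)"
      unfolding has_vector_derivative_def
    proof (rule has_derivative_transform_eventually)
      have *: "F (phi x, phi y) = phi (h (x, y))" if "x \<in> U1" "y \<in> U1" for x y
        unfolding F_def using chart_inv_prod[OF is_chart1 is_chart1] chart_inv_right[OF is_chart1] that by simp
      show "\<forall>\<^sub>F t in at 0. (F \<circ> (\<lambda>t. (phi (\<delta> t), phi (\<epsilon> t)))) t = phi (h (\<delta> t, \<epsilon> t))"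
        using tangentD(4)[OF \<delta>] tangentD(4)[OF \<epsilon>] by eventually_elim (simp add: *)
      show "(F \<circ> (\<lambda>t. (phi (\<delta> t), phi (\<epsilon> t)))) 0 = phi (h (\<delta> 0, \<epsilon> 0))"
        using tangentD(1)[OF \<delta>] tangentD(1)[OF \<epsilon>] * one_chart1 by simp
    qed auto
  qed
  then show ?thesis by blast
qed

lemma tangent_unique: "tangent \<delta> X \<Longrightarrow> tangent \<delta> Y \<Longrightarrow> X = Y"
  using vector_derivative_unique_at tangentD(3) by blast

lemma tangent_const: "tangent (\<lambda>t. \<one>) 0"
  unfolding tangent_def by simp

text \<open>The tangent depends only on the pair (X,X), so it can be read off from two equal curves,
  for which the product is constantly the identity. This spares computing the differentials of
  multiplication and inversion.\<close>

lemma tangent_mult_inv: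
  assumes "tangent \<delta> X" "tangent \<epsilon> X"
  shows "tangent (\<lambda>t. z \<otimes> (\<delta> t \<otimes> inv (\<epsilon> t)) \<otimes> inv z) 0"
proof -
  have "smooth_map (prod_atlas (atlas G) (atlas G)) (atlas G) (\<lambda>p. z \<otimes> (fst p \<otimes> inv (snd p)) \<otimes> inv z)"
    by (intro smooth_prod_rules)
  from tangent_map2[OF this] obtain D where
    "\<forall>\<delta> \<epsilon> X Y. tangent \<delta> X \<longrightarrow> tangent \<epsilon> Y \<longrightarrow> tangent (\<lambda>t. z \<otimes> (\<delta> t \<otimes> inv (\<epsilon> t)) \<otimes> inv z) (D (X, Y))"
    by fastforce
  then have D: "\<And>\<delta> \<epsilon> X Y. tangent \<delta> X \<Longrightarrow> tangent \<epsilon> Y \<Longrightarrow> tangent (\<lambda>t. z \<otimes> (\<delta> t \<otimes> inv (\<epsilon> t)) \<otimes> inv z) (D (X, Y))"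
    by blast
  have "tangent (\<lambda>t. \<one>) (D (X, X))" using D[OF assms(1) assms(1)] by simp
  then have "D (X, X) = 0" using tangent_unique tangent_const by blast
  with D[OF assms] show ?thesis by simp
qed

lemma tangent_scale: "tangent \<delta> X \<Longrightarrow> tangent (\<lambda>t. \<delta> (c * t)) (c *\<^sub>R X)"
  unfolding tangent_def
proof (intro conjI)
  assume \<delta>: "\<delta> 0 = \<one> \<and> isCont \<delta> 0 \<and> ((\<lambda>t. phi (\<delta> t)) has_vector_derivative X) (at 0)"
  have c: "((\<lambda>t. c * t) has_vector_derivative c) (at 0)"
    by (auto intro!: derivative_eq_intros simp: has_real_derivative_iff_has_vector_derivative[symmetric])
  show "\<delta> (c * 0) = \<one>" using \<delta> by simp
  show "isCont (\<lambda>t. \<delta> (c * t)) 0" by (rule isCont_o2[of 0 "\<lambda>t. c * t"]) (use \<delta> in auto)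
  show "((\<lambda>t. phi (\<delta> (c * t))) has_vector_derivative c *\<^sub>R X) (at 0)"
    using vector_diff_chain_at[OF c, of "\<lambda>t. phi (\<delta> t)" X] \<delta> by (simp add: o_def)
qed

text \<open>\<open>velocity g t X\<close>: the curve \<open>g\<close> has left logarithmic derivative \<open>X\<close> at \<open>t\<close>.\<close>

definition velocity :: "(real \<Rightarrow> 'g) \<Rightarrow> real \<Rightarrow> 'e \<Rightarrow> bool" where
  "velocity g t X \<longleftrightarrow> tangent (\<lambda>h. inv (g t) \<otimes> g (t + h)) X"

lemma velocity_left: "velocity g t X \<Longrightarrow> velocity (\<lambda>s. z \<otimes> g s) t X"
  unfolding velocity_def by (simp add: inv_mult_group m_assoc)

lemma velocity_shift: "velocity g (s + t) X \<Longrightarrow> velocity (\<lambda>t. g (s + t)) t X"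
  unfolding velocity_def by (simp add: add.assoc)

text \<open>If \<delta> and \<epsilon> are the increments of \<open>g\<close> and \<open>k\<close>,
  translated back to the identity, then the increment of the quotient is \<delta> \<epsilon>^-1
  conjugated by \<open>k t\<close>.\<close>

lemma velocity_mult_inv:
  assumes "velocity g t X" "velocity k t X"
  shows "velocity (\<lambda>t. g t \<otimes> inv (k t)) t 0"
  using tangent_mult_inv[OF assms[unfolded velocity_def], of "k t"]
  unfolding velocity_def by (simp add: inv_mult_group m_assoc)

lemma continuous_left: "continuous_on UNIV (\<lambda>y. z \<otimes> y)"
  by (rule smooth_map_continuous[of "atlas G" "atlas G"]) (intro smooth_rules)

lemma velocity_isCont:
  assumes "velocity g t X"
  shows "isCont g t"
proof -
  have c: "isCont (\<lambda>y. g t \<otimes> y) z" for z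
    using continuous_left[of "g t"] by (simp add: continuous_on_eq_continuous_at)
  have "isCont (\<lambda>h. inv (g t) \<otimes> g (t + h)) 0" using assms tangentD(2) unfolding velocity_def by blast
  then have "isCont (\<lambda>h. g t \<otimes> (inv (g t) \<otimes> g (t + h))) 0" by (rule isCont_o2[OF _ c])
  then have "isCont (\<lambda>h. g (t + h)) 0" by simp
  then show ?thesis by (subst isCont_iff) (simp add: isCont_def)
qed

text \<open>Translated so that time \<open>t0\<close> sits at the identity, the curve stays in the
  single chart domain \<open>U1\<close> for a while, and its coordinates have derivative zero there.
  So \<open>g\<close> is locally constant on a connected interval.\<close>

lemma velocity_zero_constant:
  assumes v: "\<And>t. t \<in> {a<..<b} \<Longrightarrow> velocity g t 0" and "s \<in> {a<..<b}" "t \<in> {a<..<b}"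
  shows "g s = g t"
proof (rule connected_local_const[OF _ assms(2,3)])
  show "connected {a<..<b}" by simp
  show "\<forall>t0\<in>{a<..<b}. \<forall>\<^sub>F t in at t0 within {a<..<b}. g t0 = g t"
  proof
    fix t0 assume t0: "t0 \<in> {a<..<b}"
    define w where "w t = inv (g t0) \<otimes> g t" for t
    have w0: "w t0 = \<one>" by (simp add: w_def)
    have contg: "isCont g t" if "t \<in> {a<..<b}" for t using velocity_isCont[OF v[OF that]] .
    have contw: "continuous_on {a<..<b} w"
      unfolding w_def
      by (rule continuous_on_compose2[OF continuous_left]) (use contg in \<open>auto simp: continuous_at_imp_continuous_on\<close>)
    have "open ({a<..<b} \<inter> w -` U1)"
      using continuous_on_open_vimage[OF open_greaterThanLessThan] contw is_chart_open(1)[OF is_chart1]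
      by (metis Int_commute)
    moreover have "t0 \<in> {a<..<b} \<inter> w -` U1" using t0 w0 one_chart1 by simp
    ultimately obtain e where e: "e > 0" "ball t0 e \<subseteq> {a<..<b} \<inter> w -` U1"
      using open_contains_ball by blast
    have D: "((\<lambda>t. phi (w t)) has_vector_derivative 0) (at t)" if t: "t \<in> ball t0 e" for t
    proof -
      have wU: "w t \<in> U1" and tab: "t \<in> {a<..<b}" using e t by auto
      have df: "(\<lambda>y. phi (w t \<otimes> y)) \<circ> psi differentiable at (phi \<one>)"
        by (rule diffable_self) (use wU in \<open>auto intro!: smooth_rules\<close>)
      have "diff1 G (\<lambda>y. phi (w t \<otimes> y)) 0 = 0" using linear_0[OF linear_diff1[OF df]] .
      then have "((\<lambda>h. phi (w t \<otimes> (inv (g t) \<otimes> g (t + h)))) has_vector_derivative 0) (at 0)"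
        using tangent_curve[OF v[OF tab, unfolded velocity_def] df] by simp
      then have "((\<lambda>h. phi (w (t + h))) has_vector_derivative 0) (at 0)"
        by (simp add: w_def m_assoc)
      then show ?thesis
        by (rule has_vector_derivative_at_shift)
    qed
    have "\<exists>c. \<forall>t\<in>ball t0 e. phi (w t) = c"
      by (rule has_derivative_zero_constant)
        (use D in \<open>auto simp: has_vector_derivative_def has_derivative_at_withinI\<close>)
    then have "phi (w t) = phi (w t0)" if "t \<in> ball t0 e" for t using that e(1) by (metis centre_in_ball)
    then have "w t = \<one>" if "t \<in> ball t0 e" for t
      using that e(2) w0 chart_inv_right[OF is_chart1] one_chart1 by (metis IntD2 subsetD vimageD)
    then have "g t0 = g t" if "t \<in> ball t0 e" for t
      using that unfolding w_def by (metis inv_cancel(2) r_one carrier_eq UNIV_I)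
    then show "\<forall>\<^sub>F t in at t0 within {a<..<b}. g t0 = g t"
      unfolding eventually_at by (intro exI[of _ e]) (use e(1) in \<open>auto simp: dist_commute\<close>)
  qed
qed

text \<open>The quotient of the two curves has velocity zero and is therefore constant; the group
  structure takes the place of a Gronwall estimate.\<close>

lemma velocity_unique:
  assumes "\<And>t. t \<in> {a<..<b} \<Longrightarrow> velocity g t X" "\<And>t. t \<in> {a<..<b} \<Longrightarrow> velocity k t X"
    and "s \<in> {a<..<b}" "g s = k s" "t \<in> {a<..<b}"
  shows "g t = k t"
proof -
  have "velocity (\<lambda>t. g t \<otimes> inv (k t)) u 0" if "u \<in> {a<..<b}" for u
    using velocity_mult_inv[OF assms(1)[OF that] assms(2)[OF that]] .
  from velocity_zero_constant[OF this assms(5,3)]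
  have "g t \<otimes> inv (k t) = g s \<otimes> inv (k s)" by blast
  then have "g t \<otimes> inv (k t) = \<one>" using assms(4) by simp
  then show ?thesis using inv_equality[of "g t" "inv (k t)"] by simp
qed

section \<open>One-parameter subgroups and the exponential map\<close>

lemma one_parameter_subgroupD:
  assumes "one_parameter_subgroup G X \<gamma>"
  shows "\<gamma> (s + t) = \<gamma> s \<otimes> \<gamma> t" "\<gamma> 0 = \<one>" "tangent \<gamma> X" "velocity \<gamma> t X" "inv (\<gamma> t) = \<gamma> (- t)"
proof -
  show add: "\<gamma> (s + t) = \<gamma> s \<otimes> \<gamma> t" for s t using assms by (simp add: one_parameter_subgroup_def)
  have "\<gamma> 0 = \<gamma> 0 \<otimes> \<gamma> 0" using add[of 0 0] by simp
  then show zero: "\<gamma> 0 = \<one>" by (metis UNIV_I carrier_eq r_cancel_one)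
  have "continuous_on UNIV \<gamma>" using assms smooth_map_continuous unfolding one_parameter_subgroup_def by blast
  then show tan: "tangent \<gamma> X" unfolding tangent_def using zero assms
    by (simp add: one_parameter_subgroup_def continuous_on_eq_continuous_at o_def)
  then show "velocity \<gamma> t X" unfolding velocity_def add by simp
  show "inv (\<gamma> t) = \<gamma> (- t)" using add[of "-t" t] zero inv_equality by simp
qed

lemma one_parameter_subgroup_unique:
  assumes "one_parameter_subgroup G X \<gamma>" "one_parameter_subgroup G X \<gamma>'"
  shows "\<gamma> = \<gamma>'"
proof
  fix t
  show "\<gamma> t = \<gamma>' t"
    by (rule velocity_unique[of "-\<bar>t\<bar> - 1" "\<bar>t\<bar> + 1" _ X _ 0])
      (use one_parameter_subgroupD[OF assms(1)] one_parameter_subgroupD[OF assms(2)] in auto)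
qed

text \<open>The equation of the left-invariant field is solved in the chart at the identity. Most of
  the proof converts the coordinate equation back into a statement about
  \<open>velocity\<close>.\<close>

lemma integral_curve_exists:
  obtains e c where "0 < e" "smooth_on {-e<..<e} c" "\<And>t. \<bar>t\<bar> < e \<Longrightarrow> c t \<in> phi ` U1"
    "psi (c 0) = \<one>" "\<And>t. \<bar>t\<bar> < e \<Longrightarrow> velocity (\<lambda>t. psi (c t)) t X"
proof -
  let ?S = "phi ` U1"
  have S: "open ?S" "phi \<one> \<in> ?S" using is_chart_open[OF is_chart1] one_chart1 by auto
  \<comment> \<open>Coordinate expression of the left-invariant field with value \<open>X\<close> at
    the identity.\<close>
  define F where "F q = diff1 G (\<lambda>y. phi (psi q \<otimes> y)) X" for q
  have "smooth_map (prod_atlas (atlas G) (atlas G)) (atlas G) (\<lambda>p. fst p \<otimes> snd p)"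
    by (intro smooth_prod_rules)
  from smooth_map_partial[OF ch ch ch this chart1 chart1 one_chart1 chart1, of X]
  have F: "smooth_on ?S F"
    unfolding F_def diff1_def by (simp add: o_def)
  obtain e c where e: "0 < e" and c: "c 0 = phi \<one>" "\<And>t. \<bar>t\<bar> < e \<Longrightarrow> c t \<in> ?S"
    "\<And>t. \<bar>t\<bar> < e \<Longrightarrow> (c has_vector_derivative F (c t)) (at t)"
    using picard_local[OF S] F unfolding smooth_on_def by metis
  have "velocity (\<lambda>t. psi (c t)) t X" if t: "\<bar>t\<bar> < e" for t
    unfolding velocity_def tangent_def
  proof (intro conjI)
    define z where "z = psi (c t)"
    have z: "z \<in> U1" "phi z = c t"
      using chart_inv_mem[OF is_chart1 c(2)[OF t]] chart_inv_left[OF is_chart1 c(2)[OF t]] by (auto simp: z_def)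
    show "inv (psi (c t)) \<otimes> psi (c (t + 0)) = \<one>" by simp
    have ct: "isCont c t" using has_vector_derivative_continuous[OF c(3)[OF t]] .
    have "isCont psi (c t)"
      using continuous_on_chart_inv[OF is_chart1] c(2)[OF t] continuous_on_eq_continuous_at[OF S(1)] by blast
    then have "isCont (\<lambda>s. psi (c s)) t" by (rule isCont_o2[OF ct])
    moreover have "isCont (\<lambda>y. inv z \<otimes> y) (psi (c t))"
      using continuous_left by (simp add: continuous_on_eq_continuous_at)
    ultimately have "isCont (\<lambda>s. inv z \<otimes> psi (c s)) t" by (rule isCont_o2)
    then show "isCont (\<lambda>h. inv (psi (c t)) \<otimes> psi (c (t + h))) 0"
      by (subst (asm) isCont_iff) (simp add: isCont_def z_def)
    have "smooth_map (atlas G) (atlas G) (\<lambda>y. inv z \<otimes> y)" by (intro smooth_rules)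
    from chart_map_differentiable[OF this chart1 z(1) chart1]
    have "phi \<circ> (\<lambda>y. inv z \<otimes> y) \<circ> psi differentiable at (c t)"
      using one_chart1 z(2) by simp
    then obtain D where D: "(phi \<circ> (\<lambda>y. inv z \<otimes> y) \<circ> psi has_derivative D) (at (c t))"
      unfolding differentiable_def by blast
    have chain: "((\<lambda>h. phi (inv z \<otimes> psi (k h))) has_vector_derivative D (F (c t))) (at 0)"
      if "(k has_vector_derivative F (c t)) (at 0)" "k 0 = c t" for k
    proof -
      have "(phi \<circ> (\<lambda>y. inv z \<otimes> y) \<circ> psi has_derivative D) (at (k 0) within range k)"
        using D that(2) has_derivative_at_withinI by metis
      from vector_derivative_diff_chain_within[OF that(1) this] show ?thesis by (simp add: o_def)
    qed
    \<comment> \<open>\<open>D\<close> is the differential at \<open>c t\<close> of left translation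
      by \<open>inv z\<close>. It sends \<open>F (c t)\<close> to \<open>X\<close>, as is seen by
      translating an auxiliary curve tangent to \<open>X\<close> by \<open>z\<close> and
      back.\<close>
    obtain \<delta> where \<delta>: "tangent \<delta> X" using tangent_exists by blast
    have df: "(\<lambda>y. phi (z \<otimes> y)) \<circ> psi differentiable at (phi \<one>)"
      by (rule diffable_self) (use z in \<open>auto intro!: smooth_rules\<close>)
    have "((\<lambda>h. phi (z \<otimes> \<delta> h)) has_vector_derivative F (c t)) (at 0)"
      using tangent_curve[OF \<delta> df] by (simp add: F_def z_def)
    then have "((\<lambda>h. phi (inv z \<otimes> psi (phi (z \<otimes> \<delta> h)))) has_vector_derivative D (F (c t))) (at 0)"
      by (rule chain) (simp add: tangentD(1)[OF \<delta>] z)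
    then have "((\<lambda>h. phi (\<delta> h)) has_vector_derivative D (F (c t))) (at 0)"
      unfolding has_vector_derivative_def
    proof (rule has_derivative_transform_eventually)
      have cl: "isCont (\<lambda>y. z \<otimes> y) (\<delta> 0)"
        using continuous_left by (simp add: continuous_on_eq_continuous_at)
      have "((\<lambda>h. z \<otimes> \<delta> h) \<longlongrightarrow> z) (at 0)"
        using isCont_o2[OF tangentD(2)[OF \<delta>] cl] tangentD(1)[OF \<delta>] by (simp add: isCont_def)
      then have "\<forall>\<^sub>F h in at 0. z \<otimes> \<delta> h \<in> U1"
        using topological_tendstoD is_chart_open(1)[OF is_chart1] z(1) by blast
      then show "\<forall>\<^sub>F h in at 0. phi (inv z \<otimes> psi (phi (z \<otimes> \<delta> h))) = phi (\<delta> h)"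
        by eventually_elim (simp add: chart_inv_right[OF is_chart1])
    qed (simp_all add: tangentD(1)[OF \<delta>] chart_inv_right[OF is_chart1 z(1)])
    then have "D (F (c t)) = X" using tangentD(3)[OF \<delta>] vector_derivative_unique_at by blast
    moreover have "((\<lambda>h. c (t + h)) has_vector_derivative F (c t)) (at 0)"
    proof -
      have "((\<lambda>h. t + h) has_vector_derivative 1) (at 0)" by (auto intro!: derivative_eq_intros)
      from vector_diff_chain_at[OF this, of c "F (c t)"] c(3)[OF t] show ?thesis by (simp add: o_def)
    qed
    from chain[OF this] have "((\<lambda>h. phi (inv z \<otimes> psi (c (t + h)))) has_vector_derivative D (F (c t))) (at 0)" by simp
    ultimately show "((\<lambda>h. phi (inv (psi (c t)) \<otimes> psi (c (t + h)))) has_vector_derivative X) (at 0)"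
      by (simp add: z_def)
  qed
  then show thesis
    using that[OF e ode_solution_smooth[OF F c(2,3)] c(2)] c(1) chart_inv_right[OF is_chart1 one_chart1] by simp
qed

text \<open>As curves in \<open>t\<close>, psi(c(s + t)) and the left translate of psi(c(t)) by
  psi(c(s)) both have velocity X and agree at 0. Halving the interval keeps s + t inside the domain
  of the solution.\<close>

lemma local_one_parameter_subgroup_exists:
  obtains e c where "0 < e" "smooth_on {-e<..<e} c" "\<And>t. \<bar>t\<bar> < e \<Longrightarrow> c t \<in> phi ` U1"
    "psi (c 0) = \<one>" "velocity (\<lambda>t. psi (c t)) 0 X"
    "\<And>s t. \<bar>s\<bar> < e \<Longrightarrow> \<bar>t\<bar> < e \<Longrightarrow> psi (c (s + t)) = psi (c s) \<otimes> psi (c t)"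
proof -
  obtain e c where e: "0 < e" and c: "smooth_on {-e<..<e} c" "\<And>t. \<bar>t\<bar> < e \<Longrightarrow> c t \<in> phi ` U1"
    "psi (c 0) = \<one>" "\<And>t. \<bar>t\<bar> < e \<Longrightarrow> velocity (\<lambda>t. psi (c t)) t X"
    using integral_curve_exists by metis
  show thesis
  proof (rule that[of "e / 2" c])
    show "smooth_on {-(e/2)<..<e/2} c" by (rule smooth_on_subset[OF c(1)]) (use e in auto)
    fix s t assume st: "\<bar>s\<bar> < e / 2" "\<bar>t\<bar> < e / 2"
    show "psi (c (s + t)) = psi (c s) \<otimes> psi (c t)"
    proof (rule velocity_unique[of "-(e/2)" "e/2" "\<lambda>t. psi (c (s + t))" X "\<lambda>t. psi (c s) \<otimes> psi (c t)" 0])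
      fix u assume u: "u \<in> {-(e/2)<..<e/2}"
      then have "\<bar>s + u\<bar> < e" "\<bar>u\<bar> < e" using st by auto
      then show "velocity (\<lambda>t. psi (c (s + t))) u X" "velocity (\<lambda>t. psi (c s) \<otimes> psi (c t)) u X"
        using velocity_shift[of "\<lambda>t. psi (c t)"] velocity_left[of "\<lambda>t. psi (c t)"] c(4) by blast+
    qed (use st e c(3) in auto)
  qed (use e c in auto)
qed

text \<open>The local subgroup \<open>g\<close> is extended to the whole line by taking the N-th
  power of g(t/N) for N so large that t/N lies in the domain.\<close>

lemma one_parameter_subgroup_exists: "\<exists>\<gamma>. one_parameter_subgroup G X \<gamma>"
proof -
  obtain e c where e: "0 < e" and c: "smooth_on {-e<..<e} c" "\<And>t. \<bar>t\<bar> < e \<Longrightarrow> c t \<in> phi ` U1"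
    "psi (c 0) = \<one>" "velocity (\<lambda>t. psi (c t)) 0 X"
    "\<And>s t. \<bar>s\<bar> < e \<Longrightarrow> \<bar>t\<bar> < e \<Longrightarrow> psi (c (s + t)) = psi (c s) \<otimes> psi (c t)"
    using local_one_parameter_subgroup_exists by metis
  define g where "g t = psi (c t)" for t
  have g0: "g 0 = \<one>" using c by (simp add: g_def)
  have gadd: "g (s + t) = g s \<otimes> g t" if "\<bar>s\<bar> < e" "\<bar>t\<bar> < e" for s t using c(5) that by (simp add: g_def)
  have gpow: "g (real k * t) = g t [^] k" if "real k * \<bar>t\<bar> < e" for k :: nat and t
    using that
  proof (induction k)
    case (Suc k)
    have "real k * \<bar>t\<bar> \<le> real (Suc k) * \<bar>t\<bar>" "1 * \<bar>t\<bar> \<le> real (Suc k) * \<bar>t\<bar>" by (intro mult_right_mono; simp)+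
    then have 1: "real k * \<bar>t\<bar> < e" "\<bar>t\<bar> < e" using Suc.prems by linarith+
    have "real (Suc k) * t = real k * t + t" by (simp add: algebra_simps)
    then have "g (real (Suc k) * t) = g (real k * t) \<otimes> g t" using gadd[of "real k * t" t] 1 by (simp add: abs_mult)
    then show ?case using Suc.IH[OF 1(1)] by simp
  qed (simp add: g0)
  define ok where "ok N t \<longleftrightarrow> 0 < N \<and> \<bar>t\<bar> < real N * e" for N :: nat and t
  have ex_ok: "\<exists>N. ok N t" for t
  proof -
    obtain N where "\<bar>t\<bar> / e < real N" using reals_Archimedean2 by blast
    then have "\<bar>t\<bar> < real N * e" using e by (simp add: field_simps)
    moreover from this have "0 < N" by (cases N) auto
    ultimately show ?thesis by (auto simp: ok_def)
  qed
  have ok_mono: "ok M t" if "ok N t" "N \<le> M" for N M t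
  proof -
    have "real N * e \<le> real M * e" using that e by (intro mult_right_mono) auto
    then show ?thesis using that unfolding ok_def by linarith
  qed
  \<comment> \<open>Passing from \<open>N\<close> to a multiple changes nothing, so two admissible
    exponents are compared through their product.\<close>
  have refine: "g (t / real N) [^] N = g (t / real (N * M)) [^] (N * M)" if N: "ok N t" and M: "0 < M" for N M t
  proof -
    have "real M * \<bar>t / real (N * M)\<bar> = \<bar>t\<bar> / real N" using M by (simp add: abs_mult)
    also have "\<dots> < e" using N by (simp add: ok_def field_simps)
    finally have "g (real M * (t / real (N * M))) = g (t / real (N * M)) [^] M" by (rule gpow)
    moreover have "real M * (t / real (N * M)) = t / real N" using M by simp
    ultimately show ?thesis by (simp add: nat_pow_pow mult.commute)
  qed
  define \<gamma> where "\<gamma> t = g (t / real (SOME N. ok N t)) [^] (SOME N. ok N t)" for t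
  have \<gamma>: "\<gamma> t = g (t / real N) [^] N" if N: "ok N t" for N t
  proof -
    define M where "M = (SOME N. ok N t)"
    have M: "ok M t" unfolding M_def using N by (rule someI)
    have "\<gamma> t = g (t / real M) [^] M" by (simp add: \<gamma>_def M_def)
    also have "\<dots> = g (t / real N) [^] N"
      using refine[OF M, of N] refine[OF N, of M] M N by (simp add: ok_def mult.commute)
    finally show ?thesis .
  qed
  have \<gamma>g: "\<gamma> t = g t" if "\<bar>t\<bar> < e" for t
    using \<gamma>[of 1 t] that by (simp add: ok_def)
  have add: "\<gamma> (s + t) = \<gamma> s \<otimes> \<gamma> t" for s t
  proof -
    obtain A B C where ABC: "ok A s" "ok B t" "ok C (s + t)" using ex_ok by metis
    define N where "N = A + B + C"
    have N: "ok N s" "ok N t" "ok N (s + t)" using ABC ok_mono unfolding N_def by (meson le_add1 le_add2 trans_le_add1)+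
    have lt: "\<bar>s / real N\<bar> < e" "\<bar>t / real N\<bar> < e" using N by (simp_all add: ok_def field_simps)
    \<comment> \<open>The local group law and commutativity of addition make the two factors
      commute, so the N-th power of their product splits.\<close>
    have "g (s / real N + t / real N) = g (t / real N + s / real N)" by (simp add: add.commute)
    then have comm: "g (s / real N) \<otimes> g (t / real N) = g (t / real N) \<otimes> g (s / real N)"
      using gadd lt by simp
    have "\<gamma> (s + t) = (g (s / real N) \<otimes> g (t / real N)) [^] N"
      using \<gamma>[OF N(3)] gadd[OF lt] by (simp add: add_divide_distrib)
    also have "\<dots> = \<gamma> s \<otimes> \<gamma> t"
      using pow_mult_distrib[OF comm] \<gamma>[OF N(1)] \<gamma>[OF N(2)] by simp
    finally show ?thesis .
  qed
  have tan: "tangent g X" using c(4) unfolding velocity_def g_def by (simp add: c(3))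
  \<comment> \<open>Near \<open>t0\<close> the extension is a left translate of the local solution;
    its continuity and smoothness are read off from this.\<close>
  have shift: "\<gamma> t = \<gamma> t0 \<otimes> g (t - t0)" if "\<bar>t - t0\<bar> < e" for t t0
    using add[of t0 "t - t0"] \<gamma>g[OF that] by simp
  have psic: "isCont psi (c t)" if "\<bar>t\<bar> < e" for t
    using continuous_on_chart_inv[OF is_chart1] c(2)[OF that]
      continuous_on_eq_continuous_at[OF is_chart_open(2)[OF is_chart1]] by blast
  have cont\<gamma>: "continuous_on UNIV \<gamma>"
  proof -
    have "isCont \<gamma> t0" for t0
    proof -
      have cl: "isCont (\<lambda>y. \<gamma> t0 \<otimes> y) z" for z using continuous_left by (simp add: continuous_on_eq_continuous_at)
      have "isCont (\<lambda>h. \<gamma> t0 \<otimes> g h) 0" by (rule isCont_o2[OF tangentD(2)[OF tan] cl])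
      then have "((\<lambda>h. \<gamma> t0 \<otimes> g h) \<longlongrightarrow> \<gamma> t0) (at 0)" using g0 by (simp add: isCont_def)
      moreover have "\<forall>\<^sub>F h in at 0. \<gamma> t0 \<otimes> g h = \<gamma> (t0 + h)"
        unfolding eventually_at using e shift[of "t0 + _" t0] by (intro exI[of _ e]) (auto simp: dist_real_def)
      ultimately have "((\<lambda>h. \<gamma> (t0 + h)) \<longlongrightarrow> \<gamma> t0) (at 0)" by (rule Lim_transform_eventually)
      then show ?thesis by (subst isCont_iff)
    qed
    then show ?thesis by (simp add: continuous_on_eq_continuous_at)
  qed
  have "smooth_map vector_atlas (atlas G) \<gamma>"
    unfolding smooth_map_def
  proof (intro conjI ballI cont\<gamma>)
    fix v :: "(real, real) chart" and d assume "v \<in> vector_atlas" and d: "d \<in> atlas G"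
    then have v: "v = (UNIV, \<lambda>x. x)" by (simp add: vector_atlas_def)
    have "smooth_on (\<gamma> -` fst d) (snd d \<circ> \<gamma>)"
    proof (rule smooth_on_local)
      fix t0 assume t0: "t0 \<in> \<gamma> -` fst d"
      define T where "T = ball t0 e \<inter> \<gamma> -` fst d"
      define w where "w = \<gamma> t0"
      have T: "open T" unfolding T_def
        using cont\<gamma> is_chart_open(1)[OF chartedD[OF ch d]] by (intro open_Int open_ball open_vimage)
      have inT: "\<bar>t - t0\<bar> < e" "\<gamma> t = w \<otimes> psi (c (t - t0))" "\<gamma> t \<in> fst d" if "t \<in> T" for t
        using that shift[of t t0] by (auto simp: T_def dist_real_def abs_minus_commute g_def w_def)
      have sm: "smooth_map (atlas G) (atlas G) (\<lambda>y. w \<otimes> y)" by (intro smooth_rules)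
      have "smooth_on T (c \<circ> (\<lambda>t. t - t0))"
      proof (rule smooth_on_compose[OF T _ c(1)])
        show "smooth_on T (\<lambda>t. t - t0)"
          using smooth_on_add[OF T smooth_on_ident smooth_on_const[of _ "- t0"]] by simp
        have "t - t0 \<in> {-e<..<e}" if "t \<in> T" for t using inT(1)[OF that] by auto
        then show "(\<lambda>t. t - t0) ` T \<subseteq> {-e<..<e}" by blast
      qed
      moreover have "smooth_on (phi ` (U1 \<inter> (\<lambda>y. w \<otimes> y) -` fst d)) (snd d \<circ> (\<lambda>y. w \<otimes> y) \<circ> psi)"
        using sm chart1 d unfolding smooth_map_def by blast
      ultimately have "smooth_on T ((snd d \<circ> (\<lambda>y. w \<otimes> y) \<circ> psi) \<circ> (c \<circ> (\<lambda>t. t - t0)))"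
      proof (rule smooth_on_compose[OF T])
        show "(c \<circ> (\<lambda>t. t - t0)) ` T \<subseteq> phi ` (U1 \<inter> (\<lambda>y. w \<otimes> y) -` fst d)"
          using inT c(2) by (auto simp: chart_image_iff[OF is_chart1])
      qed
      then have "smooth_on T (snd d \<circ> \<gamma>)"
        by (rule smooth_on_cong[OF T, rotated]) (simp add: inT(2))
      moreover have "t0 \<in> T" using t0 e by (simp add: T_def)
      ultimately show "\<exists>T. open T \<and> t0 \<in> T \<and> smooth_on T (snd d \<circ> \<gamma>)" using T by blast
    qed
    then show "smooth_on (snd v ` (fst v \<inter> \<gamma> -` fst d)) (snd d \<circ> \<gamma> \<circ> chart_inv v)"
      by (simp add: v o_def)
  qed
  moreover have "((phi \<circ> \<gamma>) has_vector_derivative X) (at 0)"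
    by (rule has_vector_derivative_transform_within_open[OF tangentD(3)[OF tan], of "{-e<..<e}"])
      (use e \<gamma>g in \<open>auto simp: abs_less_iff\<close>)
  ultimately show ?thesis using add unfolding one_parameter_subgroup_def by blast
qed

lemma one_parameter_subgroup_scale:
  assumes "one_parameter_subgroup G X \<gamma>"
  shows "one_parameter_subgroup G (c *\<^sub>R X) (\<lambda>t. \<gamma> (c * t))"
  unfolding one_parameter_subgroup_def
proof (intro conjI allI)
  have "smooth_map vector_atlas vector_atlas (\<lambda>t::real. c * t)"
    unfolding smooth_map_def vector_atlas_def
    by (auto simp: o_def intro!: smooth_on_bounded_linear bounded_linear_mult_right continuous_intros)
  from smooth_map_compose[OF charted_vector charted_vector ch this] assms
  show "smooth_map vector_atlas (atlas G) (\<lambda>t. \<gamma> (c * t))"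
    by (simp add: one_parameter_subgroup_def o_def)
  show "\<gamma> (c * (s + t)) = \<gamma> (c * s) \<otimes> \<gamma> (c * t)" for s t
    by (simp add: distrib_left one_parameter_subgroupD(1)[OF assms])
  show "((phi \<circ> (\<lambda>t. \<gamma> (c * t))) has_vector_derivative c *\<^sub>R X) (at 0)"
    using tangentD(3)[OF tangent_scale[OF one_parameter_subgroupD(3)[OF assms]]] by (simp add: o_def)
qed

lemma lie_exp_eq:
  assumes "one_parameter_subgroup G X \<gamma>"
  shows "lie_exp G (t *\<^sub>R X) = \<gamma> t"
proof -
  have "(THE \<gamma>. one_parameter_subgroup G (t *\<^sub>R X) \<gamma>) = (\<lambda>s. \<gamma> (t * s))"
    using one_parameter_subgroup_scale[OF assms, of t] one_parameter_subgroup_unique by (intro the_equality) auto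
  then show ?thesis by (simp add: lie_exp_def)
qed

lemma one_parameter_subgroup_exp: "one_parameter_subgroup G X (\<lambda>t. lie_exp G (t *\<^sub>R X))"
proof -
  obtain \<gamma> where "one_parameter_subgroup G X \<gamma>" using one_parameter_subgroup_exists by blast
  then show ?thesis by (simp add: lie_exp_eq)
qed

end

section \<open>Invariant derivatives and the adjoint representation\<close>

lemma trace_mult_commute:
  fixes S T :: "'e::euclidean_space \<Rightarrow> 'e"
  assumes "linear S" "linear T"
  shows "(\<Sum>b\<in>Basis. S (T b) \<bullet> b) = (\<Sum>b\<in>Basis. T (S b) \<bullet> b)"
proof -
  have "S w \<bullet> b = (\<Sum>c\<in>Basis. (w \<bullet> c) * (S c \<bullet> b))" if "linear S" for S :: "'e \<Rightarrow> 'e" and w b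
  proof -
    have "S w \<bullet> b = (\<Sum>c\<in>Basis. (w \<bullet> c) *\<^sub>R S c) \<bullet> b"
      by (rule arg_cong[OF linear_euclidean_expand[OF that]])
    also have "\<dots> = (\<Sum>c\<in>Basis. (w \<bullet> c) * (S c \<bullet> b))" unfolding inner_sum_left inner_scaleR_left ..
    finally show ?thesis .
  qed
  then have *: "(\<Sum>b\<in>Basis. S (T b) \<bullet> b) = (\<Sum>b\<in>Basis. \<Sum>c\<in>Basis. (T b \<bullet> c) * (S c \<bullet> b))"
    if "linear S" for S T :: "'e \<Rightarrow> 'e"
    by (intro sum.cong refl) (use that in blast)
  show ?thesis unfolding *[OF assms(1)] *[OF assms(2)]
    by (subst sum.swap) (simp only: mult.commute)
qed

context lie_grp
begin

lemma smooth_fun_diff1: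
  assumes C: "charted C" and H: "smooth_map (prod_atlas (atlas G) (atlas G)) C H"
    and d: "d \<in> C" "\<And>x. H (x, \<one>) \<in> fst d"
  shows "smooth_fun G (\<lambda>x. diff1 G (\<lambda>y. snd d (H (x, y))) X)"
  unfolding smooth_fun_def
proof (rule smooth_fun_of_charts[OF ch])
  fix c assume c: "c \<in> atlas G"
  show "smooth_on (snd c ` fst c) ((\<lambda>x. diff1 G (\<lambda>y. snd d (H (x, y))) X) \<circ> chart_inv c)"
    using smooth_map_partial[OF ch ch C H c chart1 one_chart1 d(1), of X] d(2) unfolding diff1_def by simp
qed

lemma smooth_fun_comp:
  assumes "smooth_fun G f" "smooth_map (atlas G) (atlas G) h"
  shows "smooth_fun G (\<lambda>x. f (h x))"
  using smooth_map_compose[OF ch ch charted_vector assms(2) assms(1)[unfolded smooth_fun_def]]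
  by (simp add: smooth_fun_def o_def)

lemma smooth_fun_continuous: "smooth_fun G f \<Longrightarrow> continuous_on UNIV f"
  unfolding smooth_fun_def by (rule smooth_map_continuous)

section \<open>Derivatives along left-invariant vector fields\<close>

text \<open>The derivative along the left-invariant field with value \<open>X\<close> at the
  identity. Unlike the curve formula of \<open>canonical_connection\<close>, this form displays
  linearity in the direction and smoothness in the point.\<close>

definition lder :: "('g \<Rightarrow> 'b::real_normed_vector) \<Rightarrow> 'g \<Rightarrow> 'e \<Rightarrow> 'b" where
  "lder f x X = diff1 G (\<lambda>y. f (x \<otimes> y)) X"

lemma lder_diffable:
  assumes "smooth_fun G f"
  shows "(\<lambda>y. f (x \<otimes> y)) \<circ> psi differentiable at (phi \<one>)"
proof (rule diffable_vector)
  have "smooth_map (atlas G) (atlas G) (\<lambda>y. x \<otimes> y)" by (intro smooth_rules)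
  then show "smooth_fun G (\<lambda>y. f (x \<otimes> y))" by (rule smooth_fun_comp[OF assms])
qed

lemma lder_smooth:
  assumes "smooth_fun G f"
  shows "smooth_fun G (\<lambda>x. lder f x X)"
proof -
  have "smooth_map (prod_atlas (atlas G) (atlas G)) (atlas G) (\<lambda>p. fst p \<otimes> snd p)" by (intro smooth_prod_rules)
  from smooth_map_compose[OF charted_prod[OF ch ch] ch charted_vector this assms[unfolded smooth_fun_def]]
  have "smooth_map (prod_atlas (atlas G) (atlas G)) vector_atlas (\<lambda>p. f (fst p \<otimes> snd p))" by (simp add: o_def)
  from smooth_fun_diff1[OF charted_vector this, of "(UNIV, \<lambda>x. x)" X]
  show ?thesis by (simp add: lder_def vector_atlas_def)
qed

lemma linear_lder: "smooth_fun G f \<Longrightarrow> linear (lder f x)"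
  unfolding lder_def[abs_def] by (intro linear_diff1 lder_diffable)

lemma lder_curve: "smooth_fun G f \<Longrightarrow> tangent \<delta> X \<Longrightarrow> ((\<lambda>t. f (x \<otimes> \<delta> t)) has_vector_derivative lder f x X) (at 0)"
  unfolding lder_def by (rule tangent_curve[OF _ lder_diffable])

lemma canonical_connection_eq: "smooth_fun G f \<Longrightarrow> canonical_connection G V f x = lder f x (V x)"
  unfolding canonical_connection_def
  by (rule vector_derivative_at[OF lder_curve[OF _ one_parameter_subgroupD(3)[OF one_parameter_subgroup_exp]]])

section \<open>The adjoint representation and the Killing form\<close>

lemma conj_smooth: "smooth_map (atlas G) (atlas G) (\<lambda>y. x \<otimes> y \<otimes> inv x)"
  by (intro smooth_rules)

lemma tangent_Ad: "tangent \<delta> X \<Longrightarrow> tangent (\<lambda>t. x \<otimes> \<delta> t \<otimes> inv x) (Ad G x X)"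
  unfolding Ad_def by (rule tangent_map[OF _ conj_smooth]) simp_all

lemma linear_Ad: "linear (Ad G x)"
  unfolding Ad_def by (intro linear_diff1 diffable_self conj_smooth) (simp add: one_chart1)

lemma Ad_mult: "Ad G (x \<otimes> y) X = Ad G x (Ad G y X)"
proof -
  obtain \<delta> where \<delta>: "tangent \<delta> X" using tangent_exists by blast
  have "tangent (\<lambda>t. x \<otimes> (y \<otimes> \<delta> t \<otimes> inv y) \<otimes> inv x) (Ad G x (Ad G y X))"
    by (intro tangent_Ad \<delta>)
  moreover have "tangent (\<lambda>t. x \<otimes> (y \<otimes> \<delta> t \<otimes> inv y) \<otimes> inv x) (Ad G (x \<otimes> y) X)"
    using tangent_Ad[OF \<delta>, of "x \<otimes> y"] by (simp add: inv_mult_group m_assoc)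
  ultimately show ?thesis using tangent_unique by blast
qed

lemma Ad_one: "Ad G \<one> X = X"
proof -
  obtain \<delta> where \<delta>: "tangent \<delta> X" using tangent_exists by blast
  have "tangent \<delta> (Ad G \<one> X)" using tangent_Ad[OF \<delta>, of \<one>] by simp
  then show ?thesis using tangent_unique \<delta> by blast
qed

lemma Ad_inv [simp]: "Ad G (inv x) (Ad G x X) = X" "Ad G x (Ad G (inv x) X) = X"
  by (simp_all add: Ad_mult[symmetric] Ad_one)

lemma smooth_Ad: "smooth_fun G (\<lambda>x. Ad G x X)"
proof -
  have "smooth_map (prod_atlas (atlas G) (atlas G)) (atlas G) (\<lambda>p. fst p \<otimes> snd p \<otimes> inv (fst p))"
    by (intro smooth_prod_rules)
  from smooth_fun_diff1[OF ch this chart1, of X] one_chart1 show ?thesis by (simp add: Ad_def)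
qed

lemma smooth_Ad_inv: "smooth_fun G (\<lambda>x. Ad G (inv x) X)"
  using smooth_fun_comp[OF smooth_Ad, of "\<lambda>x. inv x" X] smooth_inv[OF ch smooth_map_ident[OF atl]] by simp

text \<open>A one-parameter subgroup is commutative, hence fixed by its own conjugations. This is
  what makes \<open>pull X\<close> constant along the left flow of \<open>X\<close>.\<close>

lemma Ad_one_parameter_subgroup:
  assumes "one_parameter_subgroup G X \<gamma>"
  shows "Ad G (\<gamma> t) X = X"
proof -
  note \<gamma> = one_parameter_subgroupD[OF assms]
  have "\<gamma> t \<otimes> \<gamma> s \<otimes> inv (\<gamma> t) = \<gamma> s" for s
  proof -
    have "\<gamma> t \<otimes> \<gamma> s = \<gamma> s \<otimes> \<gamma> t" using \<gamma>(1)[of t s] \<gamma>(1)[of s t] by (simp add: add.commute)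
    then show ?thesis by (simp add: m_assoc)
  qed
  then have "tangent \<gamma> (Ad G (\<gamma> t) X)" using tangent_Ad[OF \<gamma>(3), of "\<gamma> t"] by simp
  then show ?thesis using tangent_unique \<gamma>(3) by blast
qed

text \<open>The left translate \<gamma>(h) y equals y (y^-1 \<gamma>(h) y), a right translate by a
  curve tangent to Ad(y^-1) X; so a left flow is differentiated with \<open>lder\<close>.\<close>

lemma left_flow_derivative:
  assumes f: "smooth_fun G f" and \<gamma>: "one_parameter_subgroup G X \<gamma>"
  shows "((\<lambda>t. f (\<gamma> t \<otimes> x)) has_vector_derivative lder f (\<gamma> t \<otimes> x) (Ad G (inv (\<gamma> t \<otimes> x)) X)) (at t)"
proof (rule has_vector_derivative_at_shift)
  define x' where "x' = \<gamma> t \<otimes> x"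
  have "tangent (\<lambda>h. inv x' \<otimes> \<gamma> h \<otimes> inv (inv x')) (Ad G (inv x') X)"
    by (rule tangent_Ad[OF one_parameter_subgroupD(3)[OF \<gamma>]])
  from lder_curve[OF f this, of x']
  have "((\<lambda>h. f (\<gamma> h \<otimes> x')) has_vector_derivative lder f x' (Ad G (inv x') X)) (at 0)"
    by (simp add: m_assoc)
  moreover have "\<gamma> h \<otimes> x' = \<gamma> (t + h) \<otimes> x" for h
    using one_parameter_subgroupD(1)[OF \<gamma>, of h t] by (simp add: x'_def m_assoc add.commute)
  ultimately show "((\<lambda>h. f (\<gamma> (t + h) \<otimes> x)) has_vector_derivative lder f (\<gamma> t \<otimes> x) (Ad G (inv (\<gamma> t \<otimes> x)) X)) (at 0)"
    by (simp add: x'_def)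
qed

lemma ad_curve: "tangent \<delta> X \<Longrightarrow> ((\<lambda>t. Ad G (\<delta> t) Y) has_vector_derivative ad G X Y) (at 0)"
  unfolding ad_def by (rule tangent_curve[OF _ diffable_vector[OF smooth_Ad]])

lemma linear_ad_left: "linear (\<lambda>X. ad G X Y)"
  unfolding ad_def by (rule linear_diff1[OF diffable_vector[OF smooth_Ad]])

lemma linear_ad: "linear (ad G X)"
proof -
  obtain \<delta> where \<delta>: "tangent \<delta> X" using tangent_exists by blast
  show ?thesis
  proof (rule linearI)
    fix Y Z :: 'e and r :: real
    have "((\<lambda>t. Ad G (\<delta> t) (Y + Z)) has_vector_derivative ad G X Y + ad G X Z) (at 0)"
      unfolding linear_add[OF linear_Ad] by (intro has_vector_derivative_add ad_curve \<delta>)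
    then show "ad G X (Y + Z) = ad G X Y + ad G X Z"
      using ad_curve[OF \<delta>] vector_derivative_unique_at by blast
    have "((\<lambda>t. Ad G (\<delta> t) (r *\<^sub>R Y)) has_vector_derivative r *\<^sub>R ad G X Y) (at 0)"
      unfolding linear_cmul[OF linear_Ad]
      by (intro bounded_linear.has_vector_derivative[OF bounded_linear_scaleR_right] ad_curve \<delta>)
    then show "ad G X (r *\<^sub>R Y) = r *\<^sub>R ad G X Y"
      using ad_curve[OF \<delta>] vector_derivative_unique_at by blast
  qed
qed

lemma ad_Ad: "ad G (Ad G s X) (Ad G s Y) = Ad G s (ad G X Y)"
proof -
  obtain \<delta> where \<delta>: "tangent \<delta> X" using tangent_exists by blast
  have "((\<lambda>t. Ad G (s \<otimes> \<delta> t \<otimes> inv s) (Ad G s Y)) has_vector_derivative ad G (Ad G s X) (Ad G s Y)) (at 0)"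
    by (rule ad_curve[OF tangent_Ad[OF \<delta>]])
  moreover have "((\<lambda>t. Ad G (s \<otimes> \<delta> t \<otimes> inv s) (Ad G s Y)) has_vector_derivative Ad G s (ad G X Y)) (at 0)"
    using bounded_linear.has_vector_derivative[OF linear_conv_bounded_linear[THEN iffD1, OF linear_Ad] ad_curve[OF \<delta>]]
    by (simp add: Ad_mult)
  ultimately show ?thesis using vector_derivative_unique_at by blast
qed

text \<open>\<open>Ad\<close> respects the bracket, so the two operators whose traces are compared
  are conjugate.\<close>

lemma Kil_Ad: "Kil G (Ad G s X) (Ad G s Y) = Kil G X Y"
proof -
  have "ad G (Ad G s X) (ad G (Ad G s Y) b) = Ad G s (ad G X (ad G Y (Ad G (inv s) b)))" for b
    using ad_Ad[of s Y "Ad G (inv s) b"] ad_Ad[of s X "ad G Y (Ad G (inv s) b)"] by simp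
  then have "Kil G (Ad G s X) (Ad G s Y) = - (\<Sum>b\<in>Basis. Ad G s (ad G X (ad G Y (Ad G (inv s) b))) \<bullet> b)"
    by (simp add: Kil_def)
  also have "\<dots> = - (\<Sum>b\<in>Basis. ad G X (ad G Y (Ad G (inv s) (Ad G s b))) \<bullet> b)"
  proof -
    have "linear (\<lambda>b. ad G X (ad G Y (Ad G (inv s) b)))"
      using linear_compose[OF linear_compose[OF linear_Ad linear_ad] linear_ad] by (simp add: o_def)
    from trace_mult_commute[OF linear_Ad this, of s] show ?thesis by simp
  qed
  finally show ?thesis by (simp add: Kil_def)
qed

lemma linear_Kil_left: "linear (\<lambda>X. Kil G X Y)"
  unfolding Kil_def
  by (intro linearI)
    (simp_all add: linear_add[OF linear_ad_left] linear_cmul[OF linear_ad_left] inner_add_left sum.distrib sum_distrib_left)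

lemma subspace_m_space: "subspace (m_space G K)"
  unfolding subspace_def m_space_def
  by (simp add: linear_0[OF linear_Kil_left] linear_add[OF linear_Kil_left] linear_cmul[OF linear_Kil_left])

lemma one_parameter_subgroup_Ad:
  assumes "one_parameter_subgroup G X \<gamma>"
  shows "one_parameter_subgroup G (Ad G s X) (\<lambda>t. s \<otimes> \<gamma> t \<otimes> inv s)"
  unfolding one_parameter_subgroup_def
proof (intro conjI allI)
  note \<gamma> = one_parameter_subgroupD[OF assms]
  have "smooth_map vector_atlas (atlas G) \<gamma>" using assms by (simp add: one_parameter_subgroup_def)
  from smooth_map_compose[OF charted_vector ch ch this conj_smooth]
  show "smooth_map vector_atlas (atlas G) (\<lambda>t. s \<otimes> \<gamma> t \<otimes> inv s)" by (simp add: o_def)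
  show "s \<otimes> \<gamma> (a + b) \<otimes> inv s = s \<otimes> \<gamma> a \<otimes> inv s \<otimes> (s \<otimes> \<gamma> b \<otimes> inv s)" for a b
    by (simp add: \<gamma>(1) m_assoc)
  show "(phi \<circ> (\<lambda>t. s \<otimes> \<gamma> t \<otimes> inv s) has_vector_derivative Ad G s X) (at 0)"
    using tangentD(3)[OF tangent_Ad[OF \<gamma>(3)]] by (simp add: o_def)
qed

lemma lie_subalg_Ad:
  assumes K: "subgroup K G" and s: "s \<in> K" and X: "X \<in> lie_subalg G K"
  shows "Ad G s X \<in> lie_subalg G K"
proof -
  have "lie_exp G (t *\<^sub>R Ad G s X) = s \<otimes> lie_exp G (t *\<^sub>R X) \<otimes> inv s" for t
    by (rule lie_exp_eq[OF one_parameter_subgroup_Ad[OF one_parameter_subgroup_exp]])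
  then show ?thesis using X s subgroup.m_closed[OF K] subgroup.m_inv_closed[OF K]
    by (simp add: lie_subalg_def)
qed

lemma m_space_Ad:
  assumes K: "subgroup K G" and s: "s \<in> K"
  shows "Ad G s ` m_space G K = m_space G K"
proof -
  have *: "Ad G r X \<in> m_space G K" if X: "X \<in> m_space G K" and r: "r \<in> K" for r X
    unfolding m_space_def
  proof (intro CollectI ballI)
    fix Y assume "Y \<in> lie_subalg G K"
    then have "Ad G (inv r) Y \<in> lie_subalg G K"
      using lie_subalg_Ad[OF K] subgroup.m_inv_closed[OF K r] by blast
    then have "Kil G (Ad G r X) (Ad G r (Ad G (inv r) Y)) = 0"
      unfolding Kil_Ad using X by (simp add: m_space_def)
    then show "Kil G (Ad G r X) Y = 0" by simp
  qed
  have "X \<in> Ad G s ` m_space G K" if X: "X \<in> m_space G K" for X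
    using *[OF X subgroup.m_inv_closed[OF K s]] by (intro image_eqI[of _ _ "Ad G (inv s) X"]) simp_all
  then show ?thesis using *[OF _ s] by blast
qed

section \<open>An Ad-invariant inner product from compactness\<close>

lemma Ad_bounded:
  assumes "compact (UNIV :: 'g set)"
  obtains M where "\<And>x Z. norm (Ad G x Z) \<le> M * norm Z"
proof -
  have "\<exists>B. \<forall>x. norm (Ad G x b) \<le> B" for b
    using compact_imp_bounded[OF compact_continuous_image[OF smooth_fun_continuous[OF smooth_Ad] assms]]
    by (auto simp: bounded_iff)
  then obtain B where B: "\<And>b x. norm (Ad G x b) \<le> B b" by metis
  show thesis
  proof
    fix x Z
    have "norm (Ad G x Z) = norm (\<Sum>b\<in>Basis. (Z \<bullet> b) *\<^sub>R Ad G x b)"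
      by (rule arg_cong[OF linear_euclidean_expand[OF linear_Ad]])
    also have "\<dots> \<le> (\<Sum>b\<in>Basis. norm Z * B b)"
      using B by (intro sum_norm_le) (auto intro!: mult_mono Basis_le_norm)
    finally show "norm (Ad G x Z) \<le> (\<Sum>b\<in>Basis. B b) * norm Z"
      by (simp add: sum_distrib_left mult.commute)
  qed
qed

lemma Ad_invariant_inner_product:
  assumes "compact (UNIV :: 'g set)"
  obtains B where "inner_product_on UNIV B" "bilinear B" "\<And>x X Y. B (Ad G x X) (Ad G x Y) = B X Y"
proof -
  obtain M where M: "\<And>x Z. norm (Ad G x Z) \<le> M * norm Z" using Ad_bounded[OF assms] by blast
  show thesis
  proof (rule invariant_inner_product_exists[of "range (Ad G)" M])
    show "id \<in> range (Ad G)" using Ad_one by (intro image_eqI[of _ _ \<one>]) auto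
    show "S \<circ> T \<in> range (Ad G)" if S: "S \<in> range (Ad G)" and T: "T \<in> range (Ad G)" for S T
    proof -
      obtain x y where "S = Ad G x" "T = Ad G y" using S T by blast
      then have "S \<circ> T = Ad G (x \<otimes> y)" using Ad_mult[of x y] by auto
      then show ?thesis by blast
    qed
    show "\<exists>T'\<in>range (Ad G). T \<circ> T' = id" if T: "T \<in> range (Ad G)" for T
    proof -
      obtain x where "T = Ad G x" using T by blast
      then have "T \<circ> Ad G (inv x) = id" by auto
      then show ?thesis by blast
    qed
    show "linear T" if T: "T \<in> range (Ad G)" for T using T linear_Ad by blast
    show "norm (T Z) \<le> M * norm Z" if T: "T \<in> range (Ad G)" for T Z using T M by blast
    fix B assume B: "inner_product_on UNIV B" "bilinear B"
      "\<And>T X Y. T \<in> range (Ad G) \<Longrightarrow> B (T X) (T Y) = B X Y"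
    have "B (Ad G x X) (Ad G x Y) = B X Y" for x X Y using B(3) by blast
    then show thesis by (rule that[OF B(1,2)])
  qed
qed

end

section \<open>Integration over the coset space\<close>

text \<open>Dominated convergence is applied to a sequence, so the difference quotients are taken at
  the steps 1/(n+1).\<close>

lemma has_vector_derivative_LIMSEQ:
  assumes "(g has_vector_derivative D) (at 0)"
  shows "(\<lambda>n. real (Suc n) *\<^sub>R (g (1 / real (Suc n)) - g 0)) \<longlonglongrightarrow> D"
proof -
  have "((\<lambda>y. norm ((g y - g 0) - y *\<^sub>R D) / norm y) \<longlongrightarrow> 0) (at 0)"
    using assms unfolding has_vector_derivative_def has_derivative_iff_norm by simp
  moreover have "filterlim (\<lambda>n. 1 / real (Suc n)) (at 0) sequentially"
    unfolding filterlim_at using LIMSEQ_Suc[OF lim_1_over_n] by (auto intro!: always_eventually)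
  ultimately have "(\<lambda>n. norm ((g (1 / real (Suc n)) - g 0) - (1 / real (Suc n)) *\<^sub>R D) / norm (1 / real (Suc n))) \<longlonglongrightarrow> 0"
    by (rule filterlim_compose)
  moreover have "norm ((g (1 / real (Suc n)) - g 0) - (1 / real (Suc n)) *\<^sub>R D) / norm (1 / real (Suc n)) =
      norm (real (Suc n) *\<^sub>R (g (1 / real (Suc n)) - g 0) - D)" for n
  proof -
    have "real (Suc n) *\<^sub>R (g (1 / real (Suc n)) - g 0) - D =
        real (Suc n) *\<^sub>R ((g (1 / real (Suc n)) - g 0) - (1 / real (Suc n)) *\<^sub>R D)"
      by (simp add: scaleR_diff_right del: of_nat_Suc)
    then show ?thesis by (simp add: mult.commute del: of_nat_Suc)
  qed
  ultimately have "(\<lambda>n. norm (real (Suc n) *\<^sub>R (g (1 / real (Suc n)) - g 0) - D)) \<longlonglongrightarrow> 0" by simp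
  then show ?thesis by (simp add: tendsto_norm_zero_iff LIM_zero_cancel)
qed

text \<open>Supplies the constant that dominates the difference quotients.\<close>

lemma vector_derivative_bound:
  assumes "\<And>t. (g has_vector_derivative h t) (at t)" "\<And>t. norm (h t) \<le> M"
  shows "norm (g t - g 0) \<le> M * \<bar>t\<bar>"
proof -
  have "norm (g t - g 0) \<le> M * norm (t - 0)"
  proof (rule differentiable_bound[OF convex_UNIV])
    show "(g has_derivative (\<lambda>s. s *\<^sub>R h x)) (at x within UNIV)" for x
      using assms(1)[of x] by (simp add: has_vector_derivative_def)
    show "onorm (\<lambda>s. s *\<^sub>R h x) \<le> M" for x
    proof (rule onorm_bound)
      show "0 \<le> M" using order_trans[OF norm_ge_zero assms(2)[of x]] .
      show "norm (s *\<^sub>R h x) \<le> M * norm s" for s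
        using mult_left_mono[OF assms(2)[of x] abs_ge_zero[of s]] by (simp add: mult.commute)
    qed
  qed auto
  then show ?thesis by simp
qed

locale coset_measure = lie_grp G for G :: "('g::{t2_space, second_countable_topology}, 'e::euclidean_space) lie_struct" (structure) +
  fixes K :: "'g set" and \<mu> :: "'g set measure"
  assumes K: "subgroup K G" and \<mu>: "invariant_measure G K \<mu>" and compact: "compact (UNIV :: 'g set)"
begin

lemma sets_\<mu>: "sets \<mu> = sets (coset_borel G K)"
  using \<mu> by (simp add: invariant_measure_def)

lemma space_\<mu>: "space \<mu> = left_cosets G K"
  using sets_eq_imp_space_eq[OF sets_\<mu>] by (simp add: coset_borel_def space_measure_of_conv)

sublocale finite_measure \<mu>
  using \<mu> by (simp add: invariant_measure_def)

lemma sets_\<mu>_sigma: "sets \<mu> = sigma_sets (left_cosets G K) {U. U \<subseteq> left_cosets G K \<and> open (\<Union>U)}"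
  unfolding sets_\<mu> coset_borel_def by (rule sets_measure_of) blast

lemma open_in_sets: "U \<subseteq> left_cosets G K \<Longrightarrow> open (\<Union>U) \<Longrightarrow> U \<in> sets \<mu>"
  unfolding sets_\<mu>_sigma by (auto intro: sigma_sets.Basic)

lemma mem_coset: "x \<in> x <# K"
  using subgroup.one_closed[OF K] unfolding l_coset_def by force

lemma coset_in: "x <# K \<in> left_cosets G K"
  by (simp add: left_cosets_def)

lemma coset_eqI: "C \<in> left_cosets G K \<Longrightarrow> x \<in> C \<Longrightarrow> C = x <# K"
  using l_repr_independence[OF _ _ K] by (auto simp: left_cosets_def)

lemma translate_coset: "x <# (y <# K) = (x \<otimes> y) <# K"
  by (rule lcos_m_assoc) simp_all

text \<open>The same choice as in \<open>coset_integral\<close>, so that coset integrals become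
  integrals of \<open>f (rep C)\<close>.\<close>

definition rep :: "'g set \<Rightarrow> 'g" where "rep C = (SOME x. x \<in> C)"

lemma rep_mem:
  assumes "C \<in> left_cosets G K"
  shows "rep C \<in> C"
proof -
  obtain x where "C = x <# K" using assms by (auto simp: left_cosets_def)
  then have "x \<in> C" using mem_coset by simp
  then show ?thesis unfolding rep_def by (rule someI)
qed

lemma rep_coset: "C \<in> left_cosets G K \<Longrightarrow> rep C <# K = C"
  using coset_eqI rep_mem by metis

definition right_invariant :: "('g \<Rightarrow> complex) \<Rightarrow> bool" where
  "right_invariant f \<longleftrightarrow> (\<forall>x. \<forall>s\<in>K. f (x \<otimes> s) = f x)"

lemma right_invariant_rep:
  assumes "right_invariant f"
  shows "f (rep (x <# K)) = f x"
proof -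
  have "rep (x <# K) \<in> x <# K" by (rule rep_mem[OF coset_in])
  then obtain s where "s \<in> K" "rep (x <# K) = x \<otimes> s" by (auto simp: l_coset_def)
  then show ?thesis using assms by (simp add: right_invariant_def)
qed

text \<open>A set of cosets counts as open when its union is open; by right invariance the union of
  the preimage of \<open>S\<close> on cosets is the preimage of \<open>S\<close> in the
  group.\<close>

lemma continuous_measurable:
  assumes f: "right_invariant f" "continuous_on UNIV f"
  shows "(\<lambda>C. f (rep C)) \<in> borel_measurable \<mu>"
proof (rule borel_measurableI)
  fix S :: "complex set" assume S: "open S"
  let ?U = "(\<lambda>C. f (rep C)) -` S \<inter> space \<mu>"
  have "\<Union>?U = f -` S"
  proof
    show "\<Union>?U \<subseteq> f -` S"
      using coset_eqI right_invariant_rep[OF f(1)] by (auto simp: space_\<mu>) metis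
    show "f -` S \<subseteq> \<Union>?U"
    proof
      fix x assume "x \<in> f -` S"
      then have "x <# K \<in> ?U" using right_invariant_rep[OF f(1)] coset_in by (simp add: space_\<mu>)
      then show "x \<in> \<Union>?U" using mem_coset by blast
    qed
  qed
  then show "?U \<in> sets \<mu>"
    using open_vimage[OF S f(2)] by (intro open_in_sets) (auto simp: space_\<mu>)
qed

lemma continuous_integrable:
  assumes f: "right_invariant f" "continuous_on UNIV f"
  shows "integrable \<mu> (\<lambda>C. f (rep C))"
proof -
  obtain M where "\<And>x. norm (f x) \<le> M"
    using compact_imp_bounded[OF compact_continuous_image[OF f(2) compact]] by (auto simp: bounded_iff)
  then show ?thesis using continuous_measurable[OF f] by (intro integrable_const_bound[of _ M]) auto
qed

lemma translate_measurable: "(\<lambda>C. x <# C) \<in> measurable \<mu> \<mu>"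
proof (rule measurable_sigma_sets[OF sets_\<mu>_sigma])
  have im: "x <# C \<in> left_cosets G K" if "C \<in> left_cosets G K" for C
    using that translate_coset by (auto simp: left_cosets_def)
  then show "(\<lambda>C. x <# C) \<in> space \<mu> \<rightarrow> left_cosets G K" by (simp add: space_\<mu>)
  fix U assume "U \<in> {U. U \<subseteq> left_cosets G K \<and> open (\<Union>U)}"
  then have U: "U \<subseteq> left_cosets G K" "open (\<Union>U)" by auto
  let ?V = "(\<lambda>C. x <# C) -` U \<inter> space \<mu>"
  have "\<Union>?V = (\<lambda>y. x \<otimes> y) -` \<Union>U"
  proof
    show "\<Union>?V \<subseteq> (\<lambda>y. x \<otimes> y) -` \<Union>U" by (auto simp: l_coset_def)
    show "(\<lambda>y. x \<otimes> y) -` \<Union>U \<subseteq> \<Union>?V"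
    proof
      fix y assume "y \<in> (\<lambda>y. x \<otimes> y) -` \<Union>U"
      then obtain D where D: "D \<in> U" "x \<otimes> y \<in> D" by auto
      then have "D = x <# (y <# K)" using coset_eqI U translate_coset by auto
      then have "y <# K \<in> ?V" using D coset_in by (simp add: space_\<mu>)
      then show "y \<in> \<Union>?V" using mem_coset by blast
    qed
  qed
  then show "?V \<in> sets \<mu>"
    using open_vimage[OF U(2) continuous_left[of x]] by (intro open_in_sets) (auto simp: space_\<mu>)
qed (auto)

text \<open>\<open>invariant_measure\<close> speaks of images of measurable sets; the preimage under
  translation by \<open>x\<close> is the image under translation by its inverse.\<close>

lemma distr_translate: "distr \<mu> \<mu> (\<lambda>C. x <# C) = \<mu>"
proof (rule measure_eqI)
  fix A assume "A \<in> sets (distr \<mu> \<mu> (\<lambda>C. x <# C))"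
  then have A: "A \<in> sets \<mu>" by simp
  have inv: "inv x <# (x <# C) = C" "x <# (inv x <# C) = C" for C
    by (auto simp: l_coset_def)
  have sub: "A \<subseteq> left_cosets G K" using sets.sets_into_space[OF A] by (simp add: space_\<mu>)
  have "(\<lambda>C. x <# C) -` A \<inter> space \<mu> = (\<lambda>C. inv x <# C) ` A"
  proof
    show "(\<lambda>C. x <# C) -` A \<inter> space \<mu> \<subseteq> (\<lambda>C. inv x <# C) ` A"
    proof
      fix C assume "C \<in> (\<lambda>C. x <# C) -` A \<inter> space \<mu>"
      then have "x <# C \<in> A" by simp
      from imageI[OF this, of "\<lambda>C. inv x <# C"] show "C \<in> (\<lambda>C. inv x <# C) ` A" by (simp only: inv(1))
    qed
    show "(\<lambda>C. inv x <# C) ` A \<subseteq> (\<lambda>C. x <# C) -` A \<inter> space \<mu>"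
    proof
      fix D assume "D \<in> (\<lambda>C. inv x <# C) ` A"
      then obtain C where C: "C \<in> A" "D = inv x <# C" by auto
      then obtain y where "C = y <# K" using sub by (auto simp: left_cosets_def)
      then have "D \<in> left_cosets G K" using C(2) translate_coset coset_in by simp
      moreover have "x <# D = C" using C(2) inv(2) by simp
      ultimately show "D \<in> (\<lambda>C. x <# C) -` A \<inter> space \<mu>" using C(1) by (simp add: space_\<mu>)
    qed
  qed
  then show "emeasure (distr \<mu> \<mu> (\<lambda>C. x <# C)) A = emeasure \<mu> A"
    using \<mu> A by (simp add: emeasure_distr[OF translate_measurable A] invariant_measure_def)
qed simp

lemma integral_translate:
  assumes f: "right_invariant f" "continuous_on UNIV f"
  shows "(\<integral>C. f (x \<otimes> rep C) \<partial>\<mu>) = (\<integral>C. f (rep C) \<partial>\<mu>)"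
proof -
  have "(\<integral>C. f (rep C) \<partial>\<mu>) = (\<integral>C. f (rep C) \<partial>distr \<mu> \<mu> (\<lambda>C. x <# C))" by (simp add: distr_translate)
  also have "\<dots> = (\<integral>C. f (rep (x <# C)) \<partial>\<mu>)"
    by (rule integral_distr[OF translate_measurable continuous_measurable[OF f]])
  also have "\<dots> = (\<integral>C. f (x \<otimes> rep C) \<partial>\<mu>)"
  proof (rule Bochner_Integration.integral_cong)
    fix C assume "C \<in> space \<mu>"
    then have "x <# C = (x \<otimes> rep C) <# K"
      using translate_coset[of x "rep C"] rep_coset by (simp add: space_\<mu>)
    then show "f (rep (x <# C)) = f (x \<otimes> rep C)" using right_invariant_rep[OF f(1)] by simp
  qed simp
  finally show ?thesis by simp
qed

text \<open>The difference quotients of \<open>f\<close> along the flow integrate to zero by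
  invariance of \<mu>, are bounded by \<open>M\<close> through the mean value inequality, and
  converge to \<open>h\<close>. As \<mu> is finite, the constant \<open>M\<close> is an integrable
  majorant.\<close>

lemma integral_left_flow_derivative:
  assumes f: "right_invariant f" "continuous_on UNIV f"
    and \<gamma>: "one_parameter_subgroup G X \<gamma>"
    and D: "\<And>t x. ((\<lambda>t. f (\<gamma> t \<otimes> x)) has_vector_derivative h (\<gamma> t \<otimes> x)) (at t)"
    and bound: "\<And>x. norm (h x) \<le> M"
  shows "integrable \<mu> (\<lambda>C. h (rep C))" "(\<integral>C. h (rep C) \<partial>\<mu>) = 0"
proof -
  have \<gamma>0: "\<gamma> 0 = \<one>" by (rule one_parameter_subgroupD(2)[OF \<gamma>])
  define q where "q n x = real (Suc n) *\<^sub>R (f (\<gamma> (1 / real (Suc n)) \<otimes> x) - f x)" for n x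
  have lim: "(\<lambda>n. q n x) \<longlonglongrightarrow> h x" for x
    using has_vector_derivative_LIMSEQ[OF D[of x 0]] by (simp add: q_def \<gamma>0)
  have fc: "right_invariant (\<lambda>x. f (z \<otimes> x))" "continuous_on UNIV (\<lambda>x. f (z \<otimes> x))" for z
    using f(1) continuous_on_compose2[OF f(2) continuous_left[of z]]
    by (auto simp: right_invariant_def m_assoc[symmetric])
  have iq: "integrable \<mu> (\<lambda>C. q n (rep C))" for n
    unfolding q_def
    by (intro Bochner_Integration.integrable_scaleR_right Bochner_Integration.integrable_diff continuous_integrable[OF f] continuous_integrable[OF fc])
  have "(\<integral>C. q n (rep C) \<partial>\<mu>) = real (Suc n) *\<^sub>R
     ((\<integral>C. f (\<gamma> (1 / real (Suc n)) \<otimes> rep C) \<partial>\<mu>) - (\<integral>C. f (rep C) \<partial>\<mu>))" for n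
    unfolding q_def
    by (simp add: Bochner_Integration.integral_diff[OF continuous_integrable[OF fc] continuous_integrable[OF f]] del: of_nat_Suc)
  then have zero: "(\<integral>C. q n (rep C) \<partial>\<mu>) = 0" for n by (simp add: integral_translate[OF f])
  have qb: "norm (q n x) \<le> M" for n x
  proof -
    have "norm (f (\<gamma> (1 / real (Suc n)) \<otimes> x) - f (\<gamma> 0 \<otimes> x)) \<le> M * \<bar>1 / real (Suc n)\<bar>"
      by (rule vector_derivative_bound[OF D bound])
    then have "real (Suc n) * norm (f (\<gamma> (1 / real (Suc n)) \<otimes> x) - f x) \<le> real (Suc n) * (M * \<bar>1 / real (Suc n)\<bar>)"
      by (intro mult_left_mono) (simp_all add: \<gamma>0)
    then show ?thesis by (simp add: q_def del: of_nat_Suc)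
  qed
  \<comment> \<open>Measurability of \<open>h\<close> on cosets is obtained as that of a pointwise
    limit of the measurable quotients.\<close>
  have hm: "(\<lambda>C. h (rep C)) \<in> borel_measurable \<mu>"
    by (rule borel_measurable_LIMSEQ_metric[OF borel_measurable_integrable[OF iq]]) (rule lim)
  show "integrable \<mu> (\<lambda>C. h (rep C))"
    using hm bound by (intro integrable_const_bound[of _ M]) auto
  have "(\<lambda>n. \<integral>C. q n (rep C) \<partial>\<mu>) \<longlonglongrightarrow> (\<integral>C. h (rep C) \<partial>\<mu>)"
    by (rule integral_dominated_convergence[where w = "\<lambda>_. M"])
      (use hm iq lim qb borel_measurable_integrable in auto)
  then show "(\<integral>C. h (rep C) \<partial>\<mu>) = 0" by (simp add: zero LIMSEQ_const_iff)
qed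

text \<open>Meant for two functions whose difference alone is known to be integrable; each by itself
  may fail to descend to cosets.\<close>

lemma coset_integral_cong_null:
  assumes "\<And>x. f x - g x = h x" "integrable \<mu> (\<lambda>C. h (rep C))" "(\<integral>C. h (rep C) \<partial>\<mu>) = 0"
  shows "coset_integral \<mu> f = coset_integral \<mu> g"
  unfolding coset_integral_def rep_def[symmetric]
proof -
  have fg: "f (rep C) = g (rep C) + h (rep C)" for C using assms(1)[of "rep C"] by (simp add: algebra_simps)
  show "(\<integral>C. f (rep C) \<partial>\<mu>) = (\<integral>C. g (rep C) \<partial>\<mu>)"
  proof (cases "integrable \<mu> (\<lambda>C. g (rep C))")
    case True
    then show ?thesis unfolding fg using assms(2,3) by simp
  next
    \<comment> \<open>If \<open>g\<close> is not integrable then neither is \<open>f\<close>, and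
      both Bochner integrals are 0 by convention.\<close>
    case False
    have "\<not> integrable \<mu> (\<lambda>C. f (rep C))"
    proof
      assume "integrable \<mu> (\<lambda>C. f (rep C))"
      from Bochner_Integration.integrable_diff[OF this assms(2)] have "integrable \<mu> (\<lambda>C. g (rep C))"
        unfolding fg by simp
      then show False using False by simp
    qed
    then show ?thesis using False by (simp add: not_integrable_integral_eq)
  qed
qed

end

section \<open>The Dirac operator\<close>

lemma bounded_of_continuous:
  assumes "compact (UNIV :: 'a::topological_space set)" "continuous_on UNIV (f :: 'a \<Rightarrow> 'b::real_normed_vector)"
  obtains M where "\<And>x. norm (f x) \<le> M"
  using compact_imp_bounded[OF compact_continuous_image[OF assms(2,1)]] by (auto simp: bounded_iff)

locale almost_hermitian_spinors = coset_measure G K \<mu>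
  for G :: "('g::{t2_space, second_countable_topology}, 'e::euclidean_space) lie_struct" (structure)
    and K \<mu> +
  fixes g0 :: "'e \<Rightarrow> 'e \<Rightarrow> real" and J :: "'e \<Rightarrow> 'e" and E :: "('e, 's::euclidean_space) ext_alg"
    and chi :: "'g \<Rightarrow> complex" and n :: nat and W :: "nat \<Rightarrow> 'g \<Rightarrow> 'e"
    and B :: "'e \<Rightarrow> 'e \<Rightarrow> real"
  assumes ah: "almost_hermitian G K g0 J" and spinor: "spinor_space (m_space G K) g0 J E"
    and chi: "character G K chi" and W: "standard_module_frame G K g0 n W"
    and B: "inner_product_on UNIV B" "bilinear B" and B_Ad: "\<And>x X Y. B (Ad G x X) (Ad G x Y) = B X Y"
begin

abbreviation m :: "'e set" where "m \<equiv> m_space G K"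

lemma sub: "subspace m" by (rule subspace_m_space)

lemma g0: "inner_product_on m g0"
  and g0_Ad: "s \<in> K \<Longrightarrow> X \<in> m \<Longrightarrow> Y \<in> m \<Longrightarrow> g0 (Ad G s X) (Ad G s Y) = g0 X Y"
  and J: "complex_structure_on m J" and J_Ad: "s \<in> K \<Longrightarrow> X \<in> m \<Longrightarrow> J (Ad G s X) = Ad G s (J X)"
  using ah by (auto simp: almost_hermitian_def)

sublocale S: spinor_module m g0 J E
  by unfold_locales (rule spinor sub g0 J)+

abbreviation \<kappa> :: "'e \<Rightarrow> 's \<Rightarrow> 's" where "\<kappa> \<equiv> clifford m g0 J E"

lemma spinor_isometry_Ad:
  assumes s: "s \<in> K"
  shows "spinor_isometry m g0 J E (Ad G s)"
  by unfold_locales (use m_space_Ad[OF K s] g0_Ad[OF s] J_Ad[OF s] in auto)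

lemma Ad_mem: "s \<in> K \<Longrightarrow> X \<in> m \<Longrightarrow> Ad G s X \<in> m"
  using m_space_Ad[OF K] by blast

section \<open>The vector fields generated by the Lie algebra, and the frame identity\<close>

definition m_basis :: "'e set" where
  "m_basis = (SOME F. finite F \<and> F \<subseteq> m \<and> (\<forall>Y\<in>m. Y = (\<Sum>e\<in>F. g0 e Y *\<^sub>R e)))"

lemma m_basis: "finite m_basis" "m_basis \<subseteq> m" "Y \<in> m \<Longrightarrow> Y = (\<Sum>e\<in>m_basis. g0 e Y *\<^sub>R e)"
proof -
  note s = someI_ex[OF orthonormal_expansion_exists[OF g0 sub], folded m_basis_def]
  show "finite m_basis" "m_basis \<subseteq> m" using s by blast+
  show "Y = (\<Sum>e\<in>m_basis. g0 e Y *\<^sub>R e)" if "Y \<in> m"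
    by (rule bspec[OF conjunct2[OF conjunct2[OF s]] that])
qed

text \<open>The transpose P, written with an expansion family of \<open>g0\<close>;
  \<open>g0_incl_adj\<close> is its characteristic property. It is the \<open>B\<close>-orthogonal
  projection to \<open>m\<close> exactly when \<open>g0\<close> is the restriction of
  \<open>B\<close>.\<close>

definition incl_adj :: "'e \<Rightarrow> 'e" where "incl_adj Z = (\<Sum>e\<in>m_basis. B Z e *\<^sub>R e)"

lemma incl_adj_mem: "incl_adj Z \<in> m"
  unfolding incl_adj_def using m_basis by (intro subspace_sum[OF sub] subspace_scale[OF sub]) auto

lemma linear_incl_adj: "linear incl_adj"
  unfolding incl_adj_def
  by (intro linearI)
    (simp_all add: bilinear_ladd[OF B(2)] bilinear_lmul[OF B(2)] scaleR_left_distrib sum.distrib scaleR_sum_right)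

lemma g0_incl_adj: "Y \<in> m \<Longrightarrow> g0 (incl_adj Z) Y = B Z Y"
proof -
  assume Y: "Y \<in> m"
  have "B Z Y = B Z (\<Sum>e\<in>m_basis. g0 e Y *\<^sub>R e)"
    by (rule arg_cong[OF m_basis(3)[OF Y]])
  also have "\<dots> = (\<Sum>e\<in>m_basis. g0 e Y * B Z e)"
    by (rule inner_product_on_sum_right[OF B(1)]) auto
  also have "\<dots> = g0 (incl_adj Z) Y"
    unfolding incl_adj_def using m_basis(2) by (subst inner_product_on_sum_left[OF g0 sub Y]) (auto simp: mult.commute)
  finally show ?thesis by simp
qed

text \<open>As \<open>B\<close> and \<open>g0\<close> are both invariant under Ad of
  \<open>K\<close>, the two sides have the same \<open>g0\<close>-product with every vector of
  \<open>m\<close>; positivity applied to their difference finishes.\<close>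

lemma incl_adj_Ad:
  assumes s: "s \<in> K"
  shows "incl_adj (Ad G s Z) = Ad G s (incl_adj Z)"
proof -
  have si: "inv s \<in> K" using subgroup.m_inv_closed[OF K s] .
  have *: "g0 (incl_adj (Ad G s Z)) Y = g0 (Ad G s (incl_adj Z)) Y" if Y: "Y \<in> m" for Y
  proof -
    have "g0 (incl_adj (Ad G s Z)) Y = B (Ad G s Z) (Ad G s (Ad G (inv s) Y))" using g0_incl_adj[OF Y] by simp
    also have "\<dots> = B Z (Ad G (inv s) Y)" by (rule B_Ad)
    also have "\<dots> = g0 (incl_adj Z) (Ad G (inv s) Y)" by (rule g0_incl_adj[OF Ad_mem[OF si Y], symmetric])
    also have "\<dots> = g0 (Ad G s (incl_adj Z)) (Ad G s (Ad G (inv s) Y))"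
      by (rule g0_Ad[OF s incl_adj_mem Ad_mem[OF si Y], symmetric])
    finally show ?thesis by simp
  qed
  define d where "d = incl_adj (Ad G s Z) - Ad G s (incl_adj Z)"
  have d: "d \<in> m" unfolding d_def by (intro subspace_diff[OF sub] incl_adj_mem Ad_mem s)
  have "g0 (d + Ad G s (incl_adj Z)) d = g0 d d + g0 (Ad G s (incl_adj Z)) d"
    by (rule inner_product_on_add_left[OF g0 d Ad_mem[OF s incl_adj_mem] d])
  then have "g0 d d = 0" using *[OF d] by (simp add: d_def)
  then have "d = 0" using inner_product_on_pos[OF g0 d] by fastforce
  then show ?thesis by (simp add: d_def)
qed

text \<open>The vector field on the group that generates left translation by exp(tX), in the
  left-invariant trivialisation.\<close>

definition pull :: "'e \<Rightarrow> 'g \<Rightarrow> 'e" where "pull X x = Ad G (inv x) X"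

lemma vector_field_incl_adj: "vector_field G K (\<lambda>x. incl_adj (pull X x))"
  unfolding vector_field_def
proof (intro conjI allI ballI)
  have "smooth_map (atlas G) vector_atlas (\<lambda>x. incl_adj (pull X x))"
  proof (rule smooth_fun_of_charts[OF ch])
    fix c assume c: "c \<in> atlas G"
    have "smooth_on (snd c ` fst c) ((\<lambda>x. pull X x) \<circ> chart_inv c)"
      using smooth_Ad_inv[of X] c unfolding smooth_fun_def smooth_map_def vector_atlas_def pull_def
      by (auto simp: o_def)
    then show "smooth_on (snd c ` fst c) ((\<lambda>x. incl_adj (pull X x)) \<circ> chart_inv c)"
      using smooth_on_bounded_linear_comp[OF is_chart_open(2)[OF chartedD[OF ch c]]
          linear_conv_bounded_linear[THEN iffD1, OF linear_incl_adj]] by (simp add: o_def)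
  qed
  then show "smooth_fun G (\<lambda>x. incl_adj (pull X x))" by (simp add: smooth_fun_def)
  show "incl_adj (pull X x) \<in> m" for x by (rule incl_adj_mem)
  fix x s assume s: "s \<in> K"
  have si: "inv s \<in> K" using subgroup.m_inv_closed[OF K s] .
  have "incl_adj (pull X (x \<otimes> s)) = Ad G (inv s) (incl_adj (pull X x))"
    by (simp add: pull_def inv_mult_group Ad_mult incl_adj_Ad[OF si])
  also have "\<dots> = inv_into m (Ad G s) (incl_adj (pull X x))"
  proof (rule inv_into_f_eq[symmetric])
    show "inj_on (Ad G s) m" by (rule inj_on_inverseI[of _ "Ad G (inv s)"]) simp
  qed (simp_all add: Ad_mem[OF si incl_adj_mem])
  finally show "incl_adj (pull X (x \<otimes> s)) = inv_into m (Ad G s) (incl_adj (pull X x))" .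
qed

lemma W_mem: "j < n \<Longrightarrow> W j x \<in> m"
  using W by (simp add: standard_module_frame_def vector_field_def)

text \<open>To use the frame property at one point, it is applied to the field belonging to X =
  Ad(x) Z, which takes the value \<open>incl_adj Z\<close> at \<open>x\<close>.\<close>

lemma incl_adj_frame: "incl_adj Z = (\<Sum>j<n. B Z (W j x) *\<^sub>R W j x)"
proof -
  have "incl_adj (pull (Ad G x Z) x) = (\<Sum>j<n. g0 (W j x) (incl_adj (pull (Ad G x Z) x)) *\<^sub>R W j x)"
    using W vector_field_incl_adj unfolding standard_module_frame_def by blast
  then have "incl_adj Z = (\<Sum>j<n. g0 (W j x) (incl_adj Z) *\<^sub>R W j x)" by (simp add: pull_def)
  also have "\<dots> = (\<Sum>j<n. B Z (W j x) *\<^sub>R W j x)"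
    using g0_incl_adj W_mem inner_product_on_commute[OF g0 _ incl_adj_mem] by (intro sum.cong) auto
  finally show ?thesis .
qed

definition B_basis :: "'e set" where
  "B_basis = (SOME F. finite F \<and> F \<subseteq> UNIV \<and> (\<forall>Z\<in>UNIV. Z = (\<Sum>X\<in>F. B X Z *\<^sub>R X)))"

lemma B_basis: "finite B_basis" "Z = (\<Sum>X\<in>B_basis. B X Z *\<^sub>R X)"
proof -
  note s = someI_ex[OF orthonormal_expansion_exists[OF B(1) subspace_UNIV], folded B_basis_def]
  show "finite B_basis" using s by blast
  show "Z = (\<Sum>X\<in>B_basis. B X Z *\<^sub>R X)" by (rule bspec[OF conjunct2[OF conjunct2[OF s]] UNIV_I])
qed

text \<open>Invariance of \<open>B\<close> under \<open>Ad\<close> lets the vectors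
  \<open>pull X x\<close> inherit the expansion property of \<open>B_basis\<close> at every
  \<open>x\<close>.\<close>

lemma pull_expand: "Z = (\<Sum>X\<in>B_basis. B (pull X x) Z *\<^sub>R pull X x)"
proof -
  have "Z = Ad G (inv x) (Ad G x Z)" by simp
  also have "\<dots> = Ad G (inv x) (\<Sum>X\<in>B_basis. B X (Ad G x Z) *\<^sub>R X)"
    by (rule arg_cong[OF B_basis(2)])
  also have "\<dots> = (\<Sum>X\<in>B_basis. B X (Ad G x Z) *\<^sub>R pull X x)"
    by (simp add: linear_sum[OF linear_Ad] linear_cmul[OF linear_Ad] pull_def)
  also have "\<dots> = (\<Sum>X\<in>B_basis. B (pull X x) Z *\<^sub>R pull X x)"
    using B_Ad[of x "pull _ x" Z] by (simp add: pull_def)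
  finally show ?thesis .
qed

text \<open>The second slot is expanded in the frame; the coefficients B(pull X x, W j x) then
  reassemble the first slot to \<open>W j x\<close>. In the second slot linearity is asked only on
  combinations of the frame, because Clifford multiplication is controlled only for vectors of
  \<open>m\<close>.\<close>

lemma frame_tensor:
  fixes Q :: "'e \<Rightarrow> 'e \<Rightarrow> complex"
  assumes l: "\<And>w. linear (\<lambda>z. Q z w)"
    and r: "\<And>z c. Q z (\<Sum>j<n. c j *\<^sub>R W j x) = (\<Sum>j<n. c j *\<^sub>R Q z (W j x))"
  shows "(\<Sum>X\<in>B_basis. Q (pull X x) (incl_adj (pull X x))) = (\<Sum>j<n. Q (W j x) (W j x))"
proof -
  have "(\<Sum>X\<in>B_basis. Q (pull X x) (incl_adj (pull X x))) = (\<Sum>X\<in>B_basis. \<Sum>j<n. B (pull X x) (W j x) *\<^sub>R Q (pull X x) (W j x))"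
    unfolding incl_adj_frame[of _ x] r ..
  also have "\<dots> = (\<Sum>j<n. \<Sum>X\<in>B_basis. B (pull X x) (W j x) *\<^sub>R Q (pull X x) (W j x))" by (rule sum.swap)
  also have "\<dots> = (\<Sum>j<n. Q (W j x) (W j x))"
  proof (rule sum.cong)
    fix j
    have "Q (W j x) w = (\<Sum>X\<in>B_basis. B (pull X x) (W j x) *\<^sub>R Q (pull X x) w)" for w
    proof -
      have "Q (W j x) w = Q (\<Sum>X\<in>B_basis. B (pull X x) (W j x) *\<^sub>R pull X x) w"
        by (rule arg_cong[OF pull_expand])
      then show ?thesis by (simp add: linear_sum[OF l] linear_cmul[OF l])
    qed
    then show "(\<Sum>X\<in>B_basis. B (pull X x) (W j x) *\<^sub>R Q (pull X x) (W j x)) = Q (W j x) (W j x)" by simp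
  qed simp
  finally show ?thesis .
qed

lemma linear_clifford: "X \<in> m \<Longrightarrow> linear (\<kappa> X)"
  using S.clinearD[OF S.clinear_clifford] by (intro linearI) auto

lemma bounded_linear_clifford: "X \<in> m \<Longrightarrow> bounded_linear (\<kappa> X)"
  using linear_clifford linear_conv_bounded_linear by blast

lemma clifford_incl_adj: "\<kappa> (incl_adj Z) v = (\<Sum>e\<in>m_basis. B Z e *\<^sub>R \<kappa> e v)"
  unfolding incl_adj_def using m_basis(2) by (intro S.clifford_sum) auto

lemma continuous_pull: "continuous_on UNIV (pull X)"
  unfolding pull_def[abs_def] by (rule smooth_fun_continuous[OF smooth_Ad_inv])

text \<open>Expansion over the fixed \<open>m_basis\<close> turns the moving vector into scalar
  coefficients of finitely many fixed Clifford operators.\<close>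

lemma continuous_clifford_incl_adj:
  assumes "continuous_on UNIV v" "continuous_on UNIV Z"
  shows "continuous_on UNIV (\<lambda>x::'g. \<kappa> (incl_adj (Z x)) (v x))"
proof -
  have "bounded_linear (\<lambda>Z. B Z e)" for e
    using B(2) unfolding bilinear_def by (simp add: linear_conv_bounded_linear)
  then show ?thesis
    unfolding clifford_incl_adj using m_basis(2)
    by (intro continuous_on_sum continuous_on_scaleR bounded_linear.continuous_on[OF _ assms(2)]
        bounded_linear.continuous_on[OF bounded_linear_clifford assms(1)]) auto
qed

lemma continuous_lder:
  assumes f: "smooth_fun G f" and Z: "continuous_on UNIV Z"
  shows "continuous_on UNIV (\<lambda>x. lder f x (Z x))"
proof -
  have "continuous_on UNIV (\<lambda>x. \<Sum>b\<in>Basis. (Z x \<bullet> b) *\<^sub>R lder f x b)"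
    by (intro continuous_on_sum continuous_on_scaleR continuous_on_inner Z continuous_on_const
        smooth_fun_continuous[OF lder_smooth[OF f]])
  moreover have "lder f x (Z x) = (\<Sum>b\<in>Basis. (Z x \<bullet> b) *\<^sub>R lder f x b)" for x
    by (rule linear_euclidean_expand[OF linear_lder[OF f]])
  ultimately show ?thesis by presburger
qed

section \<open>Integration by parts for a pair of spinor fields\<close>

context
  fixes \<psi> \<phi> :: "'g \<Rightarrow> 's"
  assumes \<psi>: "spinor_field G K chi E \<psi>" and \<phi>: "spinor_field G K chi E \<phi>"
begin

lemma sm: "smooth_fun G \<psi>" "smooth_fun G \<phi>"
  using \<psi> \<phi> by (auto simp: spinor_field_def)

definition flux :: "'e \<Rightarrow> 'g \<Rightarrow> complex" where
  "flux X x = ip E (\<psi> x) (\<kappa> (incl_adj (pull X x)) (\<phi> x))"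

definition flux_deriv :: "'e \<Rightarrow> 'g \<Rightarrow> complex" where
  "flux_deriv X x = ip E (\<psi> x) (\<kappa> (incl_adj (pull X x)) (lder \<phi> x (pull X x))) + ip E (lder \<psi> x (pull X x)) (\<kappa> (incl_adj (pull X x)) (\<phi> x))"

lemma right_invariant_flux: "right_invariant (flux X)"
  unfolding right_invariant_def
proof (intro allI ballI)
  fix x s assume s: "s \<in> K"
  interpret T: spinor_isometry m g0 J E "Ad G s" by (rule spinor_isometry_Ad[OF s])
  have si: "inv s \<in> K" using subgroup.m_inv_closed[OF K s] .
  have "norm (cnj (chi s)) = 1" using chi s by (simp add: character_def)
  moreover have "incl_adj (pull X (x \<otimes> s)) = Ad G (inv s) (incl_adj (pull X x))"
    by (simp add: pull_def inv_mult_group Ad_mult incl_adj_Ad[OF si])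
  ultimately show "flux X (x \<otimes> s) = flux X x"
    using T.ip_clifford_equivariant[OF Ad_mem[OF si incl_adj_mem[of "pull X x"]], of "cnj (chi s)" "\<psi> x" "\<phi> x"] \<psi> \<phi> s
    by (simp add: flux_def spinor_field_def)
qed

lemma continuous_flux: "continuous_on UNIV (flux X)"
  unfolding flux_def
  by (intro bounded_bilinear.continuous_on[OF S.bounded_bilinear_ip] continuous_clifford_incl_adj continuous_pull
      smooth_fun_continuous sm)

lemma continuous_flux_deriv: "continuous_on UNIV (flux_deriv X)"
  unfolding flux_deriv_def
  by (intro continuous_on_add bounded_bilinear.continuous_on[OF S.bounded_bilinear_ip]
      continuous_clifford_incl_adj continuous_pull continuous_lder smooth_fun_continuous sm)

text \<open>Along the flow of \<open>X\<close> by left translations, \<open>pull X\<close> is constant.\<close>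

lemma flux_derivative:
  assumes \<gamma>: "one_parameter_subgroup G X \<gamma>"
  shows "((\<lambda>t. flux X (\<gamma> t \<otimes> x)) has_vector_derivative flux_deriv X (\<gamma> t \<otimes> x)) (at t)"
proof -
  \<comment> \<open>The inverse of \<gamma>(t) is \<gamma>(-t), and Ad of it fixes
    \<open>X\<close>.\<close>
  have Yc: "pull X (\<gamma> t \<otimes> x) = pull X x" for t
    using Ad_one_parameter_subgroup[OF \<gamma>, of "- t"] one_parameter_subgroupD(5)[OF \<gamma>, of t]
    by (simp add: pull_def inv_mult_group Ad_mult)
  have d: "((\<lambda>t. u (\<gamma> t \<otimes> x)) has_vector_derivative lder u (\<gamma> t \<otimes> x) (pull X x)) (at t)"
    if "smooth_fun G u" for u :: "'g \<Rightarrow> 's"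
    using left_flow_derivative[OF that \<gamma>, of x t] Yc[of t] by (simp add: pull_def)
  have "((\<lambda>t. ip E (\<psi> (\<gamma> t \<otimes> x)) (\<kappa> (incl_adj (pull X x)) (\<phi> (\<gamma> t \<otimes> x)))) has_vector_derivative
      ip E (\<psi> (\<gamma> t \<otimes> x)) (\<kappa> (incl_adj (pull X x)) (lder \<phi> (\<gamma> t \<otimes> x) (pull X x))) +
      ip E (lder \<psi> (\<gamma> t \<otimes> x) (pull X x)) (\<kappa> (incl_adj (pull X x)) (\<phi> (\<gamma> t \<otimes> x)))) (at t)"
    by (intro bounded_bilinear.has_vector_derivative[OF S.bounded_bilinear_ip] d sm
        bounded_linear.has_vector_derivative[OF bounded_linear_clifford[OF incl_adj_mem]])
  then show ?thesis by (simp add: flux_def flux_deriv_def Yc)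
qed

lemma integral_flux_deriv: "integrable \<mu> (\<lambda>C. flux_deriv X (rep C))" "(\<integral>C. flux_deriv X (rep C) \<partial>\<mu>) = 0"
proof -
  obtain M where M: "\<And>x. norm (flux_deriv X x) \<le> M"
    using bounded_of_continuous[OF compact continuous_flux_deriv[of X]] by blast
  note i = integral_left_flow_derivative[OF right_invariant_flux continuous_flux one_parameter_subgroup_exp
      flux_derivative[OF one_parameter_subgroup_exp], of X M]
  show "integrable \<mu> (\<lambda>C. flux_deriv X (rep C))" "(\<integral>C. flux_deriv X (rep C) \<partial>\<mu>) = 0" using i M by auto
qed

lemma sum_flux_deriv:
  "ip E (\<psi> x) (dirac G K g0 J E n W \<phi> x) - ip E (dirac G K g0 J E n W \<psi> x) (\<phi> x) = (\<Sum>X\<in>B_basis. flux_deriv X x)"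
proof -
  have bil: "linear (ip E u)" "linear (\<lambda>v. ip E v u)" for u
    by (auto intro!: linearI simp: S.ip_add_right S.ip_add_left S.ip_scaleR)
  have cs: "\<kappa> (\<Sum>j<n. c j *\<^sub>R W j x) v = (\<Sum>j<n. c j *\<^sub>R \<kappa> (W j x) v)" for c v
    by (rule S.clifford_sum) (simp add: W_mem)
  have 1: "(\<Sum>X\<in>B_basis. ip E (\<psi> x) (\<kappa> (incl_adj (pull X x)) (lder \<phi> x (pull X x)))) =
      (\<Sum>j<n. ip E (\<psi> x) (\<kappa> (W j x) (lder \<phi> x (W j x))))"
  proof -
    \<comment> \<open>\<open>frame_tensor\<close> asks for linearity in the first slot at every
      \<open>w\<close>, while \<open>\<kappa> w\<close> is known to be linear only for
      \<open>w\<close> in \<open>m\<close>. Off \<open>m\<close> the form is set to 0; all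
      evaluations below are at vectors of \<open>m\<close>.\<close>
    define Q where "Q z w = (if w \<in> m then ip E (\<psi> x) (\<kappa> w (lder \<phi> x z)) else 0)" for z w
    have "(\<Sum>X\<in>B_basis. Q (pull X x) (incl_adj (pull X x))) = (\<Sum>j<n. Q (W j x) (W j x))"
    proof (rule frame_tensor)
      show "linear (\<lambda>z. Q z w)" for w
      proof (cases "w \<in> m")
        case True
        then show ?thesis
          using linear_compose[OF linear_compose[OF linear_lder[OF sm(2)] linear_clifford[OF True]] bil(1)]
          by (simp add: Q_def o_def)
      qed (simp add: Q_def linear_zero)
      show "Q z (\<Sum>j<n. c j *\<^sub>R W j x) = (\<Sum>j<n. c j *\<^sub>R Q z (W j x))" for z c
      proof -
        have "(\<Sum>j<n. c j *\<^sub>R W j x) \<in> m"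
          by (intro subspace_sum[OF sub] subspace_scale[OF sub]) (simp add: W_mem)
        then show ?thesis by (simp add: Q_def cs W_mem S.ip_sum_right S.ip_scaleR)
      qed
    qed
    then show ?thesis by (simp add: Q_def incl_adj_mem W_mem)
  qed
  \<comment> \<open>Here the first slot enters through the derivative of \<open>\<psi>\<close> only,
    paired with a fixed vector, so linearity holds at every \<open>w\<close> without a
    cut-off.\<close>
  have 2: "(\<Sum>X\<in>B_basis. ip E (lder \<psi> x (pull X x)) (\<kappa> (incl_adj (pull X x)) (\<phi> x))) =
      (\<Sum>j<n. ip E (lder \<psi> x (W j x)) (\<kappa> (W j x) (\<phi> x)))"
  proof (rule frame_tensor)
    show "linear (\<lambda>z. ip E (lder \<psi> x z) (\<kappa> w (\<phi> x)))" for w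
      using linear_compose[OF linear_lder[OF sm(1)] bil(2)] by (simp add: o_def)
  qed (simp add: cs S.ip_sum_right S.ip_scaleR)
  have "(\<Sum>X\<in>B_basis. flux_deriv X x) = (\<Sum>j<n. ip E (\<psi> x) (\<kappa> (W j x) (lder \<phi> x (W j x)))) +
      (\<Sum>j<n. ip E (lder \<psi> x (W j x)) (\<kappa> (W j x) (\<phi> x)))"
    unfolding flux_deriv_def sum.distrib 1 2 ..
  also have "(\<Sum>j<n. ip E (lder \<psi> x (W j x)) (\<kappa> (W j x) (\<phi> x))) =
      - (\<Sum>j<n. ip E (\<kappa> (W j x) (lder \<psi> x (W j x))) (\<phi> x))"
    unfolding sum_negf[symmetric] by (intro sum.cong) (simp_all add: S.ip_clifford[OF W_mem])
  finally show ?thesis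
    by (simp add: dirac_def canonical_connection_eq sm S.ip_sum_right S.ip_sum_left)
qed

lemma spinor_inner_dirac:
  "spinor_inner E \<mu> (dirac G K g0 J E n W \<psi>) \<phi> = spinor_inner E \<mu> \<psi> (dirac G K g0 J E n W \<phi>)"
  unfolding spinor_inner_def
proof (rule coset_integral_cong_null[symmetric])
  show "ip E (\<psi> x) (dirac G K g0 J E n W \<phi> x) - ip E (dirac G K g0 J E n W \<psi> x) (\<phi> x) = (\<Sum>X\<in>B_basis. flux_deriv X x)" for x
    by (rule sum_flux_deriv)
  show "integrable \<mu> (\<lambda>C. \<Sum>X\<in>B_basis. flux_deriv X (rep C))"
    by (intro Bochner_Integration.integrable_sum integral_flux_deriv)
  show "(\<integral>C. (\<Sum>X\<in>B_basis. flux_deriv X (rep C)) \<partial>\<mu>) = 0"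
    by (simp add: Bochner_Integration.integral_sum[OF integral_flux_deriv(1)] integral_flux_deriv(2))
qed

end

end

theorem corollary6p6:
  fixes G :: "('g::{t2_space, second_countable_topology}, 'e::euclidean_space) lie_struct"
    and K :: "'g set"
    and g0 :: "'e \<Rightarrow> 'e \<Rightarrow> real"
    and J :: "'e \<Rightarrow> 'e"
    and E :: "('e, 's::euclidean_space) ext_alg"
    and chi :: "'g \<Rightarrow> complex"
    and \<mu> :: "'g set measure"
    and n :: nat
    and W :: "nat \<Rightarrow> 'g \<Rightarrow> 'e"
  assumes "lie_group G"
    and "connected (UNIV :: 'g set)"
    and "compact (UNIV :: 'g set)"
    and "semisimple G"
    and "subgroup K G"
    and "closed K"
    and "almost_hermitian G K g0 J"
    and "spinor_space (m_space G K) g0 J E"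
    and "character G K chi"
    and "invariant_measure G K \<mu>"
    and "standard_module_frame G K g0 n W"
  shows "formally_self_adjoint G K chi E \<mu> (dirac G K g0 J E n W)"
proof -
  interpret lie_grp G by unfold_locales (rule assms(1))
  obtain B where B: "inner_product_on UNIV B" "bilinear B" "\<And>x X Y. B (Ad G x X) (Ad G x Y) = B X Y"
    using Ad_invariant_inner_product[OF assms(3)] by metis
  interpret almost_hermitian_spinors G K \<mu> g0 J E chi n W B
    by unfold_locales (use assms B subgroup.m_closed[OF assms(5)] subgroup.one_closed[OF assms(5)]
        subgroup.m_inv_closed[OF assms(5)] in auto)
  show ?thesis
    unfolding formally_self_adjoint_def using spinor_inner_dirac by blast
qed

end
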